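(* Consider the dynamic policy choice game described in the context, with true time lag $k^*\ge1$, state space $\mathcal{F}=\{F_0,F_1\}$ and common full-support prior $\pi_0\in\Delta(\mathcal{F})$. If $\pi_0$ is such that the agent is not indifferent between action $0$ and action $1$ at any history $h^t$, then $$\overline{V}=\underline{V}=\pi_0(F_1)+\pi_0(F_0)\,q^*\lambda.$$
   Context: Let $A=\{0,1\}$, $Y$ a finite set, $v:Y\to\mathbb{R}$, and $k^*\ge1$ an integer. A state $F=\{F(\cdot|a)\}_{a\in A}$ assigns to each $a\in A$ a probability distribution $F(\cdot|a)$ on $Y$. There are two states, $\mathcal{F}=\{F_0,F_1\}$, with $F_i(\cdot|a)$ of full support for all $i,a$, and $F_0(\cdot|a)\ne F_1(\cdot|a)$ for every $a\in A$. Assume $\sum_y v(y)F_1(y|1)>\sum_y v(y)F_1(y|0)$ and $\sum_y v(y)F_0(y|0)>\sum_y v(y)F_0(y|1)$. The principal and the agent share a prior $\pi_0\in\Delta(\mathcal{F})$ with full support. Game: in each period $t=1,2,\dots$ the principal proposes $\widetilde a_t\in A$. If $\widetilde a_t=0$ then $a_t=0$. If $\widetilde a_t=1$, the agent either accepts ($a_t=1$) or vetoes ($a_t=0$). Then an outcome $y_t\in Y$ is publicly observed. Actions before the first period are exogenously given. If the true state is $F$, then conditional on the past $y_t\sim F(\cdot|a_{t-k^*})$; the principal knows this. The agent (wrongly) believes that $y_t\sim F(\cdot|a_t)$. Histories $h^t$ consist of all past proposals, actions and outcomes; $\mathcal{H}$ is the set of histories. A principal strategy is $\sigma_p:\mathcal{H}\to[0,1]$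 (probability of proposing 1), with set $\Sigma_p$; an agent strategy is $\sigma_a:\mathcal{H}\to[0,1]$ (probability of accepting action 1 when proposed). Agent: the agent's posterior before period $t$'s outcome is computed by Bayes' rule from his subjective model and does not depend on proposals or on $\sigma_p$: $\pi_t(F)\propto\pi_0(F)\prod_{s<t}F(y_s|a_s)$ (product over past periods of the game). The agent is myopic: at $h^t$ he strictly prefers action 1 if $\sum_{F}\pi_t(F)\sum_y v(y)F(y|1)>\sum_F\pi_t(F)\sum_y v(y)F(y|0)$, strictly prefers action 0 if the inequality is reversed, and is indifferent in case of equality. When he is never indifferent, his optimal strategy is unique and is denoted $\sigma_a^*$ (accept iff action 1 is strictly preferred). Principal: with the state drawn from $\pi_0$, $$\underline V(\sigma_p)=\liminf_{t\to\infty}\frac1t\mathbb{E}^{(\sigma_p,\sigma_a^* )}\Big[\sum_{s=1}^t a_s\Big],\qquad \overline V(\sigma_p)=\limsup_{t\to\infty}\frac1t\mathbb{E}^{(\sigma_p,\sigma_a^* )}\Big[\sum_{s=1}^t a_s\Big],$$ $\underline V=\sup_{\sigma_p\in\Sigma_p}\underline V(\sigma_p)$, $\overline V=\sup_{\sigma_p\in\Sigma_p}\overline V(\sigma_p)$. Definition of $q^*$: let $\mathcal{E}^*$ be the event that there exists $t$ such that for every $s\ge t$, $\sum_{F}\pi_s(F)\sum_y v(y)F(y|1)>\sum_F\pi_s(F)\sum_y v(y)F(y|0)$. Then $q^*=\sup_{\sigma_p\in\Sigma_p}\Pr(\mathcal{E}^*\mid\sigma_p,\sigma_a^*,F_0)$,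 where the probability is under the true process when the true state is $F_0$. Definition of $\lambda$: for $a,a'\in A$ let $X_{a\to a'}$ be the random variable equal to $\log\frac{F_1(y|a')}{F_0(y|a')}$ with probability $F_0(y|a)$, $y\in Y$. Then $$\lambda=\sup\Big\{\frac{\widehat\lambda+1}{\widehat\lambda+2}\ :\ \widehat\lambda\ge0,\ \widehat\lambda\,\mathbb{E}[X_{1\to1}]+\mathbb{E}[X_{1\to0}]+\mathbb{E}[X_{0\to1}]>0\Big\},$$ and $\lambda=0$ if no $\widehat\lambda\ge0$ satisfies the constraint. *)

theory Defs
  imports "HOL-Probability.Probability"
begin

text \<open>
  Actions are booleans, with \<open>True\<close> standing for action 1 and \<open>False\<close> for action 0.
  A state assigns to each action a distribution of outcomes.
  One period of play is recorded as a triple (proposal, action, outcome), and a history is the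
  chronological list of past periods: the history at the start of period \<open>t\<close> has length \<open>t - 1\<close>.
\<close>

type_synonym 'y state = "bool \<Rightarrow> 'y pmf"
type_synonym 'y period = "bool \<times> bool \<times> 'y"
type_synonym 'y history = "'y period list"
type_synonym 'y strategy = "'y history \<Rightarrow> real"

abbreviation proposal :: "'y period \<Rightarrow> bool" where "proposal x \<equiv> fst x"
abbreviation action :: "'y period \<Rightarrow> bool" where "action x \<equiv> fst (snd x)"
abbreviation outcome :: "'y period \<Rightarrow> 'y" where "outcome x \<equiv> snd (snd x)"

definition histories :: "'y history set" where
  "histories = {h. \<forall>x\<in>set h. \<not> proposal x \<longrightarrow> \<not> action x}"

definition strategies :: "'y strategy set" where
  "strategies = histories \<rightarrow> {0..1}"


subsection \<open>The agent\<close>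

definition payoff :: "('y::finite \<Rightarrow> real) \<Rightarrow> 'y state \<Rightarrow> bool \<Rightarrow> real" where
  "payoff v F a = (\<Sum>y\<in>UNIV. v y * pmf (F a) y)"

definition likelihood :: "'y state \<Rightarrow> 'y history \<Rightarrow> real" where
  "likelihood F h = (\<Prod>x\<leftarrow>h. pmf (F (action x)) (outcome x))"

text \<open>The state space is the support of the prior.\<close>

definition posterior :: "'y state pmf \<Rightarrow> 'y history \<Rightarrow> 'y state \<Rightarrow> real" where
  "posterior \<pi>0 h F =
     pmf \<pi>0 F * likelihood F h / (\<Sum>G\<in>set_pmf \<pi>0. pmf \<pi>0 G * likelihood G h)"

definition subjective_payoff ::
  "('y::finite \<Rightarrow> real) \<Rightarrow> 'y state pmf \<Rightarrow> 'y history \<Rightarrow> bool \<Rightarrow> real" where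
  "subjective_payoff v \<pi>0 h a = (\<Sum>F\<in>set_pmf \<pi>0. posterior \<pi>0 h F * payoff v F a)"

definition prefers1 :: "('y::finite \<Rightarrow> real) \<Rightarrow> 'y state pmf \<Rightarrow> 'y history \<Rightarrow> bool" where
  "prefers1 v \<pi>0 h \<longleftrightarrow> subjective_payoff v \<pi>0 h True > subjective_payoff v \<pi>0 h False"

definition indifferent :: "('y::finite \<Rightarrow> real) \<Rightarrow> 'y state pmf \<Rightarrow> 'y history \<Rightarrow> bool" where
  "indifferent v \<pi>0 h \<longleftrightarrow> subjective_payoff v \<pi>0 h True = subjective_payoff v \<pi>0 h False"

definition agent_opt :: "('y::finite \<Rightarrow> real) \<Rightarrow> 'y state pmf \<Rightarrow> 'y strategy" where
  "agent_opt v \<pi>0 h = (if prefers1 v \<pi>0 h then 1 else 0)"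


subsection \<open>The law of play\<close>

text \<open>
  \<open>past_action init h s\<close> is the action of period \<open>s\<close>, where periods \<open>s \<ge> 1\<close> are read off the
  history and \<open>init s\<close> is the exogenous action for \<open>s \<le> 0\<close>.
\<close>

definition past_action :: "(int \<Rightarrow> bool) \<Rightarrow> 'y history \<Rightarrow> int \<Rightarrow> bool" where
  "past_action init h s = (if s \<ge> 1 then action (h ! nat (s - 1)) else init s)"

text \<open>
  The true law of period \<open>length h + 1\<close> given the history \<open>h\<close>. For \<open>k \<ge> 1\<close> the lagged action is
  always a past one, so the outcome does not depend on the current action.
\<close>

definition period_pmf ::
  "nat \<Rightarrow> (int \<Rightarrow> bool) \<Rightarrow> 'y state \<Rightarrow> 'y strategy \<Rightarrow> 'y strategy \<Rightarrow> 'y history \<Rightarrow> 'y period pmf"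
where
  "period_pmf k init F \<sigma>p \<sigma>a h =
     bind_pmf (bernoulli_pmf (\<sigma>p h)) (\<lambda>p.
     bind_pmf (if p then bernoulli_pmf (\<sigma>a h) else return_pmf False) (\<lambda>a.
     bind_pmf (F (past_action init h (int (length h) + 1 - int k))) (\<lambda>y.
     return_pmf (p, a, y))))"

text \<open>
  An infinite play is a sequence of periods, where \<open>\<omega> s\<close> is the record of period \<open>s + 1\<close>.
\<close>

abbreviation prefix :: "(nat \<Rightarrow> 'y period) \<Rightarrow> nat \<Rightarrow> 'y history" where
  "prefix \<omega> n \<equiv> map \<omega> [0..<n]"

abbreviation play_algebra :: "nat \<Rightarrow> 'y period measure" where
  "play_algebra \<equiv> (\<lambda>_. count_space UNIV)"

definition kernel ::
  "nat \<Rightarrow> (int \<Rightarrow> bool) \<Rightarrow> 'y state \<Rightarrow> 'y strategy \<Rightarrow> 'y strategy \<Rightarrow>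
     nat \<Rightarrow> (nat \<Rightarrow> 'y period) \<Rightarrow> 'y period measure"
where
  "kernel k init F \<sigma>p \<sigma>a n \<omega> = measure_pmf (period_pmf k init F \<sigma>p \<sigma>a (prefix \<omega> n))"

text \<open>The Ionescu-Tulcea limit of these kernels.\<close>

definition play_measure ::
  "nat \<Rightarrow> (int \<Rightarrow> bool) \<Rightarrow> 'y state \<Rightarrow> 'y strategy \<Rightarrow> 'y strategy \<Rightarrow> (nat \<Rightarrow> 'y period) measure"
where
  "play_measure k init F \<sigma>p \<sigma>a =
     projective_family.lim UNIV
       (Ionescu_Tulcea.CI (kernel k init F \<sigma>p \<sigma>a) play_algebra) play_algebra"

lemma Ionescu_Tulcea_kernel:
  fixes F :: "('y::finite) state"
  shows "Ionescu_Tulcea (kernel k init F \<sigma>p \<sigma>a) play_algebra"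
proof (unfold Ionescu_Tulcea_def, intro conjI allI impI)
  fix i
  have "PiM {0..<i} (play_algebra :: nat \<Rightarrow> 'y period measure)
      = count_space (PiE {0..<i} (\<lambda>_. UNIV))"
    by (rule count_space_PiM_finite) auto
  then show "kernel k init F \<sigma>p \<sigma>a i \<in>
      measurable (PiM {0..<i} play_algebra) (subprob_algebra (count_space UNIV))"
    by (auto simp: kernel_def measure_pmf_in_subprob_algebra)
next
  fix i and x :: "nat \<Rightarrow> 'y period"
  show "prob_space (kernel k init F \<sigma>p \<sigma>a i x)"
    by (simp add: kernel_def measure_pmf.prob_space_axioms)
qed

lemma sets_play_measure [simp, measurable_cong]:
  fixes F :: "('y::finite) state"
  shows "sets (play_measure k init F \<sigma>p \<sigma>a) = sets (PiM UNIV play_algebra)"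
proof -
  interpret Ionescu_Tulcea "kernel k init F \<sigma>p \<sigma>a" play_algebra
    by (rule Ionescu_Tulcea_kernel)
  show ?thesis by (simp add: play_measure_def)
qed

lemma prob_space_play_measure:
  fixes F :: "('y::finite) state"
  shows "prob_space (play_measure k init F \<sigma>p \<sigma>a)"
proof -
  interpret Ionescu_Tulcea "kernel k init F \<sigma>p \<sigma>a" play_algebra
    by (rule Ionescu_Tulcea_kernel)
  interpret CI0: prob_space "CI {}"
    by (rule PF.prob_space_P) auto
  have "PF.emb UNIV {} {\<lambda>_. undefined} = UNIV"
    by (auto simp: prod_emb_def space_PiM)
  moreover have "emeasure PF.lim (PF.emb UNIV {} {\<lambda>_. undefined}) = emeasure (CI {}) (space (CI {}))"
    by (subst lim) (auto simp: PiM_empty PF.space_P space_PiM)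
  ultimately show ?thesis
    by (intro prob_spaceI)
       (simp add: play_measure_def PF.space_lim space_PiM CI0.emeasure_space_1)
qed

text \<open>The law of play when the state is drawn from the prior.\<close>

definition ex_ante_measure ::
  "nat \<Rightarrow> (int \<Rightarrow> bool) \<Rightarrow> 'y state pmf \<Rightarrow> 'y strategy \<Rightarrow> 'y strategy \<Rightarrow> (nat \<Rightarrow> 'y period) measure"
where
  "ex_ante_measure k init \<pi>0 \<sigma>p \<sigma>a =
     measure_pmf \<pi>0 \<bind> (\<lambda>F. play_measure k init F \<sigma>p \<sigma>a)"


subsection \<open>The principal's values\<close>

definition avg_payoff ::
  "('y::finite \<Rightarrow> real) \<Rightarrow> nat \<Rightarrow> (int \<Rightarrow> bool) \<Rightarrow> 'y state pmf \<Rightarrow> 'y strategy \<Rightarrow> nat \<Rightarrow> real"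
where
  "avg_payoff v k init \<pi>0 \<sigma>p t =
     1 / real t *
       (\<integral>\<omega>. (\<Sum>s<t. of_bool (action (\<omega> s))) \<partial>ex_ante_measure k init \<pi>0 \<sigma>p (agent_opt v \<pi>0))"

definition lower_value ::
  "('y::finite \<Rightarrow> real) \<Rightarrow> nat \<Rightarrow> (int \<Rightarrow> bool) \<Rightarrow> 'y state pmf \<Rightarrow> ereal"
where
  "lower_value v k init \<pi>0 =
     (SUP \<sigma>p\<in>strategies. liminf (\<lambda>t. ereal (avg_payoff v k init \<pi>0 \<sigma>p t)))"

definition upper_value ::
  "('y::finite \<Rightarrow> real) \<Rightarrow> nat \<Rightarrow> (int \<Rightarrow> bool) \<Rightarrow> 'y state pmf \<Rightarrow> ereal"
where
  "upper_value v k init \<pi>0 =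
     (SUP \<sigma>p\<in>strategies. limsup (\<lambda>t. ereal (avg_payoff v k init \<pi>0 \<sigma>p t)))"


subsection \<open>The quantities q* and lambda\<close>

definition conviction_event ::
  "('y::finite \<Rightarrow> real) \<Rightarrow> 'y state pmf \<Rightarrow> (nat \<Rightarrow> 'y period) set"
where
  "conviction_event v \<pi>0 = {\<omega>. \<exists>t. \<forall>s\<ge>t. prefers1 v \<pi>0 (prefix \<omega> s)}"

lemma measurable_prefix:
  "(\<lambda>\<omega>. prefix \<omega> n) \<in>
     measurable (PiM UNIV (play_algebra :: nat \<Rightarrow> ('y::finite) period measure)) (count_space UNIV)"
proof (induction n)
  case (Suc n)
  note [measurable] = Suc.IH
  have "(\<lambda>\<omega>. prefix \<omega> n @ [\<omega> n]) \<in>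
      measurable (PiM UNIV (play_algebra :: nat \<Rightarrow> 'y period measure)) (count_space UNIV)"
    by measurable
  then show ?case by simp
qed simp

lemma conviction_event_sets:
  "conviction_event v \<pi>0 \<in> sets (play_measure k init F \<sigma>p \<sigma>a)"
proof -
  note [measurable] = measurable_prefix
  have "{\<omega> \<in> space (PiM UNIV play_algebra). \<exists>t. \<forall>s\<ge>t. prefers1 v \<pi>0 (prefix \<omega> s)}
      \<in> sets (PiM UNIV play_algebra)"
    by measurable
  then show ?thesis by (simp add: conviction_event_def space_PiM)
qed

definition q_star ::
  "('y::finite \<Rightarrow> real) \<Rightarrow> nat \<Rightarrow> (int \<Rightarrow> bool) \<Rightarrow> 'y state pmf \<Rightarrow> 'y state \<Rightarrow> real"
where
  "q_star v k init \<pi>0 F0 =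
     (SUP \<sigma>p\<in>strategies.
        measure (play_measure k init F0 \<sigma>p (agent_opt v \<pi>0)) (conviction_event v \<pi>0))"

text \<open>
  \<open>expected_llr F0 F1 a b\<close> is the mean of \<open>X\<close> from \<open>a\<close> to \<open>b\<close>: outcomes are generated
  by action \<open>a\<close> in state \<open>F0\<close> but interpreted as generated by action \<open>b\<close>.
\<close>

definition llr :: "'y state \<Rightarrow> 'y state \<Rightarrow> bool \<Rightarrow> 'y \<Rightarrow> real" where
  "llr F0 F1 b y = ln (pmf (F1 b) y / pmf (F0 b) y)"

definition expected_llr :: "'y state \<Rightarrow> 'y state \<Rightarrow> bool \<Rightarrow> bool \<Rightarrow> real" where
  "expected_llr F0 F1 a b = measure_pmf.expectation (F0 a) (llr F0 F1 b)"

definition lambda_feasible :: "'y state \<Rightarrow> 'y state \<Rightarrow> real set" where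
  "lambda_feasible F0 F1 =
     {l. l \<ge> 0 \<and>
         l * expected_llr F0 F1 True True + expected_llr F0 F1 True False
           + expected_llr F0 F1 False True > 0}"

definition lambda_star :: "'y state \<Rightarrow> 'y state \<Rightarrow> real" where
  "lambda_star F0 F1 =
     (if lambda_feasible F0 F1 = {} then 0
      else (SUP l\<in>lambda_feasible F0 F1. (l + 1) / (l + 2)))"

end

theory Submission
  imports Defs "HOL-Real_Asymp.Real_Asymp"
begin

text \<open>
  Let the score be the agent's subjective log-likelihood ratio of \<open>F1\<close> against \<open>F0\<close>, shifted so that
  he prefers action 1 iff it is positive. While the score is negative only action 0 is played, and
  after \<open>k\<close> such periods the agent's model is correct. Hence in state \<open>F0\<close> a negative score stays
  negative with probability bounded away from zero, and by a zero-one argument the score is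
  eventually of constant sign; on the event \<open>\<E>\<^sup>*\<close> of eventual conviction it even tends to infinity.
  In state \<open>F1\<close> the same argument applied to the negative score shows that proposing action 1 forever
  makes the agent accept eventually.

  Upper bound: in state \<open>F0\<close> the score is a martingale plus a drift that is linear in the numbers of
  the four transitions from the lagged to the current action. The numbers of the transitions
  \<open>0 \<rightarrow> 1\<close> and \<open>1 \<rightarrow> 0\<close> differ by at most \<open>k\<close>, so linear programming duality turns positivity of the
  score into the bound \<open>\<lambda>\<close> for the frequency of action 1.

  Lower bound: the principal plays a nearly optimal strategy for conviction until the score is
  high and the correctly specified likelihood ratio has revealed the state. In state \<open>F0\<close> a cyclic
  pattern with positive drift then keeps the score positive forever with high probability.
\<close>

section \<open>Finite-horizon laws of play\<close>

text \<open>In state \<open>F0\<close> an outcome credited to the action that generated it lowers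
  the score on average, because \<open>e a a\<close> is minus a relative entropy. Only
  misattribution at a switch can raise it. So one \<open>1 \<rightarrow> 0\<close> and one
  \<open>0 \<rightarrow> 1\<close> transition together must pay for as many
  \<open>1 \<rightarrow> 1\<close> transitions as possible; if they pay for x of them, action 1 is
  used in x + 1 of x + 2 periods, the expression inside \<lambda>.

  Two gaps lie between the conviction probability and the value. Conviction asks only for a positive
  score, while the cyclic pattern protects only a high one; divergence of the score closes this gap.
  And the score is misspecified, so it cannot tell the principal the state; a second likelihood
  ratio, built from the lagged actions, does so under any play.

  All estimates are made on finite histories, where laws are finitely supported and expectations are
  finite sums. Infinite play enters only through its prefixes, and approximation by cylinder events
  takes the place of conditional expectations and their convergence.\<close>

lemma finite_type_lists: "finite {h :: 'a::finite list. length h = n}"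
  using finite_lists_length_eq[of "UNIV :: 'a set" n] by simp

lemma take_prefix [simp]: "take m (prefix \<omega> n) = prefix \<omega> (min m n)"
  by (simp add: take_map min_def)

lemma integral_mono_pmf_finite:
  fixes f g :: "'a \<Rightarrow> real"
  assumes "finite (set_pmf p)" "\<And>x. x \<in> set_pmf p \<Longrightarrow> f x \<le> g x"
  shows "measure_pmf.expectation p f \<le> measure_pmf.expectation p g"
  using assms by (intro integral_mono_AE integrable_measure_pmf_finite) (auto simp: AE_measure_pmf_iff)

lemma expectation_bind_pmf_finite:
  fixes f :: "'a \<Rightarrow> real"
  assumes "finite (set_pmf p)" "\<And>x. x \<in> set_pmf p \<Longrightarrow> finite (set_pmf (q x))"
  shows "measure_pmf.expectation (bind_pmf p q) f
    = measure_pmf.expectation p (\<lambda>x. measure_pmf.expectation (q x) f)"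
proof -
  have "measure_pmf.expectation (bind_pmf p q) f
      = (\<Sum>x\<in>set_pmf p. pmf p x *\<^sub>R measure_pmf.expectation (q x) f)"
    using assms by (intro pmf_expectation_bind) auto
  also have "\<dots> = measure_pmf.expectation p (\<lambda>x. measure_pmf.expectation (q x) f)"
    using assms(1) by (subst integral_measure_pmf[of "set_pmf p"]) (auto simp: set_pmf_eq)
  finally show ?thesis .
qed

lemma measure_eq_expectation_pmf:
  "measure (measure_pmf p) G = measure_pmf.expectation p (indicator G)"
  by simp

lemma measure_bind_pmf_finite:
  assumes "finite (set_pmf p)" "\<And>x. x \<in> set_pmf p \<Longrightarrow> finite (set_pmf (q x))"
  shows "measure (bind_pmf p q) G = measure_pmf.expectation p (\<lambda>x. measure (q x) G)"
  using expectation_bind_pmf_finite[of p q, OF assms, where f = "indicator G"] by simp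

locale play =
  fixes k :: nat and init :: "int \<Rightarrow> bool" and F :: "('y::finite) state"
    and \<sigma>p \<sigma>a :: "'y strategy"
begin

abbreviation step :: "'y history \<Rightarrow> 'y period pmf" where
  "step \<equiv> period_pmf k init F \<sigma>p \<sigma>a"

abbreviation law :: "(nat \<Rightarrow> 'y period) measure" where
  "law \<equiv> play_measure k init F \<sigma>p \<sigma>a"

text \<open>The law of the full history \<open>n\<close> periods after \<open>h\<close>, with
  \<open>h\<close> kept as its prefix. Recursion on the first period suits bounds that are proved by
  induction for every starting history.\<close>

primrec future :: "nat \<Rightarrow> 'y history \<Rightarrow> 'y history pmf" where
  "future 0 h = return_pmf h"
| "future (Suc n) h = bind_pmf (step h) (\<lambda>x. future n (h @ [x]))"

lemma finite_set_step [simp]: "finite (set_pmf (step h))"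
  by (rule finite)

lemma finite_set_future [simp]: "finite (set_pmf (future n h))"
  by (induction n arbitrary: h) auto

lemma future_add: "future (m + n) h = bind_pmf (future m h) (future n)"
  by (induction m arbitrary: h) (auto simp: bind_return_pmf bind_assoc_pmf)

lemma future_Suc_right: "future (Suc n) h = bind_pmf (future n h) (\<lambda>g. map_pmf (\<lambda>x. g @ [x]) (step g))"
proof -
  have "future (Suc n) h = bind_pmf (future n h) (future (Suc 0))"
    using future_add[of n "Suc 0" h] by (simp only: add_Suc_right add_0_right)
  moreover have "future (Suc 0) = (\<lambda>g. map_pmf (\<lambda>x. g @ [x]) (step g))"
    by (rule ext) (simp add: map_pmf_def)
  ultimately show ?thesis by simp
qed

lemma set_future:
  assumes "g \<in> set_pmf (future n h)"
  shows "length g = length h + n" "take (length h) g = h"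
proof -
  have "length g = length h + n \<and> take (length h) g = h"
    using assms
  proof (induction n arbitrary: h)
    case (Suc n)
    then obtain x where "g \<in> set_pmf (future n (h @ [x]))" by auto
    from Suc.IH[OF this] have *: "length g = length h + Suc n" "take (length h + 1) g = h @ [x]"
      by auto
    have "take (length h) g = take (length h) (take (length h + 1) g)" by (simp add: min_def)
    also have "\<dots> = h" unfolding *(2) by simp
    finally show ?case using * by simp
  qed simp
  then show "length g = length h + n" "take (length h) g = h" by auto
qed

lemma set_step_proposal: "x \<in> set_pmf (step h) \<Longrightarrow> action x \<Longrightarrow> proposal x"
  by (auto simp: period_pmf_def split: if_splits)

lemma step_histories: "h \<in> histories \<Longrightarrow> x \<in> set_pmf (step h) \<Longrightarrow> h @ [x] \<in> histories"
  unfolding histories_def using set_step_proposal[of x h] by auto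

lemma future_histories: "h \<in> histories \<Longrightarrow> g \<in> set_pmf (future n h) \<Longrightarrow> g \<in> histories"
  by (induction n arbitrary: h) (auto dest: step_histories)

lemma Nil_histories [simp]: "[] \<in> histories"
  by (simp add: histories_def)

section \<open>Transfer between infinite play and its finite prefixes\<close>

sublocale prob_space law
  by (rule prob_space_play_measure)

lemma space_law [simp]: "space law = UNIV"
  using sets_eq_imp_space_eq[OF sets_play_measure] by (simp add: space_PiM)

lemma measurable_prefix_law [measurable]: "(\<lambda>\<omega>. prefix \<omega> n) \<in> measurable law (count_space UNIV)"
  by (subst measurable_cong_sets[OF sets_play_measure refl]) (rule measurable_prefix)

text \<open>Induction on \<open>n\<close> for all \<open>f\<close> at once, peeling off the last
  kernel, identifies the composed kernels with \<open>future\<close>. They are the marginal of the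
  projective limit on the first \<open>n\<close> coordinates.\<close>

lemma nn_integral_prefix: "(\<integral>\<^sup>+\<omega>. f (prefix \<omega> n) \<partial>law) = (\<integral>\<^sup>+h. f h \<partial>future n [])"
proof -
  interpret IT: Ionescu_Tulcea "kernel k init F \<sigma>p \<sigma>a" play_algebra
    by (rule Ionescu_Tulcea_kernel)
  have meas: "(\<lambda>\<omega>. prefix \<omega> n) \<in>
      measurable (PiM {0..<n} (play_algebra :: nat \<Rightarrow> 'y period measure)) (count_space UNIV)" for n
    by (subst count_space_PiM_finite) auto
  have C: "(\<integral>\<^sup>+\<omega>. f (prefix \<omega> n) \<partial>IT.C 0 n (\<lambda>_. undefined)) = (\<integral>\<^sup>+h. f h \<partial>future n [])" for f n
  proof (induction n arbitrary: f)
    case 0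
    have "(\<lambda>_. undefined) \<in> space (PiM {0..<0} (play_algebra :: nat \<Rightarrow> 'y period measure))"
      by (simp add: space_PiM)
    then show ?case unfolding IT.C.simps(1)
      by (subst nn_integral_return) auto
  next
    case (Suc n)
    have prfx: "prefix (fun_upd \<omega> n z) (Suc n) = prefix \<omega> n @ [z]" for \<omega> :: "nat \<Rightarrow> 'y period" and z
      by (auto intro!: nth_equalityI simp: nth_append less_Suc_eq)
    have mf: "(\<lambda>\<omega>. f (prefix \<omega> (Suc n))) \<in> borel_measurable (PiM {0..<Suc n} play_algebra)"
      by (rule measurable_compose[OF meas]) simp
    have "(\<integral>\<^sup>+\<omega>. f (prefix \<omega> (Suc n)) \<partial>IT.C 0 (Suc n) (\<lambda>_. undefined))
      = (\<integral>\<^sup>+\<omega>. \<integral>\<^sup>+\<omega>'. f (prefix \<omega>' (Suc n)) \<partial>IT.eP n \<omega> \<partial>IT.C 0 n (\<lambda>_. undefined))"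
      using mf by (simp add: nn_integral_bind[where B="PiM {0..<Suc n} play_algebra"]
        measurable_cong_sets[OF IT.sets_C])
    also have "\<dots> = (\<integral>\<^sup>+\<omega>. (\<integral>\<^sup>+z. f (prefix \<omega> n @ [z]) \<partial>step (prefix \<omega> n)) \<partial>IT.C 0 n (\<lambda>_. undefined))"
      by (intro nn_integral_cong, subst IT.nn_integral_eP)
        (use mf in \<open>auto simp: IT.space_C prfx kernel_def simp del: upt_Suc\<close>)
    also have "\<dots> = (\<integral>\<^sup>+h. (\<integral>\<^sup>+z. f (h @ [z]) \<partial>step h) \<partial>future n [])"
      by (rule Suc)
    also have "\<dots> = (\<integral>\<^sup>+h. f h \<partial>future (Suc n) [])"
      by (subst future_Suc_right) simp
    finally show ?case .
  qed
  have up: "IT.up_to {0..<n} = n"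
    by (metis IT.up_to IT.up_to_iff_Ico dual_order.refl finite_atLeastLessThan ivl_subset le_antisym
      less_eq_nat.simps(1) linorder_not_less order.refl)
  have "(\<integral>\<^sup>+\<omega>. f (prefix \<omega> n) \<partial>law) = (\<integral>\<^sup>+\<omega>. f (prefix (restrict \<omega> {0..<n}) n) \<partial>IT.PF.lim)"
    unfolding play_measure_def by (intro nn_integral_cong arg_cong[where f=f]) auto
  also have "\<dots> = (\<integral>\<^sup>+\<omega>. f (prefix \<omega> n) \<partial>distr IT.PF.lim (PiM {0..<n} play_algebra) (\<lambda>\<omega>. restrict \<omega> {0..<n}))"
    by (subst nn_integral_distr) (auto intro!: measurable_restrict measurable_compose[OF meas]
        measurable_component_singleton simp: measurable_cong_sets[OF IT.PF.sets_lim refl])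
  also have "\<dots> = (\<integral>\<^sup>+\<omega>. f (prefix \<omega> n) \<partial>IT.CI {0..<n})"
    by (subst IT.distr_lim) auto
  also have "\<dots> = (\<integral>\<^sup>+\<omega>. f (prefix (restrict \<omega> {0..<n}) n) \<partial>IT.C 0 n (\<lambda>_. undefined))"
    unfolding IT.CI_def up
    by (subst nn_integral_distr) (auto intro!: measurable_restrict measurable_compose[OF meas]
        simp: measurable_cong_sets[OF IT.sets_C])
  also have "\<dots> = (\<integral>\<^sup>+\<omega>. f (prefix \<omega> n) \<partial>IT.C 0 n (\<lambda>_. undefined))"
    by (intro nn_integral_cong arg_cong[where f=f]) auto
  finally show ?thesis using C by simp
qed

lemma distr_prefix: "distr law (count_space UNIV) (\<lambda>\<omega>. prefix \<omega> n) = measure_pmf (future n [])"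
proof (rule measure_eqI)
  fix G assume "G \<in> sets (distr law (count_space UNIV) (\<lambda>\<omega>. prefix \<omega> n))"
  have "emeasure (distr law (count_space UNIV) (\<lambda>\<omega>. prefix \<omega> n)) G
      = (\<integral>\<^sup>+h. indicator G h \<partial>distr law (count_space UNIV) (\<lambda>\<omega>. prefix \<omega> n))"
    by simp
  also have "\<dots> = (\<integral>\<^sup>+\<omega>. indicator G (prefix \<omega> n) \<partial>law)"
    by (subst nn_integral_distr) auto
  finally show "emeasure (distr law (count_space UNIV) (\<lambda>\<omega>. prefix \<omega> n)) G = emeasure (future n []) G"
    by (subst (asm) nn_integral_prefix) simp
qed simp

lemma prefix_sets [simp]: "{\<omega>. Q (prefix \<omega> n)} \<in> sets law"
  using measurable_sets[OF measurable_prefix_law, of "Collect Q" n] by (simp add: vimage_def)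

lemma prob_prefix: "prob {\<omega>. Q (prefix \<omega> n)} = measure (future n []) {h. Q h}"
  unfolding distr_prefix[symmetric]
  by (subst measure_distr) (auto simp: vimage_def)

lemma integral_prefix:
  "(\<integral>\<omega>. (f (prefix \<omega> n) :: real) \<partial>law) = measure_pmf.expectation (future n []) f"
  unfolding distr_prefix[symmetric] by (subst integral_distr) auto

lemma AE_prefixI:
  assumes "\<And>h. h \<in> set_pmf (future n []) \<Longrightarrow> Q h"
  shows "AE \<omega> in law. Q (prefix \<omega> n)"
proof -
  have "prob {\<omega>. Q (prefix \<omega> n)} = 1"
    unfolding prob_prefix by (subst measure_pmf.prob_eq_1) (auto simp: AE_measure_pmf_iff assms)
  then show ?thesis
    using prob_eq_1[OF prefix_sets[of Q n]] by simp
qed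

lemma AE_prefix_histories: "AE \<omega> in law. prefix \<omega> n \<in> histories"
  by (rule AE_prefixI) (rule future_histories[OF Nil_histories])

text \<open>The Markov property at a fixed history, in product form so that null histories need no
  separate treatment.\<close>

lemma prob_prefix_cond:
  assumes "length h = n"
  shows "prob {\<omega>. prefix \<omega> n = h \<and> Q (prefix \<omega> (n + m))}
    = prob {\<omega>. prefix \<omega> n = h} * measure (future m h) {g. Q g}"
proof -
  have "prob {\<omega>. prefix \<omega> n = h \<and> Q (prefix \<omega> (n + m))}
      = measure (future (n + m) []) {g. take n g = h \<and> Q g}"
    by (subst prob_prefix[symmetric]) simp
  also have "\<dots> = measure_pmf.expectation (future n []) (\<lambda>h'. measure (future m h') {g. take n g = h \<and> Q g})"
    unfolding future_add by (rule measure_bind_pmf_finite) auto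
  also have "\<dots> = measure_pmf.expectation (future n []) (\<lambda>h'. indicator {h} h' * measure (future m h) {g. Q g})"
  proof (intro integral_cong_AE, simp, simp, simp only: AE_measure_pmf_iff, intro ballI)
    fix h' assume h': "h' \<in> set_pmf (future n [])"
    then have len: "length h' = n" using set_future(1)[OF h'] by simp
    have "measure (future m h') {g. take n g = h \<and> Q g} = measure (future m h') {g. h' = h \<and> Q g}"
      by (rule measure_pmf.finite_measure_eq_AE)
        (use len set_future(2)[of _ m h'] in \<open>auto simp: AE_measure_pmf_iff\<close>)
    then show "measure (future m h') {g. take n g = h \<and> Q g}
        = indicator {h} h' * measure (future m h) {g. Q g}"
      by (auto simp: indicator_def)
  qed
  also have "\<dots> = measure (future n []) {h} * measure (future m h) {g. Q g}" by simp
  also have "measure (future n []) {h} = prob {\<omega>. prefix \<omega> n = h}"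
    by (subst prob_prefix) simp
  finally show ?thesis .
qed

text \<open>Used to force a run of \<open>m\<close> favourable or unfavourable outcomes, each of
  probability at least \<open>p\<close> whatever happened before.\<close>

lemma push_bound:
  assumes "\<And>g. I g \<Longrightarrow> measure (step g) {x. I (g @ [x])} \<ge> p" "I h" "p \<ge> 0"
  shows "measure (future m h) {g. I g} \<ge> p ^ m"
  using assms(2)
proof (induction m arbitrary: h)
  case (Suc m)
  have "p ^ Suc m \<le> p ^ m * measure (step h) {x. I (h @ [x])}"
    using mult_left_mono[OF assms(1)[OF Suc.prems], of "p ^ m"] assms(3) by (simp add: mult.commute)
  also have "\<dots> = measure_pmf.expectation (step h) (\<lambda>x. p ^ m * indicator {x. I (h @ [x])} x)"
    by simp
  also have "\<dots> \<le> measure_pmf.expectation (step h) (\<lambda>x. measure (future m (h @ [x])) {g. I g})"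
    by (rule integral_mono_pmf_finite) (auto simp: indicator_def Suc.IH)
  also have "\<dots> = measure (future (Suc m) h) {g. I g}"
    by (simp add: measure_bind_pmf_finite)
  finally show ?case .
qed (simp add: indicator_def)

lemma future_add_bound:
  assumes "measure (future m h) B \<ge> p" "\<And>g. g \<in> B \<Longrightarrow> g \<in> set_pmf (future m h) \<Longrightarrow> measure (future n g) G \<ge> q" "q \<ge> 0"
  shows "measure (future (m + n) h) G \<ge> p * q"
proof -
  have "p * q \<le> measure (future m h) B * q" using assms by (intro mult_right_mono)
  also have "\<dots> = measure_pmf.expectation (future m h) (\<lambda>g. indicator B g * q)" by simp
  also have "\<dots> \<le> measure_pmf.expectation (future m h) (\<lambda>g. measure (future n g) G)"
    by (rule integral_mono_pmf_finite) (auto simp: indicator_def assms)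
  also have "\<dots> = measure (future (m + n) h) G"
    by (simp add: measure_bind_pmf_finite future_add)
  finally show ?thesis .
qed

text \<open>The maximal inequality for nonnegative supermartingales. After an exit from
  \<open>I\<close> the value of \<open>\<phi>\<close> is at least 1 and bounds any probability, so
  the supermartingale property is asked only inside \<open>I\<close>.\<close>

lemma exit_bound:
  assumes super: "\<And>g. I g \<Longrightarrow> measure_pmf.expectation (step g) (\<lambda>x. \<phi> (g @ [x])) \<le> (\<phi> g :: real)"
    and exit: "\<And>g x. I g \<Longrightarrow> x \<in> set_pmf (step g) \<Longrightarrow> \<not> I (g @ [x]) \<Longrightarrow> \<phi> (g @ [x]) \<ge> 1"
    and nonneg: "\<And>g. \<phi> g \<ge> 0"
    and "I h"
  shows "measure (future m h) {g. \<not> I g} \<le> \<phi> h"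
  using \<open>I h\<close>
proof (induction m arbitrary: h)
  case (Suc m)
  have "measure (future (Suc m) h) {g. \<not> I g}
      = measure_pmf.expectation (step h) (\<lambda>x. measure (future m (h @ [x])) {g. \<not> I g})"
    by (simp add: measure_bind_pmf_finite)
  also have "\<dots> \<le> measure_pmf.expectation (step h) (\<lambda>x. \<phi> (h @ [x]))"
  proof (rule integral_mono_pmf_finite)
    fix x assume x: "x \<in> set_pmf (step h)"
    show "measure (future m (h @ [x])) {g. \<not> I g} \<le> \<phi> (h @ [x])"
      by (cases "I (h @ [x])")
        (auto simp: Suc.IH intro: order_trans[OF measure_pmf.prob_le_1 exit[OF Suc.prems x]])
  qed simp
  also have "\<dots> \<le> \<phi> h" by (rule super[OF Suc.prems])
  finally show ?case .
qed (use nonneg in \<open>simp add: indicator_def\<close>)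

lemma future_expectation_le:
  assumes "\<And>g. I g \<Longrightarrow> measure_pmf.expectation (step g) (\<lambda>x. \<phi> (g @ [x])) \<le> c * (\<phi> g :: real)"
    and "\<And>g x. I g \<Longrightarrow> x \<in> set_pmf (step g) \<Longrightarrow> I (g @ [x])"
    and "I h" "c \<ge> 0"
  shows "measure_pmf.expectation (future m h) \<phi> \<le> c ^ m * \<phi> h"
  using \<open>I h\<close>
proof (induction m arbitrary: h)
  case (Suc m)
  have "measure_pmf.expectation (future (Suc m) h) \<phi>
      = measure_pmf.expectation (step h) (\<lambda>x. measure_pmf.expectation (future m (h @ [x])) \<phi>)"
    by (simp add: expectation_bind_pmf_finite)
  also have "\<dots> \<le> measure_pmf.expectation (step h) (\<lambda>x. c ^ m * \<phi> (h @ [x]))"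
    by (rule integral_mono_pmf_finite) (use Suc assms in auto)
  also have "\<dots> = c ^ m * measure_pmf.expectation (step h) (\<lambda>x. \<phi> (h @ [x]))" by simp
  also have "\<dots> \<le> c ^ m * (c * \<phi> h)"
    by (intro mult_left_mono assms Suc.prems) (use assms in auto)
  finally show ?case by (simp add: mult.assoc mult.left_commute)
qed simp

end

section \<open>A zero-one bound\<close>

declare sets_play_measure [simp del]

context play
begin

text \<open>Induction over the generated sigma-algebra. Asking for every large \<open>n\<close>, not
  just some \<open>n\<close>, lets finitely many events share one horizon; a countable union is
  first cut down to a finite one.\<close>

lemma cylinder_approximation:
  assumes "C \<in> sets law" "\<epsilon> > 0"
  shows "\<exists>n0. \<forall>n\<ge>n0. \<exists>G. prob (sym_diff C {\<omega>. prefix \<omega> n \<in> G}) < \<epsilon>"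
proof -
  have sets: "sets law = sigma_sets UNIV {{f. f i \<in> A} | i A. True}"
    by (simp add: sets_PiM_single sets_play_measure)
  have "C \<in> sigma_sets UNIV {{f. f i \<in> A} | i A. True}" using assms(1) sets by simp
  then show ?thesis using \<open>\<epsilon> > 0\<close>
  proof (induction arbitrary: \<epsilon>)
    case (Basic a)
    then obtain i A where a: "a = {f. f i \<in> A}" by auto
    show ?case
    proof (intro exI[of _ "Suc i"] allI impI)
      fix n assume "n \<ge> Suc i"
      then have "a = {\<omega>. prefix \<omega> n \<in> {h. h ! i \<in> A}}" unfolding a by auto
      then show "\<exists>G. prob (sym_diff a {\<omega>. prefix \<omega> n \<in> G}) < \<epsilon>"
        using Basic.prems by (intro exI[of _ "{h. h ! i \<in> A}"]) auto
    qed
  next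
    case Empty
    then show ?case by (intro exI[of _ 0] allI impI exI[of _ "{}"]) auto
  next
    case (Compl a)
    obtain n0 where n0: "\<And>n. n \<ge> n0 \<Longrightarrow> \<exists>G. prob (sym_diff a {\<omega>. prefix \<omega> n \<in> G}) < \<epsilon>"
      using Compl.IH Compl.prems by blast
    show ?case
    proof (intro exI[of _ n0] allI impI)
      fix n assume "n \<ge> n0"
      then obtain G where G: "prob (sym_diff a {\<omega>. prefix \<omega> n \<in> G}) < \<epsilon>" using n0 by blast
      have "sym_diff (UNIV - a) {\<omega>. prefix \<omega> n \<in> - G} = sym_diff a {\<omega>. prefix \<omega> n \<in> G}" by auto
      then show "\<exists>G. prob (sym_diff (UNIV - a) {\<omega>. prefix \<omega> n \<in> G}) < \<epsilon>"
        using G by (intro exI[of _ "- G"]) simp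
    qed
  next
    case (Union a)
    have a [measurable]: "a i \<in> sets law" for i using Union.hyps sets by simp
    have "(\<lambda>N. prob (\<Union>i<N. a i)) \<longlonglongrightarrow> prob (\<Union>N. \<Union>i<N. a i)"
      by (intro finite_Lim_measure_incseq) (auto simp: incseq_def intro: less_le_trans)
    also have "(\<Union>N. \<Union>i<N. a i) = (\<Union>i. a i)" by auto
    finally have "\<forall>\<^sub>F N in sequentially. dist (prob (\<Union>i<N. a i)) (prob (\<Union>i. a i)) < \<epsilon> / 2"
      using Union.prems by (intro tendstoD) auto
    then obtain N where N: "dist (prob (\<Union>i<N. a i)) (prob (\<Union>i. a i)) < \<epsilon> / 2"
      by (auto simp: eventually_sequentially)
    \<comment> \<open>The denominator \<open>N + 1\<close> covers \<open>N = 0\<close> and keeps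
      \<open>N\<close> such errors below \<open>\<epsilon> / 2\<close>.\<close>
    define \<epsilon>' where "\<epsilon>' = \<epsilon> / (2 * (real N + 1))"
    have \<epsilon>': "\<epsilon>' > 0" using Union.prems by (simp add: \<epsilon>'_def add_nonneg_pos)
    have "\<forall>i. \<exists>n0. \<forall>n\<ge>n0. \<exists>G. prob (sym_diff (a i) {\<omega>. prefix \<omega> n \<in> G}) < \<epsilon>'"
      using Union.IH[OF \<epsilon>'] by blast
    then obtain n0 where n0: "\<And>i n. n \<ge> n0 i \<Longrightarrow> \<exists>G. prob (sym_diff (a i) {\<omega>. prefix \<omega> n \<in> G}) < \<epsilon>'"
      by metis
    show ?case
    proof (intro exI[of _ "\<Sum>i<N. n0 i"] allI impI)
      fix n assume n: "n \<ge> (\<Sum>i<N. n0 i)"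
      have "n0 i \<le> n" if "i < N" for i
        using member_le_sum[of i "{..<N}" n0] that n by simp
      then have "\<forall>i. \<exists>G. i < N \<longrightarrow> prob (sym_diff (a i) {\<omega>. prefix \<omega> n \<in> G}) < \<epsilon>'"
        using n0 by blast
      then obtain G where G: "\<And>i. i < N \<Longrightarrow> prob (sym_diff (a i) {\<omega>. prefix \<omega> n \<in> G i}) < \<epsilon>'"
        by metis
      let ?X = "{\<omega>. prefix \<omega> n \<in> (\<Union>i<N. G i)}"
      have X: "{\<omega>. prefix \<omega> n \<in> G'} \<in> sets law" for G' by (rule prefix_sets)
      note [measurable] = X
      have "prob (sym_diff (\<Union>i. a i) ?X)
          \<le> prob (((\<Union>i. a i) - (\<Union>i<N. a i)) \<union> (\<Union>i<N. sym_diff (a i) {\<omega>. prefix \<omega> n \<in> G i}))"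
        by (intro finite_measure_mono sets.Un sets.Diff sets.finite_UN sets.countable_UN) (auto intro: X)
      also have "\<dots> \<le> prob ((\<Union>i. a i) - (\<Union>i<N. a i)) + prob (\<Union>i<N. sym_diff (a i) {\<omega>. prefix \<omega> n \<in> G i})"
        by (intro measure_Un_le sets.Un sets.Diff sets.finite_UN sets.countable_UN) (auto intro: X)
      also have "prob ((\<Union>i. a i) - (\<Union>i<N. a i)) = prob (\<Union>i. a i) - prob (\<Union>i<N. a i)"
        by (intro finite_measure_Diff sets.finite_UN sets.countable_UN) auto
      also have "\<dots> < \<epsilon> / 2" using N unfolding dist_real_def by linarith
      also have "prob (\<Union>i<N. sym_diff (a i) {\<omega>. prefix \<omega> n \<in> G i})
          \<le> (\<Sum>i<N. prob (sym_diff (a i) {\<omega>. prefix \<omega> n \<in> G i}))"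
        by (intro finite_measure_subadditive_finite) (auto intro: X)
      also have "\<dots> \<le> (\<Sum>i<N. \<epsilon>')" using G by (intro sum_mono) (auto intro: less_imp_le)
      also have "\<dots> = \<epsilon> / 2 * (real N / (real N + 1))" by (simp add: \<epsilon>'_def field_simps)
      also have "\<dots> \<le> \<epsilon> / 2 * 1" using Union.prems by (intro mult_left_mono) auto
      finally show "\<exists>G. prob (sym_diff (\<Union>i. a i) {\<omega>. prefix \<omega> n \<in> G}) < \<epsilon>"
        by (intro exI[of _ "\<Union>i<N. G i"]) simp
    qed
  qed
qed

text \<open>
  This is Levy's zero-one law in disguise: if \<open>C\<close> failed at infinitely many visits to \<open>A\<close>, one could
  approximate the complement of \<open>C\<close> by a cylinder event and stop play at the next visit to \<open>A\<close>.
\<close>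

lemma AE_recurrent_imp:
  assumes C [measurable]: "C \<in> sets law" and \<delta>: "\<delta> > 0"
    and step: "\<And>h. h \<in> A \<Longrightarrow> h \<in> histories \<Longrightarrow> t \<le> length h \<Longrightarrow>
      prob {\<omega>. prefix \<omega> (length h) = h \<and> \<omega> \<in> C} \<ge> \<delta> * prob {\<omega>. prefix \<omega> (length h) = h}"
  shows "AE \<omega> in law. (\<forall>m. \<exists>n\<ge>m. prefix \<omega> n \<in> A) \<longrightarrow> \<omega> \<in> C"
proof -
  have X [measurable]: "{\<omega>. prefix \<omega> n \<in> G'} \<in> sets law" for G' n by (rule prefix_sets)
  have X1 [measurable]: "{\<omega>. prefix \<omega> n = h} \<in> sets law" for h n
    using prefix_sets[of "\<lambda>g. g = h"] .
  define Z where "Z = {\<omega>. (\<forall>m. \<exists>n\<ge>m. prefix \<omega> n \<in> A) \<and> \<omega> \<notin> C}"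
  have "Z = (\<Inter>m. \<Union>n\<in>{m..}. {\<omega>. prefix \<omega> n \<in> A}) - C" by (auto simp: Z_def)
  also have "\<dots> \<in> sets law"
    by (intro sets.Diff sets.countable_INT'' sets.countable_UN' C X) (use sets.top[of law] in auto)
  finally have Z [measurable]: "Z \<in> sets law" .
  have *: "prob Z \<le> \<epsilon> / \<delta> + \<epsilon>" if \<epsilon>: "\<epsilon> > 0" for \<epsilon>
  proof -
    obtain n0 where "\<And>n. n \<ge> n0 \<Longrightarrow> \<exists>G. prob (sym_diff C {\<omega>. prefix \<omega> n \<in> G}) < \<epsilon>"
      using cylinder_approximation[OF C \<epsilon>] by blast
    from this[of "max n0 t"] obtain n G where n: "n \<ge> t"
      and G: "prob (sym_diff C {\<omega>. prefix \<omega> n \<in> G}) < \<epsilon>" by (metis max.cobounded1 max.cobounded2)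
    let ?U = "{\<omega>. prefix \<omega> n \<notin> G}"
    have U [measurable]: "?U \<in> sets law" using prefix_sets[of "\<lambda>g. g \<notin> G"] .
    \<comment> \<open>\<open>H m\<close> collects the histories whose first visit to
      \<open>A\<close> at or after time \<open>n\<close> happens at time \<open>m\<close>, outside
      the cylinder \<open>G\<close> that approximates \<open>C\<close>.\<close>
    define H where "H m = {h. length h = m \<and> n \<le> m \<and> take n h \<notin> G \<and> h \<in> A \<and>
      (\<forall>j. n \<le> j \<and> j < m \<longrightarrow> take j h \<notin> A)}" for m
    define D where "D m = {\<omega>. prefix \<omega> m \<in> H m}" for m
    have D [measurable]: "D m \<in> sets law" for m unfolding D_def by (rule X)
    have fin: "finite (H m)" for m
      by (rule finite_subset[OF _ finite_type_lists[of m]]) (auto simp: H_def)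
    have D_iff: "\<omega> \<in> D m \<longleftrightarrow> n \<le> m \<and> prefix \<omega> n \<notin> G \<and> prefix \<omega> m \<in> A \<and>
        (\<forall>j. n \<le> j \<and> j < m \<longrightarrow> prefix \<omega> j \<notin> A)" for m \<omega>
      by (auto simp: D_def H_def min_def)
    have disj: "disjoint_family D"
    proof (unfold disjoint_family_on_def, intro ballI impI)
      fix m m' :: nat assume "m \<noteq> m'"
      then have "m < m' \<or> m' < m" by arith
      then show "D m \<inter> D m' = {}" using D_iff by blast
    qed
    have CD: "prob (C \<inter> D m) \<ge> \<delta> * prob (D m)" for m
    proof -
      have "prob {\<omega>. prefix \<omega> m = h \<and> \<omega> \<in> C} \<ge> \<delta> * prob {\<omega>. prefix \<omega> m = h}" if h: "h \<in> H m" for h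
      proof (cases "h \<in> histories")
        case True
        then show ?thesis using step[of h] h n by (auto simp: H_def)
      next
        case False
        have "AE \<omega> in law. \<omega> \<notin> {\<omega>. prefix \<omega> m = h}"
          by (rule AE_mp[OF AE_prefix_histories[of m]], rule AE_I2) (use False in auto)
        then have "prob {\<omega>. prefix \<omega> m = h} = 0" using prob_eq_0[OF X1] by simp
        then show ?thesis by simp
      qed
      note st = this
      have "\<delta> * prob (D m) = \<delta> * prob (\<Union>h\<in>H m. {\<omega>. prefix \<omega> m = h})"
        by (auto simp: D_def intro!: arg_cong[where f=prob])
      also have "\<dots> = (\<Sum>h\<in>H m. \<delta> * prob {\<omega>. prefix \<omega> m = h})"
        by (subst finite_measure_finite_Union)
          (use fin in \<open>auto simp: disjoint_family_on_def sum_distrib_left\<close>)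
      also have "\<dots> \<le> (\<Sum>h\<in>H m. prob {\<omega>. prefix \<omega> m = h \<and> \<omega> \<in> C})"
        by (intro sum_mono st)
      also have "\<dots> = (\<Sum>h\<in>H m. prob ({\<omega>. prefix \<omega> m = h} \<inter> C))"
        by (simp add: Int_def)
      also have "\<dots> = prob (\<Union>h\<in>H m. {\<omega>. prefix \<omega> m = h} \<inter> C)"
        by (subst finite_measure_finite_Union)
          (use fin in \<open>auto simp: disjoint_family_on_def\<close>)
      also have "(\<Union>h\<in>H m. {\<omega>. prefix \<omega> m = h} \<inter> C) = C \<inter> D m" by (auto simp: D_def)
      finally show ?thesis .
    qed
    have "(\<lambda>m. prob (D m)) sums prob (\<Union>m. D m)"
      using disj by (intro finite_measure_UNION) auto
    then have s1: "(\<lambda>m. \<delta> * prob (D m)) sums (\<delta> * prob (\<Union>m. D m))" by (rule sums_mult)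
    have s2: "(\<lambda>m. prob (C \<inter> D m)) sums prob (\<Union>m. C \<inter> D m)"
      using disj by (intro finite_measure_UNION) (auto simp: disjoint_family_on_def)
    \<comment> \<open>At its first visit each play still has chance at least \<open>\<delta>\<close>
      of ending in \<open>C\<close>. Yet the sets \<open>D m\<close> avoid \<open>G\<close>, so
      their part inside \<open>C\<close> is approximation error.\<close>
    have "\<delta> * prob (\<Union>m. D m) \<le> prob (\<Union>m. C \<inter> D m)"
      by (rule sums_le[OF _ s1 s2]) (rule CD)
    also have "\<dots> \<le> prob (sym_diff C {\<omega>. prefix \<omega> n \<in> G})"
      by (intro finite_measure_mono) (auto simp: D_iff)
    also have "\<dots> \<le> \<epsilon>" using G by simp
    finally have 1: "prob (\<Union>m. D m) \<le> \<epsilon> / \<delta>" using \<delta> by (simp add: field_simps)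
    \<comment> \<open>A play in \<open>Z\<close> is outside \<open>C\<close>. If it lies in the
      cylinder it is approximation error; otherwise its first visit to \<open>A\<close> from time
      \<open>n\<close> on puts it in some \<open>D m\<close>.\<close>
    have sub: "Z \<subseteq> (\<Union>m. D m) \<union> sym_diff C {\<omega>. prefix \<omega> n \<in> G}"
    proof
      fix \<omega> assume \<omega>: "\<omega> \<in> Z"
      then obtain m where m: "m \<ge> n" "prefix \<omega> m \<in> A" by (auto simp: Z_def)
      define l where "l = (LEAST m. m \<ge> n \<and> prefix \<omega> m \<in> A)"
      have "l \<ge> n \<and> prefix \<omega> l \<in> A" unfolding l_def by (rule LeastI[of _ m]) (use m in auto)
      moreover have "prefix \<omega> j \<notin> A" if "n \<le> j" "j < l" for j
        using not_less_Least[of j "\<lambda>m. m \<ge> n \<and> prefix \<omega> m \<in> A"] that unfolding l_def by auto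
      ultimately have "prefix \<omega> n \<notin> G \<Longrightarrow> \<omega> \<in> D l" by (auto simp: D_iff)
      then show "\<omega> \<in> (\<Union>m. D m) \<union> sym_diff C {\<omega>. prefix \<omega> n \<in> G}"
        using \<omega> by (auto simp: Z_def)
    qed
    have "prob Z \<le> prob ((\<Union>m. D m) \<union> sym_diff C {\<omega>. prefix \<omega> n \<in> G})"
      by (intro finite_measure_mono sub) auto
    also have "\<dots> \<le> prob (\<Union>m. D m) + prob (sym_diff C {\<omega>. prefix \<omega> n \<in> G})"
      by (intro measure_Un_le) auto
    finally show ?thesis using 1 G by linarith
  qed
  have "prob Z \<le> 0 + e" if "e > 0" for e
  proof -
    have "1 / \<delta> + 1 > 0" using \<delta> by (simp add: add_pos_pos)
    then have "prob Z \<le> e / (1 / \<delta> + 1) / \<delta> + e / (1 / \<delta> + 1)"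
      using * that by (intro *) simp
    also have "\<dots> = e / (1 / \<delta> + 1) * (1 / \<delta> + 1)" by (simp only: distrib_left mult_1_right times_divide_eq_right)
    also have "\<dots> = e" using \<open>1 / \<delta> + 1 > 0\<close> by simp
    finally show ?thesis by simp
  qed
  then have "prob Z = 0" using field_le_epsilon[of "prob Z" 0] by (simp add: measure_le_0_iff)
  then have "AE \<omega> in law. \<omega> \<notin> Z" using prob_eq_0[OF Z] by simp
  then show ?thesis by (auto simp: Z_def)
qed

text \<open>Continuity from above: the events for growing horizons decrease, so a bound for all
  large horizons survives in the limit.\<close>

lemma prob_forever:
  assumes h: "length h = n"
    and bound: "\<And>j. j \<ge> m \<Longrightarrow> measure (future j h) {g. \<forall>s. n \<le> s \<and> s \<le> length g \<longrightarrow> Q (take s g)} \<ge> \<delta>"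
  shows "prob {\<omega>. prefix \<omega> n = h \<and> (\<forall>s\<ge>n. Q (prefix \<omega> s))} \<ge> \<delta> * prob {\<omega>. prefix \<omega> n = h}"
proof -
  let ?Q = "\<lambda>g. \<forall>s. n \<le> s \<and> s \<le> length g \<longrightarrow> Q (take s g)"
  define B where "B j = {\<omega>. prefix \<omega> n = h \<and> (\<forall>s. n \<le> s \<and> s \<le> n + j \<longrightarrow> Q (prefix \<omega> s))}" for j
  have B: "B j = {\<omega>. prefix \<omega> n = h \<and> ?Q (prefix \<omega> (n + j))}" for j
    by (auto simp: B_def min_def)
  have B': "B j = {\<omega>. (\<lambda>g. take n g = h \<and> ?Q g) (prefix \<omega> (n + j))}" for j
    by (auto simp: B min_def)
  have Bs: "B j \<in> sets law" for j unfolding B' by (rule prefix_sets)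
  have "(\<lambda>j. prob (B j)) \<longlonglongrightarrow> prob (\<Inter>j. B j)"
    using Bs by (intro finite_Lim_measure_decseq) (auto simp: decseq_def B_def)
  moreover have "prob (B j) \<ge> \<delta> * prob {\<omega>. prefix \<omega> n = h}" if "j \<ge> m" for j
    unfolding B prob_prefix_cond[OF h, of ?Q]
    using mult_right_mono[OF bound[OF that], of "prob {\<omega>. prefix \<omega> n = h}"] by (simp add: mult.commute)
  ultimately have "prob (\<Inter>j. B j) \<ge> \<delta> * prob {\<omega>. prefix \<omega> n = h}"
    by (intro LIMSEQ_le_const) auto
  also have "(\<Inter>j. B j) = {\<omega>. prefix \<omega> n = h \<and> (\<forall>s\<ge>n. Q (prefix \<omega> s))}"
    by (auto simp: B_def) (metis le_add_diff_inverse order_refl)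
  finally show ?thesis .
qed

end

section \<open>One period of play\<close>

lemma measure_pmf_Not: "measure (measure_pmf p) {x. \<not> P x} = 1 - measure (measure_pmf p) {x. P x}"
proof -
  have "{x. \<not> P x} = space (measure_pmf p) - {x. P x}" by auto
  then show ?thesis by (simp add: measure_pmf.prob_compl del: space_measure_pmf)
qed

lemma set_pmf_bernoulli_0: "b \<in> set_pmf (bernoulli_pmf 0) \<longleftrightarrow> \<not> b"
  by (cases b) (auto simp: set_pmf_iff)

lemma set_pmf_bernoulli_1: "b \<in> set_pmf (bernoulli_pmf 1) \<longleftrightarrow> b"
  by (cases b) (auto simp: set_pmf_iff)

context play
begin

abbreviation lag :: "'y history \<Rightarrow> bool" where
  "lag h \<equiv> past_action init h (int (length h) + 1 - int k)"

text \<open>The outcome law \<open>F (lag h)\<close> does not involve the proposal or the current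
  action. Hence a period is a draw of this pair followed by an independent outcome.\<close>

definition choice :: "'y history \<Rightarrow> (bool \<times> bool) pmf" where
  "choice h = bind_pmf (bernoulli_pmf (\<sigma>p h)) (\<lambda>p.
     map_pmf (Pair p) (if p then bernoulli_pmf (\<sigma>a h) else return_pmf False))"

lemma step_eq: "step h = bind_pmf (choice h) (\<lambda>c. map_pmf (\<lambda>y. (fst c, snd c, y)) (F (lag h)))"
  by (simp add: period_pmf_def choice_def map_pmf_def bind_assoc_pmf bind_return_pmf)

text \<open>Period \<open>s\<close> sits at list position \<open>s - 1\<close>, so the lagged period
  \<open>length h + 1 - k\<close> is entry \<open>length h - k\<close>.\<close>

lemma lag_eq: "1 \<le> k \<Longrightarrow> k \<le> length h \<Longrightarrow> lag h = action (h ! (length h - k))"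
proof -
  assume k: "1 \<le> k" "k \<le> length h"
  then have "nat (int (length h) + 1 - int k - 1) = length h - k" by simp
  then show ?thesis using k by (simp add: past_action_def)
qed

lemma choice_step: "c \<in> set_pmf (choice h) \<Longrightarrow> \<exists>x\<in>set_pmf (step h). action x = snd c"
proof -
  assume c: "c \<in> set_pmf (choice h)"
  obtain y where "y \<in> set_pmf (F (lag h))" using set_pmf_not_empty[of "F (lag h)"] by blast
  then have "(fst c, snd c, y) \<in> set_pmf (step h)" using c unfolding step_eq by auto
  then show ?thesis by force
qed

lemma expectation_step:
  "measure_pmf.expectation (step h) f
    = measure_pmf.expectation (choice h) (\<lambda>c. measure_pmf.expectation (F (lag h)) (\<lambda>y. f (fst c, snd c, y)))"
  for f :: "'y period \<Rightarrow> real"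
  unfolding step_eq by (subst expectation_bind_pmf_finite) auto

text \<open>Since choice and outcome are independent, it suffices to bound the outcome average for
  each action that can occur. Mixed strategies then need no separate argument.\<close>

lemma expectation_step_le:
  fixes f :: "bool \<Rightarrow> 'y \<Rightarrow> real"
  assumes "\<And>x. x \<in> set_pmf (step h) \<Longrightarrow> measure_pmf.expectation (F (lag h)) (f (action x)) \<le> c"
  shows "measure_pmf.expectation (step h) (\<lambda>x. f (action x) (outcome x)) \<le> c"
proof -
  have "measure_pmf.expectation (step h) (\<lambda>x. f (action x) (outcome x))
      = measure_pmf.expectation (choice h) (\<lambda>c. measure_pmf.expectation (F (lag h)) (f (snd c)))"
    by (simp add: expectation_step)
  also have "\<dots> \<le> measure_pmf.expectation (choice h) (\<lambda>_. c)"
  proof (rule integral_mono_pmf_finite)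
    fix c' assume "c' \<in> set_pmf (choice h)"
    then show "measure_pmf.expectation (F (lag h)) (f (snd c')) \<le> c"
      using choice_step[of c' h] assms by auto
  qed simp
  finally show ?thesis by simp
qed

lemma measure_step_ge:
  assumes "\<And>x. x \<in> set_pmf (step h) \<Longrightarrow> measure (F (lag h)) {y. Q (action x) y} \<ge> c"
  shows "measure (step h) {x. Q (action x) (outcome x)} \<ge> c"
proof -
  have ind: "indicator {x. Q (action x) (outcome x)} x = indicator {y. Q (action x) y} (outcome x)" for x
    by (auto simp: indicator_def)
  have "measure_pmf.expectation (step h) (\<lambda>x. - indicator {y. Q (action x) y} (outcome x)) \<le> - c"
    by (rule expectation_step_le) (use assms in simp)
  then show ?thesis unfolding measure_eq_expectation_pmf ind by (simp del: integral_indicator)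
qed

lemma no_accept: "x \<in> set_pmf (step h) \<Longrightarrow> \<sigma>a h = 0 \<or> \<sigma>p h = 0 \<Longrightarrow> \<not> action x"
  by (auto simp: step_eq choice_def set_pmf_bernoulli_0 split: if_splits)

lemma accept: "x \<in> set_pmf (step h) \<Longrightarrow> \<sigma>a h = 1 \<Longrightarrow> \<sigma>p h = 1 \<Longrightarrow> action x"
  by (auto simp: step_eq choice_def set_pmf_bernoulli_1 split: if_splits)

text \<open>
  Once the misspecified log-likelihood ratio \<open>W\<close> against the true state has driven play to the
  action \<open>b\<close> for \<open>k\<close> periods, the misspecification is harmless and \<open>exp W\<close> is a martingale.
  A run of favourable outcomes makes \<open>W\<close> so negative that \<open>W\<close> then stays negative with
  probability at least one half.
\<close>

lemma absorbing_probability: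
  fixes W :: "'y history \<Rightarrow> real"
  assumes k: "k \<ge> 1"
    and full: "\<And>a. set_pmf (F a) = UNIV" "\<And>a. set_pmf (G a) = UNIV" and "F b \<noteq> G b"
    and W: "\<And>h x. W (h @ [x]) = W h + ln (pmf (G (action x)) (outcome x) / pmf (F (action x)) (outcome x))"
    and forced: "\<And>h x. R h \<Longrightarrow> W h < 0 \<Longrightarrow> x \<in> set_pmf (step h) \<Longrightarrow> action x = b \<and> R (h @ [x])"
  shows "\<exists>\<delta>>0. \<exists>m. \<forall>h j. R h \<longrightarrow> W h < 0 \<longrightarrow> m \<le> j \<longrightarrow>
    measure (future j h) {g. \<forall>s. length h \<le> s \<and> s \<le> length g \<longrightarrow> W (take s g) < 0} \<ge> \<delta>"
proof -
  have pos: "pmf (F a) y > 0" "pmf (G a) y > 0" for a y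
    using full[of a] by (auto intro: pmf_positive)
  obtain y0 where y0: "pmf (G b) y0 < pmf (F b) y0"
    using \<open>F b \<noteq> G b\<close> pmf_neq_exists_less[of "G b" "F b"] by auto
  define \<eta> where "\<eta> = - ln (pmf (G b) y0 / pmf (F b) y0)"
  have \<eta>: "\<eta> > 0" using y0 pos by (simp add: \<eta>_def ln_less_zero_iff)
  \<comment> \<open>During the push the lagged action may still be either one, so the chance of
    \<open>y0\<close> is bounded under both.\<close>
  define p where "p = min (pmf (F True) y0) (pmf (F False) y0)"
  have p: "p > 0" "p \<le> pmf (F a) y0" for a using pos by (cases a; simp add: p_def)+
  obtain n where n: "real n * \<eta> > ln 2" using reals_Archimedean3[OF \<eta>] by blast
  \<comment> \<open>Two requirements meet here: \<open>k\<close> periods of action \<open>b\<close>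
    also make the lagged action \<open>b\<close>, and the total fall exceeds \<open>ln 2\<close>, so
    that \<open>exp W\<close> is at most 1/2 after the push.\<close>
  define m where "m = max k n"
  have m: "real m * \<eta> > ln 2" "m \<ge> k"
    using n \<eta> by (auto simp: m_def intro: less_le_trans mult_right_mono)
  have "measure (future (m + j) h) {g. \<forall>s. length h \<le> s \<and> s \<le> length g \<longrightarrow> W (take s g) < 0} \<ge> p ^ m * (1/2)"
    if h: "R h" "W h < 0" for h j
  proof -
    define I where "I g \<longleftrightarrow> R g \<and> length h \<le> length g \<and>
      (\<forall>s. length h \<le> s \<and> s \<le> length g \<longrightarrow> W (take s g) < 0) \<and>
      (\<forall>i. length h \<le> i \<and> i < length g \<longrightarrow> action (g ! i) = b)" for g
    have I_step: "I (g @ [x])" if "I g" "x \<in> set_pmf (step g)" "W (g @ [x]) < 0" for g x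
    proof -
      have "W g < 0" using that(1) by (auto simp: I_def dest: spec[of _ "length g"])
      then have "action x = b" "R (g @ [x])" using forced[of g x] that by (auto simp: I_def)
      then show ?thesis using that by (auto simp: I_def nth_append less_Suc_eq le_Suc_eq)
    qed
    have I_act: "action x = b" if "I g" "x \<in> set_pmf (step g)" for g x
      using that forced[of g x] by (auto simp: I_def dest: spec[of _ "length g"])
    define I1 where "I1 g \<longleftrightarrow> I g \<and> W g \<le> W h - \<eta> * (real (length g) - real (length h))" for g
    have push: "measure (step g) {x. I1 (g @ [x])} \<ge> p" if g: "I1 g" for g
    proof -
      have "p \<le> measure (step g) {x. outcome x = y0}"
        using p(2)[of "lag g"] measure_step_ge[of g p "\<lambda>_ y. y = y0"] by (simp add: measure_pmf_single)
      also have "\<dots> \<le> measure (step g) {x. I1 (g @ [x])}"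
      proof (rule measure_pmf.finite_measure_mono_AE, simp_all only: AE_measure_pmf_iff, intro ballI impI, goal_cases)
        case (1 x)
        then have ax: "action x = b" using I_act[of g x] g by (simp add: I1_def)
        have Wx: "W (g @ [x]) = W g - \<eta>" using 1 ax by (simp add: W \<eta>_def)
        have "W g < 0" using g by (auto simp: I1_def I_def dest: spec[of _ "length g"])
        then have "I (g @ [x])" using I_step[of g x] 1 g Wx \<eta> by (auto simp: I1_def)
        then show ?case using Wx g by (auto simp: I1_def algebra_simps)
      qed simp
      finally show ?thesis .
    qed
    have "I1 h" using h by (auto simp: I1_def I_def)
    have stay: "measure (future j g) {g. I g} \<ge> 1/2" if g: "I1 g" "g \<in> set_pmf (future m h)" for g
    proof -
      have len: "length g = length h + m" using set_future[OF g(2)] by simp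
      let ?I = "\<lambda>g. I g \<and> length h + k \<le> length g"
      have "measure (future j g) {g. \<not> ?I g} \<le> exp (W g)"
      proof (rule exit_bound)
        fix g assume g: "?I g"
        then have "length h \<le> length g - k" "length g - k < length g" using k by auto
        then have "action (g ! (length g - k)) = b" using g unfolding I_def by blast
        then have lag: "lag g = b" using k g lag_eq[of g] by simp
        have "measure_pmf.expectation (step g) (\<lambda>x. exp (W (g @ [x])))
          = measure_pmf.expectation (step g)
              (\<lambda>x. (\<lambda>a y. exp (W g) * (pmf (G a) y / pmf (F a) y)) (action x) (outcome x))"
          by (simp add: W exp_add pos)
        also have "\<dots> \<le> exp (W g)"
        proof (rule expectation_step_le)
          fix x assume "x \<in> set_pmf (step g)"
          then have "action x = b" using I_act[of g x] g by simp
          \<comment> \<open>Lagged and current action are both \<open>b\<close>, so outcomes are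
            drawn from the denominator of the ratio and its mean is 1.\<close>
          have "(\<Sum>y\<in>UNIV. pmf (F b) y * (pmf (G b) y / pmf (F b) y)) = (\<Sum>y\<in>UNIV. pmf (G b) y)"
            using pos(1)[of b] by (intro sum.cong) (auto simp: less_imp_neq[THEN not_sym])
          also have "\<dots> = 1" by (rule sum_pmf_eq_1) auto
          finally have "measure_pmf.expectation (F b) (\<lambda>y. pmf (G b) y / pmf (F b) y) = 1"
            by (subst integral_measure_pmf[of UNIV]) auto
          then show "measure_pmf.expectation (F (lag g)) (\<lambda>y. exp (W g) * (pmf (G (action x)) y / pmf (F (action x)) y))
              \<le> exp (W g)"
            unfolding lag \<open>action x = b\<close> by (subst integral_mult_right_zero) simp
        qed
        finally show "measure_pmf.expectation (step g) (\<lambda>x. exp (W (g @ [x]))) \<le> exp (W g)" .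
      next
        fix g x assume "?I g" "x \<in> set_pmf (step g)" "\<not> ?I (g @ [x])"
        then have "\<not> W (g @ [x]) < 0" using I_step[of g x] by auto
        then show "1 \<le> exp (W (g @ [x]))" by simp
      qed (use g m len in \<open>auto simp: I1_def\<close>)
      also have "\<dots> \<le> exp (- ln 2)"
        using g m(1) len h by (auto simp: I1_def algebra_simps)
      finally have "measure (future j g) {g. \<not> ?I g} \<le> 1/2" by (simp add: exp_minus)
      then have "measure (future j g) {g. ?I g} \<ge> 1/2"
        using measure_pmf_Not[of "future j g" ?I] by simp
      also have "measure (future j g) {g. ?I g} \<le> measure (future j g) {g. I g}"
        by (rule measure_pmf.finite_measure_mono) auto
      finally show ?thesis .
    qed
    have "p ^ m * (1/2) \<le> measure (future (m + j) h) {g. I g}"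
      by (rule future_add_bound[where B="{g. I1 g}"])
        (use push_bound[of I1, OF push \<open>I1 h\<close>] p(1) stay in \<open>auto simp: less_imp_le\<close>)
    also have "\<dots> \<le> measure (future (m + j) h) {g. \<forall>s. length h \<le> s \<and> s \<le> length g \<longrightarrow> W (take s g) < 0}"
      by (rule measure_pmf.finite_measure_mono) (auto simp: I_def)
    finally show ?thesis .
  qed
  note * = this
  show ?thesis
  proof (intro exI[of _ "p ^ m * (1/2)"] conjI exI[of _ m] allI impI)
    fix h j assume "R h" "W h < 0" "m \<le> j"
    then show "measure (future j h) {g. \<forall>s. length h \<le> s \<and> s \<le> length g \<longrightarrow> W (take s g) < 0} \<ge> p ^ m * (1/2)"
      using *[of h "j - m"] by simp
  qed (use p(1) in simp)
qed

text \<open>The log-likelihood ratio computed from the actions that actually generate the outcomes.\<close>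

definition true_llr :: "'y state \<Rightarrow> 'y state \<Rightarrow> 'y history \<Rightarrow> real" where
  "true_llr G0 G1 h = (\<Sum>i<length h. llr G0 G1 (lag (take i h)) (outcome (h ! i)))"

lemma true_llr_Nil [simp]: "true_llr G0 G1 [] = 0"
  by (simp add: true_llr_def)

lemma true_llr_snoc [simp]:
  "true_llr G0 G1 (h @ [x]) = true_llr G0 G1 h + llr G0 G1 (lag h) (outcome x)"
  by (simp add: true_llr_def nth_append)

end

text \<open>The Bhattacharyya coefficient: the inequality of arithmetic and geometric means is
  strict where the two laws differ. It yields both the decay rate of the likelihood ratio test and
  the negative sign of \<open>e a a\<close>.\<close>

lemma affinity_less_1:
  fixes p q :: "'y::finite pmf"
  assumes "p \<noteq> q"
  shows "(\<Sum>y\<in>UNIV. sqrt (pmf p y * pmf q y)) < 1"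
proof -
  obtain y0 where y0: "pmf p y0 < pmf q y0" using pmf_neq_exists_less[OF assms] by auto
  have "(\<Sum>y\<in>UNIV. sqrt (pmf p y * pmf q y)) < (\<Sum>y\<in>UNIV. (pmf p y + pmf q y) / 2)"
  proof (rule sum_strict_mono_ex1)
    show "\<forall>y\<in>UNIV. sqrt (pmf p y * pmf q y) \<le> (pmf p y + pmf q y) / 2"
      by (intro ballI arith_geo_mean_sqrt pmf_nonneg)
    have "pmf p y0 * pmf q y0 < ((pmf p y0 + pmf q y0) / 2)\<^sup>2"
      using y0 zero_less_power2[of "pmf p y0 - pmf q y0"] by (simp add: power2_eq_square field_simps)
    then have "sqrt (pmf p y0 * pmf q y0) < (pmf p y0 + pmf q y0) / 2"
      by (intro real_less_lsqrt) auto
    then show "\<exists>y\<in>UNIV. sqrt (pmf p y * pmf q y) < (pmf p y + pmf q y) / 2" by blast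
  qed simp
  also have "\<dots> = ((\<Sum>y\<in>UNIV. pmf p y) + (\<Sum>y\<in>UNIV. pmf q y)) / 2"
    by (simp add: sum_divide_distrib[symmetric] sum.distrib)
  also have "\<dots> = 1" by (subst (1 2) sum_pmf_eq_1) auto
  finally show ?thesis .
qed

section \<open>Decay of the correctly specified ratio and almost sure absorption\<close>

context play
begin

text \<open>The Chernoff bound at exponent 1/2. Each period multiplies the mean of
  \<open>exp (true_llr F G h / 2)\<close> by the affinity of the two outcome laws at the lagged
  action, which is at most \<open>\<rho>\<close> whatever that action is.\<close>

lemma true_llr_exponential_decay:
  assumes full: "\<And>a. set_pmf (F a) = UNIV" "\<And>a. set_pmf (G a) = UNIV" and ne: "\<And>a. F a \<noteq> G a"
  shows "\<exists>\<rho>\<ge>0. \<rho> < 1 \<and> (\<forall>n c. measure (future n []) {h. true_llr F G h \<ge> c} \<le> exp (- c / 2) * \<rho> ^ n)"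
proof -
  have pos: "pmf (F a) y > 0" "pmf (G a) y > 0" for a y
    using full[of a] by (auto intro: pmf_positive)
  define aff where "aff a = (\<Sum>y\<in>UNIV. sqrt (pmf (F a) y * pmf (G a) y))" for a
  define \<rho> where "\<rho> = max (aff True) (aff False)"
  have aff0: "aff a \<ge> 0" for a by (auto simp: aff_def intro!: sum_nonneg)
  have \<rho>: "0 \<le> \<rho>" "\<rho> < 1"
    using aff0[of True] affinity_less_1[OF ne[of True]] affinity_less_1[OF ne[of False]]
    by (auto simp: \<rho>_def aff_def)
  have aff\<rho>: "aff a \<le> \<rho>" for a by (cases a) (auto simp: \<rho>_def)
  have aff: "measure_pmf.expectation (F a) (\<lambda>y. exp (llr F G a y / 2)) = aff a" for a
  proof -
    have "exp (llr F G a y / 2) = sqrt (pmf (G a) y / pmf (F a) y)" for y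
      using pos[of a y] by (simp add: llr_def ln_sqrt[symmetric])
    moreover have "pmf (F a) y * sqrt (pmf (G a) y / pmf (F a) y) = sqrt (pmf (F a) y * pmf (G a) y)" for y
      using pos[of a y] by (simp add: real_sqrt_divide real_sqrt_mult field_simps)
    ultimately show ?thesis unfolding aff_def
      by (subst integral_measure_pmf[of UNIV]) auto
  qed
  have E: "measure_pmf.expectation (future n []) (\<lambda>h. exp (true_llr F G h / 2)) \<le> \<rho> ^ n * exp (true_llr F G [] / 2)" for n
  proof (rule future_expectation_le[where I="\<lambda>_. True"])
    fix g
    have "measure_pmf.expectation (step g) (\<lambda>x. exp (true_llr F G (g @ [x]) / 2))
      = measure_pmf.expectation (step g) (\<lambda>x. (\<lambda>a y. exp (true_llr F G g / 2) * exp (llr F G (lag g) y / 2)) (action x) (outcome x))"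
      by (simp add: add_divide_distrib exp_add)
    also have "\<dots> \<le> \<rho> * exp (true_llr F G g / 2)"
      by (rule expectation_step_le) (simp add: aff aff\<rho> mult.commute)
    finally show "measure_pmf.expectation (step g) (\<lambda>x. exp (true_llr F G (g @ [x]) / 2)) \<le> \<rho> * exp (true_llr F G g / 2)" .
  qed (use \<rho> in auto)
  have "measure (future n []) {h. true_llr F G h \<ge> c} \<le> exp (- c / 2) * \<rho> ^ n" for n c
  proof -
    have "measure (future n []) {h. true_llr F G h \<ge> c}
        = measure_pmf.expectation (future n []) (indicator {h. true_llr F G h \<ge> c})" by simp
    also have "\<dots> \<le> measure_pmf.expectation (future n []) (\<lambda>h. exp (- c / 2) * exp (true_llr F G h / 2))"
      by (rule integral_mono_pmf_finite) (auto simp: indicator_def exp_add[symmetric])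
    also have "\<dots> \<le> exp (- c / 2) * \<rho> ^ n" using E[of n] by simp
    finally show ?thesis .
  qed
  then show ?thesis using \<rho> by blast
qed

lemma future_nth_step:
  "h \<in> set_pmf (future n []) \<Longrightarrow> i < n \<Longrightarrow> h ! i \<in> set_pmf (step (take i h))"
proof (induction n arbitrary: h)
  case (Suc n)
  then obtain g x where h: "h = g @ [x]" "g \<in> set_pmf (future n [])" "x \<in> set_pmf (step g)"
    by (auto simp: future_Suc_right simp del: future.simps)
  have "length g = n" using set_future(1)[OF h(2)] by simp
  then show ?case using Suc.IH[OF h(2)] h Suc.prems(2)
    by (cases "i = n") (auto simp: nth_append)
qed simp

lemma AE_step: "AE \<omega> in law. \<omega> n \<in> set_pmf (step (prefix \<omega> n))"
proof -
  have "AE \<omega> in law. (\<lambda>h. h ! n \<in> set_pmf (step (take n h))) (prefix \<omega> (Suc n))"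
    by (rule AE_prefixI) (simp only: future_nth_step[of _ "Suc n"] lessI)
  then show ?thesis by (simp add: nth_append)
qed

lemma eventually_sets: "{\<omega>. \<exists>t. \<forall>s\<ge>t. Q (prefix \<omega> s)} \<in> sets law"
proof -
  have "{\<omega>. \<exists>t. \<forall>s\<ge>t. Q (prefix \<omega> s)} = (\<Union>t. \<Inter>s\<in>{t..}. {\<omega>. Q (prefix \<omega> s)})" by auto
  also have "\<dots> \<in> sets law"
    by (intro sets.countable_UN' sets.countable_INT') auto
  finally show ?thesis .
qed

lemma always_sets: "{\<omega>. \<forall>s\<ge>t. Q (prefix \<omega> s)} \<in> sets law"
proof -
  have "{\<omega>. \<forall>s\<ge>t. Q (prefix \<omega> s)} = (\<Inter>s\<in>{t..}. {\<omega>. Q (prefix \<omega> s)})" by auto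
  also have "\<dots> \<in> sets law"
    by (intro sets.countable_INT') auto
  finally show ?thesis .
qed

text \<open>\<open>absorbing_probability\<close> supplies the uniform chance of absorption at each
  visit that \<open>AE_recurrent_imp\<close> turns into certainty.\<close>

lemma absorbing_AE:
  fixes W :: "'y history \<Rightarrow> real"
  assumes k: "k \<ge> 1"
    and full: "\<And>a. set_pmf (F a) = UNIV" "\<And>a. set_pmf (G a) = UNIV" and "F b \<noteq> G b"
    and W: "\<And>h x. W (h @ [x]) = W h + ln (pmf (G (action x)) (outcome x) / pmf (F (action x)) (outcome x))"
    and forced: "\<And>h x. R h \<Longrightarrow> W h < 0 \<Longrightarrow> x \<in> set_pmf (step h) \<Longrightarrow> action x = b \<and> R (h @ [x])"
  shows "AE \<omega> in law. (\<forall>m. \<exists>n\<ge>m. R (prefix \<omega> n) \<and> W (prefix \<omega> n) < 0) \<longrightarrow>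
    (\<exists>t. \<forall>s\<ge>t. W (prefix \<omega> s) < 0)"
proof -
  obtain \<delta> m where \<delta>: "\<delta> > 0" and bound: "\<And>h j. R h \<Longrightarrow> W h < 0 \<Longrightarrow> m \<le> j \<Longrightarrow>
      measure (future j h) {g. \<forall>s. length h \<le> s \<and> s \<le> length g \<longrightarrow> W (take s g) < 0} \<ge> \<delta>"
    using absorbing_probability[OF assms] by blast
  let ?C = "{\<omega>. \<exists>t. \<forall>s\<ge>t. W (prefix \<omega> s) < 0}"
  have "AE \<omega> in law. (\<forall>m. \<exists>n\<ge>m. prefix \<omega> n \<in> {h. R h \<and> W h < 0}) \<longrightarrow> \<omega> \<in> ?C"
  proof (rule AE_recurrent_imp[OF eventually_sets \<delta>])
    fix h assume h: "h \<in> {h. R h \<and> W h < 0}"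
    have "\<delta> * prob {\<omega>. prefix \<omega> (length h) = h}
        \<le> prob {\<omega>. prefix \<omega> (length h) = h \<and> (\<forall>s\<ge>length h. W (prefix \<omega> s) < 0)}"
      by (rule prob_forever[where m=m]) (use bound h in auto)
    also have "{\<omega>. prefix \<omega> (length h) = h \<and> \<omega> \<in> ?C} = {\<omega>. prefix \<omega> (length h) = h} \<inter> ?C" by auto
    then have "prob {\<omega>. prefix \<omega> (length h) = h \<and> (\<forall>s\<ge>length h. W (prefix \<omega> s) < 0)}
        \<le> prob {\<omega>. prefix \<omega> (length h) = h \<and> \<omega> \<in> ?C}"
      using prefix_sets[of "\<lambda>g. g = h" "length h"] eventually_sets[of "\<lambda>g. W g < 0"]
      by (intro finite_measure_mono) auto
    finally show "\<delta> * prob {\<omega>. prefix \<omega> (length h) = h}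
        \<le> prob {\<omega>. prefix \<omega> (length h) = h \<and> \<omega> \<in> ?C}" .
  qed
  then show ?thesis by simp
qed

end

text \<open>Hoeffding's lemma for both signs of \<open>\<theta>\<close>: positive values bound the
  upper tail of \<open>mart\<close>, negative ones show that the pattern keeps the score up.\<close>

lemma expectation_exp_le:
  fixes f :: "'a \<Rightarrow> real"
  assumes fin: "finite (set_pmf p)" and bound: "\<And>x. \<bar>f x\<bar> \<le> B"
    and mean: "measure_pmf.expectation p f = 0"
  shows "measure_pmf.expectation p (\<lambda>x. exp (\<theta> * f x)) \<le> exp (\<theta>\<^sup>2 * B\<^sup>2 / 2)"
proof -
  have pos: "measure_pmf.expectation p (\<lambda>x. exp (l * g x)) \<le> exp (l\<^sup>2 * B\<^sup>2 / 2)"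
    if l: "l > 0" and g: "\<And>x. \<bar>g x\<bar> \<le> B" "measure_pmf.expectation p g = 0" for l and g :: "'a \<Rightarrow> real"
  proof -
    interpret H: interval_bounded_random_variable "measure_pmf p" g "- B" B
      using g(1) by unfold_locales (auto simp: abs_le_iff intro: minus_le_iff[THEN iffD1])
    have "ennreal (measure_pmf.expectation p (\<lambda>x. exp (l * g x))) = (\<integral>\<^sup>+x. ennreal (exp (l * g x)) \<partial>p)"
      by (intro nn_integral_eq_integral[symmetric] integrable_measure_pmf_finite fin) auto
    also have "\<dots> \<le> ennreal (exp (l\<^sup>2 * (B - (- B))\<^sup>2 / 8))"
      by (rule H.Hoeffdings_lemma_nn_integral_0[OF l g(2)])
    finally have "measure_pmf.expectation p (\<lambda>x. exp (l * g x)) \<le> exp (l\<^sup>2 * (B - (- B))\<^sup>2 / 8)"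
      by (subst (asm) ennreal_le_iff) auto
    \<comment> \<open>The interval from \<open>- B\<close> to \<open>B\<close> has length
      \<open>2 * B\<close>, which turns the constant 1/8 into 1/2.\<close>
    also have "l\<^sup>2 * (B - (- B))\<^sup>2 / 8 = l\<^sup>2 * B\<^sup>2 / 2" by (simp add: power2_eq_square)
    finally show ?thesis .
  qed
  consider "\<theta> > 0" | "\<theta> < 0" | "\<theta> = 0" by linarith
  then show ?thesis
  proof cases
    case 1
    then show ?thesis using pos bound mean by blast
  next
    case 2
    then show ?thesis using pos[of "- \<theta>" "\<lambda>x. - f x"] bound mean by simp
  qed simp
qed

section \<open>The game\<close>

locale game =
  fixes v :: "'y::finite \<Rightarrow> real"
    and k :: nat
    and init :: "int \<Rightarrow> bool"
    and F0 F1 :: "'y state"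
    and \<pi>0 :: "'y state pmf"
  assumes lag: "k \<ge> 1"
    and full_support: "\<And>a. set_pmf (F0 a) = UNIV" "\<And>a. set_pmf (F1 a) = UNIV"
    and distinct: "\<And>a. F0 a \<noteq> F1 a"
    and best_reply1: "payoff v F1 True > payoff v F1 False"
    and best_reply0: "payoff v F0 False > payoff v F0 True"
    and prior_support: "set_pmf \<pi>0 = {F0, F1}"
    and never_indifferent: "\<And>h. h \<in> histories \<Longrightarrow> \<not> indifferent v \<pi>0 h"
begin

abbreviation "step F \<sigma> \<equiv> period_pmf k init F \<sigma> (agent_opt v \<pi>0)"
abbreviation "law F \<sigma> \<equiv> play_measure k init F \<sigma> (agent_opt v \<pi>0)"
abbreviation "future F \<sigma> \<equiv> play.future k init F \<sigma> (agent_opt v \<pi>0)"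
abbreviation "lagged h \<equiv> past_action init h (int (length h) + 1 - int k)"
abbreviation "l a y \<equiv> llr F0 F1 a y"
abbreviation "e a b \<equiv> expected_llr F0 F1 a b"

lemma pmf_pos: "pmf (F0 a) y > 0" "pmf (F1 a) y > 0"
  using full_support[of a] by (auto intro: pmf_positive)

lemma llr_swap: "llr F1 F0 a y = - l a y"
  using pmf_pos[of a y] by (simp add: llr_def ln_div)

text \<open>
  The subjective log-likelihood ratio, shifted so that the agent prefers action 1 iff it is positive.
\<close>

definition score :: "'y history \<Rightarrow> real" where
  "score h = ln (pmf \<pi>0 F1 / pmf \<pi>0 F0)
     + ln ((payoff v F1 True - payoff v F1 False) / (payoff v F0 False - payoff v F0 True))
     + (\<Sum>x\<leftarrow>h. l (action x) (outcome x))"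

lemma score_snoc [simp]: "score (h @ [x]) = score h + l (action x) (outcome x)"
  by (simp add: score_def)

lemma score_sign:
  "prefers1 v \<pi>0 h \<longleftrightarrow> score h > 0" "indifferent v \<pi>0 h \<longleftrightarrow> score h = 0"
proof -
  have L: "likelihood F0 h > 0" "likelihood F1 h > 0"
    unfolding likelihood_def by (induction h) (auto simp: pmf_pos)
  have p: "pmf \<pi>0 F0 > 0" "pmf \<pi>0 F1 > 0"
    using prior_support by (auto intro: pmf_positive)
  have D: "payoff v F1 True - payoff v F1 False > 0" "payoff v F0 False - payoff v F0 True > 0"
    using best_reply1 best_reply0 by auto
  have ne: "F0 \<noteq> F1" using distinct by auto
  \<comment> \<open>\<open>X\<close> and \<open>Y\<close> are the unnormalised expected gain from
    action 1 in state \<open>F1\<close> and loss in state \<open>F0\<close>; their logarithms differ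
    by the score.\<close>
  define X where "X = pmf \<pi>0 F1 * likelihood F1 h * (payoff v F1 True - payoff v F1 False)"
  define Y where "Y = pmf \<pi>0 F0 * likelihood F0 h * (payoff v F0 False - payoff v F0 True)"
  have XY: "X > 0" "Y > 0" using L p D by (auto simp: X_def Y_def)
  have "(\<Sum>x\<leftarrow>h. l (action x) (outcome x)) = ln (likelihood F1 h / likelihood F0 h)"
  proof (induction h)
    case (Cons x h)
    have "likelihood F0 h > 0" "likelihood F1 h > 0"
      unfolding likelihood_def by (induction h) (auto simp: pmf_pos)
    then show ?case using Cons pmf_pos[of "action x" "outcome x"]
      by (simp add: likelihood_def llr_def ln_mult ln_div)
  qed (simp add: likelihood_def)
  then have S: "score h = ln X - ln Y"
    using L p D by (simp add: score_def X_def Y_def ln_mult ln_div)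
  define Z where "Z = (\<Sum>G\<in>set_pmf \<pi>0. pmf \<pi>0 G * likelihood G h)"
  have Z: "Z > 0" using L p ne by (simp add: Z_def prior_support add_pos_pos)
  have "subjective_payoff v \<pi>0 h a = (pmf \<pi>0 F0 * likelihood F0 h * payoff v F0 a
      + pmf \<pi>0 F1 * likelihood F1 h * payoff v F1 a) / Z" for a
    unfolding subjective_payoff_def posterior_def Z_def[symmetric]
    using ne by (simp add: prior_support add_divide_distrib)
  then have "subjective_payoff v \<pi>0 h True - subjective_payoff v \<pi>0 h False = (X - Y) / Z"
    by (simp add: X_def Y_def diff_divide_distrib[symmetric] algebra_simps)
  then have diff: "subjective_payoff v \<pi>0 h True = subjective_payoff v \<pi>0 h False + (X - Y) / Z"
    by simp
  have "subjective_payoff v \<pi>0 h True > subjective_payoff v \<pi>0 h False \<longleftrightarrow> X > Y"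
    unfolding diff using Z by (simp add: zero_less_divide_iff)
  also have "X > Y \<longleftrightarrow> score h > 0" using XY by (simp add: S)
  finally show "prefers1 v \<pi>0 h \<longleftrightarrow> score h > 0" by (simp add: prefers1_def)
  have "subjective_payoff v \<pi>0 h True = subjective_payoff v \<pi>0 h False \<longleftrightarrow> X = Y"
    unfolding diff using Z by simp
  also have "X = Y \<longleftrightarrow> score h = 0" using XY by (simp add: S)
  finally show "indifferent v \<pi>0 h \<longleftrightarrow> score h = 0" by (simp add: indifferent_def)
qed

lemma score_nonzero: "h \<in> histories \<Longrightarrow> score h \<noteq> 0"
  using never_indifferent score_sign(2) by blast

lemma agent_opt_score: "agent_opt v \<pi>0 h = (if score h > 0 then 1 else 0)"
  by (simp add: agent_opt_def score_sign)

lemma conviction_event_eq: "conviction_event v \<pi>0 = {\<omega>. \<exists>t. \<forall>s\<ge>t. score (prefix \<omega> s) > 0}"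
  by (simp add: conviction_event_def score_sign)

lemma no_accept: "x \<in> set_pmf (step F \<sigma> h) \<Longrightarrow> score h \<le> 0 \<or> \<sigma> h = 0 \<Longrightarrow> \<not> action x"
  by (rule play.no_accept) (auto simp: agent_opt_score)

lemma accept: "x \<in> set_pmf (step F \<sigma> h) \<Longrightarrow> score h > 0 \<Longrightarrow> \<sigma> h = 1 \<Longrightarrow> action x"
  using play.accept[of x k init F \<sigma> "agent_opt v \<pi>0" h] by (simp add: agent_opt_score)

text \<open>One constant for plain and centred increments and for the means; the summand 1 keeps it
  positive, as it is divided by later.\<close>

definition bound :: real where
  "bound = 1 + Max (range (\<lambda>(a, b, y). \<bar>l b y\<bar> + \<bar>e a b\<bar>))"

lemma bound: "\<bar>l b y\<bar> + \<bar>e a b\<bar> + 1 \<le> bound"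
proof -
  have "(\<lambda>(a, b, y). \<bar>l b y\<bar> + \<bar>e a b\<bar>) (a, b, y) \<le> Max (range (\<lambda>(a, b, y). \<bar>l b y\<bar> + \<bar>e a b\<bar>))"
    by (rule Max_ge[OF _ rangeI]) simp
  then show ?thesis by (simp add: bound_def)
qed

lemma bound_pos: "bound > 0" and llr_bound: "\<bar>l b y\<bar> \<le> bound"
  and centred_bound: "\<bar>l b y - e a b\<bar> \<le> bound"
  using bound[of b y a] by auto

section \<open>Long-run sign of the score in both states\<close>

lemma F0_disbelief_absorbing:
  "AE \<omega> in law F0 \<sigma>. (\<forall>m. \<exists>n\<ge>m. score (prefix \<omega> n) < 0) \<longrightarrow> (\<exists>t. \<forall>s\<ge>t. score (prefix \<omega> s) < 0)"
proof -
  interpret p: play k init F0 \<sigma> "agent_opt v \<pi>0" .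
  show ?thesis
    using p.absorbing_AE[of F1 False score "\<lambda>_. True"] lag full_support distinct no_accept
    by (simp add: llr_def)
qed

text \<open>Failure of conviction gives nonpositive scores infinitely often. The absence of
  indifference makes them strictly negative, and then absorption applies.\<close>

lemma F0_not_convinced:
  "AE \<omega> in law F0 \<sigma>. \<omega> \<notin> conviction_event v \<pi>0 \<longrightarrow> (\<exists>t. \<forall>s\<ge>t. score (prefix \<omega> s) < 0)"
proof -
  interpret p: play k init F0 \<sigma> "agent_opt v \<pi>0" .
  have "AE \<omega> in law F0 \<sigma>. \<forall>n. prefix \<omega> n \<in> histories"
    using p.AE_prefix_histories by (simp add: AE_all_countable)
  then show ?thesis
    using F0_disbelief_absorbing[of \<sigma>]
  proof eventually_elim
    case (elim \<omega>)
    show ?case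
    proof
      assume "\<omega> \<notin> conviction_event v \<pi>0"
      then have "\<forall>m. \<exists>n\<ge>m. score (prefix \<omega> n) \<le> 0" by (auto simp: conviction_event_eq not_less)
      then have "\<forall>m. \<exists>n\<ge>m. score (prefix \<omega> n) < 0"
        using elim(1) score_nonzero by (meson order_le_imp_less_or_eq)
      then show "\<exists>t. \<forall>s\<ge>t. score (prefix \<omega> s) < 0" using elim(2) by blast
    qed
  qed
qed

text \<open>Permanent disbelief means action 0 forever. After the lag has passed, the score and
  \<open>true_llr F1 F0\<close> move by opposite amounts, so a negative score keeps this ratio above
  a constant; in state \<open>F1\<close> the chance of that decays exponentially.\<close>

lemma F1_disbelief_null: "AE \<omega> in law F1 \<sigma>. \<not> (\<exists>t. \<forall>s\<ge>t. score (prefix \<omega> s) < 0)"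
proof -
  interpret p: play k init F1 \<sigma> "agent_opt v \<pi>0" .
  obtain \<rho> where \<rho>: "\<rho> \<ge> 0" "\<rho> < 1" and decay: "\<And>n c. measure (p.future n []) {h. p.true_llr F1 F0 h \<ge> c} \<le> exp (- c / 2) * \<rho> ^ n"
    using p.true_llr_exponential_decay[of F0] full_support distinct by metis
  have "p.prob {\<omega>. \<forall>s\<ge>t. score (prefix \<omega> s) < 0} = 0" for t
  proof -
    \<comment> \<open>Before time \<open>t + k\<close> a period changes the sum of score and ratio
      by at most \<open>2 * bound\<close>; from then on lagged and current action are both 0 and the
      sum is constant.\<close>
    define c where "c = score [] - 2 * bound * (real t + real k)"
    have low: "p.true_llr F1 F0 h \<ge> c"
      if h: "h \<in> set_pmf (p.future n [])" "n \<ge> t" "\<forall>s. t \<le> s \<and> s \<le> n \<longrightarrow> score (take s h) < 0" for h n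
    proof -
      have len: "length h = n" using p.set_future[OF h(1)] by simp
      have act: "\<not> action (h ! i)" if "t \<le> i" "i < n" for i
        using p.future_nth_step[OF h(1), of i] no_accept h(3) that by (meson less_imp_le)
      have "score (take i h) + p.true_llr F1 F0 (take i h) \<ge> score [] - 2 * bound * real (min i (t + k))"
        if "i \<le> n" for i
        using that
      proof (induction i)
        case (Suc i)
        let ?x = "h ! i" and ?g = "take i h"
        have g: "take (Suc i) h = ?g @ [?x]" using Suc.prems len by (simp add: take_Suc_conv_app_nth)
        have eq: "score (take (Suc i) h) + p.true_llr F1 F0 (take (Suc i) h)
            = score ?g + p.true_llr F1 F0 ?g + (l (action ?x) (outcome ?x) - l (lagged ?g) (outcome ?x))"
          unfolding g by (simp add: llr_swap)
        show ?case
        proof (cases "t + k \<le> i")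
          case True
          have "lagged ?g = action (h ! (i - k))"
            using p.lag_eq[of ?g] lag True Suc.prems len by (simp add: min_def)
          then have "\<not> lagged ?g" using act[of "i - k"] True Suc.prems lag by simp
          moreover have "\<not> action ?x" using act True Suc.prems by simp
          moreover have "min (Suc i) (t + k) = min i (t + k)" using True by simp
          ultimately show ?thesis using eq Suc by simp
        next
          case False
          then show ?thesis
            using eq Suc bound_pos llr_bound[of "action ?x" "outcome ?x"] llr_bound[of "lagged ?g" "outcome ?x"]
            by (simp add: min_def algebra_simps abs_le_iff)
        qed
      qed simp
      from this[of n] have "score h + p.true_llr F1 F0 h \<ge> score [] - 2 * bound * real (min n (t + k))"
        using len by simp
      moreover have "score h < 0" using h(2,3) len by (auto dest: spec[of _ n])
      moreover have "bound * real (min n (t + k)) \<le> bound * (real t + real k)"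
        using bound_pos by (intro mult_left_mono) auto
      ultimately show ?thesis unfolding c_def by linarith
    qed
    have "p.prob {\<omega>. \<forall>s\<ge>t. score (prefix \<omega> s) < 0} \<le> exp (- c / 2) * \<rho> ^ n" if "n \<ge> t" for n
    proof -
      have "p.prob {\<omega>. \<forall>s\<ge>t. score (prefix \<omega> s) < 0}
          \<le> p.prob {\<omega>. (\<lambda>h. \<forall>s. t \<le> s \<and> s \<le> n \<longrightarrow> score (take s h) < 0) (prefix \<omega> n)}"
        by (rule p.finite_measure_mono[OF _ p.prefix_sets]) auto
      also have "\<dots> = measure (p.future n []) {h. \<forall>s. t \<le> s \<and> s \<le> n \<longrightarrow> score (take s h) < 0}"
        by (rule p.prob_prefix)
      also have "\<dots> \<le> measure (p.future n []) {h. p.true_llr F1 F0 h \<ge> c}"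
        using low that by (intro measure_pmf.finite_measure_mono_AE) (auto simp: AE_measure_pmf_iff)
      also have "\<dots> \<le> exp (- c / 2) * \<rho> ^ n" by (rule decay)
      finally show ?thesis .
    qed
    moreover have "(\<lambda>n. exp (- c / 2) * \<rho> ^ n) \<longlonglongrightarrow> exp (- c / 2) * 0"
      using \<rho> by (intro tendsto_mult LIMSEQ_power_zero tendsto_const) auto
    ultimately have "p.prob {\<omega>. \<forall>s\<ge>t. score (prefix \<omega> s) < 0} \<le> 0"
      by (intro LIMSEQ_le_const[where X="\<lambda>n. exp (- c / 2) * \<rho> ^ n"]) auto
    then show ?thesis by (simp add: measure_le_0_iff)
  qed
  then have "AE \<omega> in law F1 \<sigma>. \<omega> \<notin> {\<omega>. \<forall>s\<ge>t. score (prefix \<omega> s) < 0}" for t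
    using p.prob_eq_0[OF p.always_sets[of t "\<lambda>h. score h < 0"]] by simp
  then have "AE \<omega> in law F1 \<sigma>. \<forall>t. \<omega> \<notin> {\<omega>. \<forall>s\<ge>t. score (prefix \<omega> s) < 0}"
    by (simp add: AE_all_countable)
  then show ?thesis by eventually_elim simp
qed

text \<open>Absorption with \<open>W = - score\<close> and \<open>b = True\<close>. The condition
  \<open>Q\<close> on the first \<open>N\<close> periods later carries the principal's test of the
  state, after which action 1 is always proposed.\<close>

lemma F1_eventually_action1:
  assumes \<sigma>: "\<And>h. N \<le> length h \<Longrightarrow> Q (take N h) \<Longrightarrow> \<sigma> h = 1"
  shows "AE \<omega> in law F1 \<sigma>. Q (prefix \<omega> N) \<longrightarrow> (\<exists>t. \<forall>s\<ge>t. action (\<omega> s))"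
proof -
  interpret p: play k init F1 \<sigma> "agent_opt v \<pi>0" .
  let ?R = "\<lambda>h. N \<le> length h \<and> Q (take N h)"
  have "AE \<omega> in law F1 \<sigma>. (\<forall>m. \<exists>n\<ge>m. ?R (prefix \<omega> n) \<and> - score (prefix \<omega> n) < 0) \<longrightarrow>
      (\<exists>t. \<forall>s\<ge>t. - score (prefix \<omega> s) < 0)"
  proof (rule p.absorbing_AE[where G=F0 and b=True])
    show "- score (h @ [x]) = - score h + ln (pmf (F0 (action x)) (outcome x) / pmf (F1 (action x)) (outcome x))" for h x
      using llr_swap[of "action x" "outcome x"] by (simp add: llr_def)
    show "action x = True \<and> ?R (h @ [x])" if "?R h" "- score h < 0" "x \<in> set_pmf (p.step h)" for h x
      using accept[OF that(3)] that \<sigma>[of h] by auto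
  qed (use lag full_support distinct in \<open>auto simp: eq_commute\<close>)
  moreover have "AE \<omega> in law F1 \<sigma>. \<forall>n. prefix \<omega> n \<in> histories"
    using p.AE_prefix_histories by (simp add: AE_all_countable)
  moreover have "AE \<omega> in law F1 \<sigma>. \<forall>n. \<omega> n \<in> set_pmf (p.step (prefix \<omega> n))"
    using p.AE_step by (simp add: AE_all_countable)
  ultimately show ?thesis
    using F1_disbelief_null[of \<sigma>]
  proof eventually_elim
    case (elim \<omega>)
    show ?case
    proof
      assume Q: "Q (prefix \<omega> N)"
      then have R: "?R (prefix \<omega> n)" if "n \<ge> N" for n using that by (simp add: min_def)
      have "\<exists>n\<ge>m. ?R (prefix \<omega> n) \<and> - score (prefix \<omega> n) < 0" for m
      proof -
        obtain n where "n \<ge> max m N" "\<not> score (prefix \<omega> n) < 0" using elim(4) by blast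
        moreover have "score (prefix \<omega> n) \<noteq> 0" using elim(2) score_nonzero by blast
        ultimately show ?thesis using R[of n] by (intro exI[of _ n]) auto
      qed
      then obtain t where t: "\<And>s. s \<ge> t \<Longrightarrow> score (prefix \<omega> s) > 0" using elim(1) by auto
      have "action (\<omega> s)" if "s \<ge> max t N" for s
        using elim(3) accept[of "\<omega> s" F1 \<sigma> "prefix \<omega> s"] t[of s] \<sigma>[of "prefix \<omega> s"] R[of s] that by auto
      then show "\<exists>t. \<forall>s\<ge>t. action (\<omega> s)" by blast
    qed
  qed
qed

end

text \<open>Shifting the window by one period telescopes to a difference of two values in the unit
  interval.\<close>

lemma shifted_sum_bound:
  fixes f :: "int \<Rightarrow> real"
  assumes "\<And>s. 0 \<le> f s" "\<And>s. f s \<le> 1"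
  shows "\<bar>(\<Sum>i<n. f (int i + 1 - int k)) - (\<Sum>i<n. f (int i + 1))\<bar> \<le> real k"
proof (induction k)
  case (Suc k)
  define g where "g i = f (int i - int k)" for i
  have "(\<Sum>i<n. f (int i + 1 - int k)) - (\<Sum>i<n. f (int i + 1 - int (Suc k))) = (\<Sum>i<n. g (Suc i) - g i)"
    by (simp add: g_def sum_subtractf algebra_simps)
  also have "\<dots> = g n - g 0" by (rule sum_lessThan_telescope)
  also have "\<bar>\<dots>\<bar> \<le> 1"
    using assms(1)[of "int n - int k"] assms(2)[of "int n - int k"] assms(1)[of "- int k"] assms(2)[of "- int k"]
    by (simp add: g_def abs_le_iff)
  finally show ?case using Suc by linarith
qed simp

lemma (in play) lag_balance:
  assumes "k \<ge> 1"
  shows "\<bar>\<Sum>i<length h. of_bool (lag (take i h)) - of_bool (action (h ! i)) :: real\<bar> \<le> real k"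
proof -
  define f :: "int \<Rightarrow> real" where "f s = of_bool (past_action init h s)" for s
  have "lag (take i h) = past_action init h (int i + 1 - int k)" if "i < length h" for i
    using that assms by (auto simp: past_action_def min_def)
  then have "(\<Sum>i<length h. of_bool (lag (take i h)) - of_bool (action (h ! i)) :: real)
      = (\<Sum>i<length h. f (int i + 1 - int k) - f (int i + 1))"
    by (intro sum.cong refl) (auto simp: f_def past_action_def)
  then show ?thesis
    using shifted_sum_bound[of f k "length h"] by (simp add: f_def sum_subtractf)
qed

context game
begin

section \<open>Compensating the score under F0\<close>

definition count :: "'y history \<Rightarrow> real" where
  "count h = (\<Sum>i<length h. of_bool (action (h ! i)))"

text \<open>The compensator uses the realised current action instead of averaging over it. The
  outcome is independent of that choice, so centring still works, and the drift depends on the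
  transitions alone.\<close>

definition drift :: "'y history \<Rightarrow> real" where
  "drift h = (\<Sum>i<length h. e (lagged (take i h)) (action (h ! i)))"

definition mart :: "'y history \<Rightarrow> real" where
  "mart h = score h - drift h"

lemma drift_snoc: "drift (h @ [x]) = drift h + e (lagged h) (action x)"
  by (simp add: drift_def nth_append)

lemma mart_snoc: "mart (h @ [x]) = mart h + (l (action x) (outcome x) - e (lagged h) (action x))"
  by (simp add: mart_def drift_snoc)

lemma mart_Nil [simp]: "mart [] = score []"
  by (simp add: mart_def drift_def)

lemma count_nonneg: "0 \<le> count h" and count_le: "count h \<le> real (length h)"
proof -
  show "0 \<le> count h" by (auto simp: count_def intro!: sum_nonneg)
  have "count h \<le> (\<Sum>i<length h. 1)" unfolding count_def by (intro sum_mono) auto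
  then show "count h \<le> real (length h)" by simp
qed

text \<open>Weak duality: a certificate for single transitions is summed along the history, and the
  price \<open>\<mu>\<close> of imbalance costs only a constant. The case \<open>c = 1\<close>
  bounds the frequency of action 1, the case \<open>c = 0\<close> the drift itself.\<close>

lemma linear_bound:
  assumes "\<And>a b. c * of_bool b + \<kappa> * e a b \<le> \<Lambda> + \<mu> * (of_bool a - of_bool b)"
  shows "c * count h + \<kappa> * drift h \<le> \<Lambda> * real (length h) + \<bar>\<mu>\<bar> * real k"
proof -
  let ?a = "\<lambda>i. lagged (take i h)" and ?b = "\<lambda>i. action (h ! i)"
  have "c * count h + \<kappa> * drift h = (\<Sum>i<length h. c * of_bool (?b i) + \<kappa> * e (?a i) (?b i))"
    by (simp add: count_def drift_def sum.distrib sum_distrib_left)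
  also have "\<dots> \<le> (\<Sum>i<length h. \<Lambda> + \<mu> * (of_bool (?a i) - of_bool (?b i)))"
    by (intro sum_mono assms)
  also have "\<dots> = \<Lambda> * real (length h) + \<mu> * (\<Sum>i<length h. of_bool (?a i) - of_bool (?b i))"
    by (simp add: sum.distrib sum_distrib_left)
  also have "\<mu> * (\<Sum>i<length h. of_bool (?a i) - of_bool (?b i)) \<le> \<bar>\<mu>\<bar> * real k"
  proof -
    have "\<mu> * x \<le> \<bar>\<mu>\<bar> * real k" if "\<bar>x\<bar> \<le> real k" for x
      using mult_left_mono[OF that, of "\<bar>\<mu>\<bar>"] abs_ge_self[of "\<mu> * x"] by (simp add: abs_mult)
    then show ?thesis using play.lag_balance[OF lag, of init h] .
  qed
  finally show ?thesis by simp
qed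

section \<open>Martingale estimates in state \<open>F0\<close>\<close>

lemma centred_mean: "measure_pmf.expectation (F0 a) (\<lambda>y. l b y - e a b) = 0"
  by (subst Bochner_Integration.integral_diff)
    (auto simp: expected_llr_def intro: integrable_measure_pmf_finite)

lemma mart_expectation: "measure_pmf.expectation (step F0 \<sigma> h) (\<lambda>x. mart (h @ [x])) \<le> mart h"
proof -
  interpret p: play k init F0 \<sigma> "agent_opt v \<pi>0" .
  have "measure_pmf.expectation (p.step h) (\<lambda>x. mart (h @ [x]))
      = measure_pmf.expectation (p.step h)
          (\<lambda>x. (\<lambda>a y. mart h + (l a y - e (lagged h) a)) (action x) (outcome x))"
    by (simp add: mart_snoc)
  also have "\<dots> \<le> mart h"
  proof (rule p.expectation_step_le)
    fix x
    show "measure_pmf.expectation (F0 (p.lag h)) (\<lambda>y. mart h + (l (action x) y - e (lagged h) (action x))) \<le> mart h"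
      by (subst Bochner_Integration.integral_add)
        (auto simp: centred_mean intro: integrable_measure_pmf_finite)
  qed
  finally show ?thesis .
qed

lemma mart_exp_expectation:
  "measure_pmf.expectation (step F0 \<sigma> h) (\<lambda>x. exp (\<theta> * mart (h @ [x])))
    \<le> exp (\<theta>\<^sup>2 * bound\<^sup>2 / 2) * exp (\<theta> * mart h)"
proof -
  interpret p: play k init F0 \<sigma> "agent_opt v \<pi>0" .
  have "measure_pmf.expectation (p.step h) (\<lambda>x. exp (\<theta> * mart (h @ [x])))
      = measure_pmf.expectation (p.step h)
          (\<lambda>x. (\<lambda>a y. exp (\<theta> * mart h) * exp (\<theta> * (l a y - e (lagged h) a))) (action x) (outcome x))"
    by (simp add: mart_snoc exp_add[symmetric] ring_distribs)
  also have "\<dots> \<le> exp (\<theta> * mart h) * exp (\<theta>\<^sup>2 * bound\<^sup>2 / 2)"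
  proof (rule p.expectation_step_le)
    fix x
    show "measure_pmf.expectation (F0 (p.lag h)) (\<lambda>y. exp (\<theta> * mart h) * exp (\<theta> * (l (action x) y - e (lagged h) (action x))))
      \<le> exp (\<theta> * mart h) * exp (\<theta>\<^sup>2 * bound\<^sup>2 / 2)"
      using expectation_exp_le[of "F0 (p.lag h)" "\<lambda>y. l (action x) y - e (lagged h) (action x)" bound \<theta>]
      by (simp add: centred_bound centred_mean)
  qed
  finally show ?thesis by (simp add: mult.commute)
qed

lemma mart_tail:
  assumes \<eta>: "\<eta> > 0"
  shows "measure (future F0 \<sigma> n []) {h. mart h \<ge> score [] + \<eta> * real n} \<le> exp (- (\<eta>\<^sup>2 / (2 * bound\<^sup>2))) ^ n"
proof -
  interpret p: play k init F0 \<sigma> "agent_opt v \<pi>0" .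
  \<comment> \<open>This value minimises the exponent
    \<open>\<theta>\<^sup>2 * bound\<^sup>2 / 2 - \<theta> * \<eta>\<close>.\<close>
  define \<theta> where "\<theta> = \<eta> / bound\<^sup>2"
  have \<theta>: "\<theta> > 0" using \<eta> bound_pos by (simp add: \<theta>_def)
  have E: "measure_pmf.expectation (p.future n []) (\<lambda>h. exp (\<theta> * mart h))
      \<le> exp (\<theta>\<^sup>2 * bound\<^sup>2 / 2) ^ n * exp (\<theta> * mart [])"
    by (rule p.future_expectation_le[where I="\<lambda>_. True"]) (auto intro: mart_exp_expectation)
  have "measure (p.future n []) {h. mart h \<ge> score [] + \<eta> * real n}
      = measure_pmf.expectation (p.future n []) (indicator {h. mart h \<ge> score [] + \<eta> * real n})" by simp
  also have "\<dots> \<le> measure_pmf.expectation (p.future n []) (\<lambda>h. exp (- \<theta> * (score [] + \<eta> * real n)) * exp (\<theta> * mart h))"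
    using \<theta> by (intro integral_mono_pmf_finite)
      (auto simp: indicator_def exp_add[symmetric] right_diff_distrib[symmetric] mult_left_mono)
  also have "\<dots> = exp (- \<theta> * (score [] + \<eta> * real n)) * measure_pmf.expectation (p.future n []) (\<lambda>h. exp (\<theta> * mart h))"
    by simp
  also have "\<dots> \<le> exp (- \<theta> * (score [] + \<eta> * real n)) * (exp (\<theta>\<^sup>2 * bound\<^sup>2 / 2) ^ n * exp (\<theta> * mart []))"
    by (intro mult_left_mono E) auto
  also have "\<dots> = exp (real n * (\<theta>\<^sup>2 * bound\<^sup>2 / 2 - \<theta> * \<eta>))"
    by (simp add: exp_of_nat_mult[symmetric] exp_add[symmetric] algebra_simps)
  also have "\<theta>\<^sup>2 * bound\<^sup>2 / 2 - \<theta> * \<eta> = - (\<eta>\<^sup>2 / (2 * bound\<^sup>2))"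
    using bound_pos by (simp add: \<theta>_def power2_eq_square field_simps)
  finally show ?thesis by (simp only: exp_of_nat_mult)
qed

text \<open>Minus a Kullback-Leibler divergence. Applying \<open>ln x \<le> x - 1\<close> to the
  square root of the ratio reduces strict negativity to the affinity bound.\<close>

lemma llr_mean_neg: "e a a < 0"
proof -
  have "e a a = (\<Sum>y\<in>UNIV. pmf (F0 a) y * l a y)"
    by (simp add: expected_llr_def) (subst integral_measure_pmf[of UNIV], auto)
  also have "\<dots> \<le> (\<Sum>y\<in>UNIV. 2 * (sqrt (pmf (F0 a) y * pmf (F1 a) y) - pmf (F0 a) y))"
  proof (rule sum_mono)
    fix y
    let ?r = "sqrt (pmf (F1 a) y / pmf (F0 a) y)"
    have r: "?r > 0" using pmf_pos[of a y] by simp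
    have "l a y = 2 * ln ?r" using pmf_pos[of a y] by (simp add: llr_def ln_sqrt)
    also have "\<dots> \<le> 2 * (?r - 1)" using ln_le_minus_one[OF r] by simp
    finally have "pmf (F0 a) y * l a y \<le> pmf (F0 a) y * (2 * (?r - 1))"
      by (intro mult_left_mono) auto
    also have "pmf (F0 a) y * ?r = sqrt (pmf (F0 a) y * pmf (F1 a) y)"
      using pmf_pos[of a y] by (simp add: real_sqrt_divide real_sqrt_mult field_simps)
    then have "pmf (F0 a) y * (2 * (?r - 1)) = 2 * (sqrt (pmf (F0 a) y * pmf (F1 a) y) - pmf (F0 a) y)"
      by (simp add: algebra_simps)
    finally show "pmf (F0 a) y * l a y \<le> 2 * (sqrt (pmf (F0 a) y * pmf (F1 a) y) - pmf (F0 a) y)" .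
  qed
  also have "\<dots> = 2 * ((\<Sum>y\<in>UNIV. sqrt (pmf (F0 a) y * pmf (F1 a) y)) - (\<Sum>y\<in>UNIV. pmf (F0 a) y))"
    by (simp only: sum_subtractf sum_distrib_left right_diff_distrib)
  also have "(\<Sum>y\<in>UNIV. pmf (F0 a) y) = 1" by (rule sum_pmf_eq_1) auto
  also have "2 * ((\<Sum>y\<in>UNIV. sqrt (pmf (F0 a) y * pmf (F1 a) y)) - 1) < 0"
    using affinity_less_1[OF distinct[of a]] by simp
  finally show ?thesis .
qed

text \<open>From any score at most \<open>K\<close>, a fixed number of unfavourable outcomes pushes
  it to 0 or below with probability at least \<open>q ^ m\<close>. If such scores recurred, the
  zero-one bound would produce nonpositive scores after every \<open>t\<close>, contradicting
  conviction.\<close>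

lemma F0_conviction_diverges:
  "AE \<omega> in law F0 \<sigma>. \<omega> \<in> conviction_event v \<pi>0 \<longrightarrow> (\<forall>K. \<exists>t. \<forall>s\<ge>t. score (prefix \<omega> s) > K)"
proof -
  interpret p: play k init F0 \<sigma> "agent_opt v \<pi>0" .
  have "\<exists>y. pmf (F1 b) y < pmf (F0 b) y" for b
    using pmf_neq_exists_less[of "F1 b" "F0 b"] distinct[of b] by auto
  then obtain Y where Y: "\<And>b. pmf (F1 b) (Y b) < pmf (F0 b) (Y b)" by metis
  define \<eta> where "\<eta> = min (- l True (Y True)) (- l False (Y False))"
  have "l b (Y b) < 0" for b using Y[of b] pmf_pos by (simp add: llr_def ln_less_zero_iff)
  then have \<eta>: "\<eta> > 0" by (simp add: \<eta>_def)
  have \<eta>l: "l b (Y b) \<le> - \<eta>" for b by (cases b) (auto simp: \<eta>_def)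
  \<comment> \<open>An outcome is drawn under the lagged action \<open>a\<close> but read under the
    current action \<open>b\<close>, so the minimum runs over all pairs.\<close>
  define q where "q = Min (range (\<lambda>(a, b). pmf (F0 a) (Y b)))"
  have q: "q > 0" using pmf_pos by (auto simp: q_def)
  have q_le: "q \<le> pmf (F0 a) (Y b)" for a b
    unfolding q_def by (rule Min_le) (auto intro: range_eqI[of _ _ "(a, b)"])
  have K: "AE \<omega> in law F0 \<sigma>. (\<forall>m. \<exists>n\<ge>m. prefix \<omega> n \<in> {h. score h \<le> real K}) \<longrightarrow>
      \<omega> \<in> {\<omega>. \<exists>s\<ge>t. score (prefix \<omega> s) \<le> 0}" for K t :: nat
  proof -
    obtain m where m: "real m * \<eta> > real K" using reals_Archimedean3[OF \<eta>] by blast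
    have C: "{\<omega>. \<exists>s\<ge>t. score (prefix \<omega> s) \<le> 0} = - {\<omega>. \<forall>s\<ge>t. \<not> score (prefix \<omega> s) \<le> 0}" by auto
    have Cs: "{\<omega>. \<exists>s\<ge>t. score (prefix \<omega> s) \<le> 0} \<in> sets (law F0 \<sigma>)"
      unfolding C Compl_eq_Diff_UNIV p.space_law[symmetric]
      using p.always_sets[of t "\<lambda>h. \<not> score h \<le> 0"] by (intro sets.compl_sets) simp
    show ?thesis
    proof (rule p.AE_recurrent_imp[where \<delta>="q ^ m" and t=t])
      fix h assume h: "h \<in> {h. score h \<le> real K}" "t \<le> length h"
      let ?I = "\<lambda>g. score g \<le> score h - \<eta> * (real (length g) - real (length h))"
      have push: "q \<le> measure (p.step g) {x. ?I (g @ [x])}" if "?I g" for g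
      proof -
        have "q \<le> measure (p.step g) {x. outcome x = Y (action x)}"
          using p.measure_step_ge[of g q "\<lambda>a y. y = Y a"] q_le by (simp add: measure_pmf_single)
        also have "\<dots> \<le> measure (p.step g) {x. ?I (g @ [x])}"
        proof (rule measure_pmf.finite_measure_mono, intro subsetI CollectI)
          fix x :: "'y period" assume "x \<in> {x. outcome x = Y (action x)}"
          then have "l (action x) (outcome x) \<le> - \<eta>" using \<eta>l[of "action x"] by simp
          then show "?I (g @ [x])" using that by (simp add: algebra_simps)
        qed simp
        finally show ?thesis .
      qed
      have "q ^ m * p.prob {\<omega>. prefix \<omega> (length h) = h} \<le> measure (p.future m h) {g. ?I g} * p.prob {\<omega>. prefix \<omega> (length h) = h}"
        using p.push_bound[of ?I q h m, OF push] q by (intro mult_right_mono) auto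
      also have "measure (p.future m h) {g. ?I g} \<le> measure (p.future m h) {g. score g \<le> 0}"
        using m h(1) p.set_future(1)[of _ m h]
        by (intro measure_pmf.finite_measure_mono_AE) (auto simp: AE_measure_pmf_iff algebra_simps)
      also have "measure (p.future m h) {g. score g \<le> 0} * p.prob {\<omega>. prefix \<omega> (length h) = h}
          = p.prob {\<omega>. prefix \<omega> (length h) = h \<and> score (prefix \<omega> (length h + m)) \<le> 0}"
        using p.prob_prefix_cond[of h "length h" "\<lambda>g. score g \<le> 0" m] by simp
      also have "\<dots> \<le> p.prob ({\<omega>. prefix \<omega> (length h) = h} \<inter> {\<omega>. \<exists>s\<ge>t. score (prefix \<omega> s) \<le> 0})"
        using h(2) p.prefix_sets[of "\<lambda>g. g = h" "length h"] Cs
        by (intro p.finite_measure_mono sets.Int) (auto intro!: exI[of _ "length h + m"])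
      also have "{\<omega>. prefix \<omega> (length h) = h} \<inter> {\<omega>. \<exists>s\<ge>t. score (prefix \<omega> s) \<le> 0}
          = {\<omega>. prefix \<omega> (length h) = h \<and> \<omega> \<in> {\<omega>. \<exists>s\<ge>t. score (prefix \<omega> s) \<le> 0}}" by auto
      finally show "q ^ m * p.prob {\<omega>. prefix \<omega> (length h) = h}
          \<le> p.prob {\<omega>. prefix \<omega> (length h) = h \<and> \<omega> \<in> {\<omega>. \<exists>s\<ge>t. score (prefix \<omega> s) \<le> 0}}"
        by (simp add: mult_right_mono)
    qed (use Cs q in auto)
  qed
  then have "AE \<omega> in law F0 \<sigma>. \<forall>K t. (\<forall>m. \<exists>n\<ge>m. prefix \<omega> n \<in> {h. score h \<le> real K}) \<longrightarrow>
      \<omega> \<in> {\<omega>. \<exists>s\<ge>t. score (prefix \<omega> s) \<le> 0}"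
    unfolding AE_all_countable by blast
  then show ?thesis
  proof eventually_elim
    case (elim \<omega>)
    show ?case
    proof (intro impI allI)
      fix K :: real
      assume "\<omega> \<in> conviction_event v \<pi>0"
      then obtain t where t: "\<And>s. s \<ge> t \<Longrightarrow> score (prefix \<omega> s) > 0" by (auto simp: conviction_event_eq)
      obtain K' :: nat where K': "K \<le> real K'" using real_arch_simple by blast
      have "\<not> (\<exists>s\<ge>t. score (prefix \<omega> s) \<le> 0)" using t by force
      then have "\<not> (\<forall>m. \<exists>n\<ge>m. score (prefix \<omega> n) \<le> real K')" using elim by blast
      then obtain m where "\<And>n. n \<ge> m \<Longrightarrow> score (prefix \<omega> n) > real K'" by force
      then show "\<exists>t. \<forall>s\<ge>t. score (prefix \<omega> s) > K" using K' by (meson le_less_trans)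
    qed
  qed
qed

end

lemma (in play) prob_eventually_le:
  assumes "\<epsilon> > 0"
  shows "\<exists>n0. \<forall>n\<ge>n0. prob {\<omega>. \<exists>t. \<forall>s\<ge>t. Q (prefix \<omega> s)} - \<epsilon> \<le> measure (future n []) {h. Q h}"
proof -
  let ?B = "\<lambda>t. {\<omega>. \<forall>s\<ge>t. Q (prefix \<omega> s)}"
  have "(\<lambda>t. prob (?B t)) \<longlonglongrightarrow> prob (\<Union>t. ?B t)"
    using always_sets[of _ Q] by (intro finite_Lim_measure_incseq) (auto simp: incseq_def)
  moreover have "(\<Union>t. ?B t) = {\<omega>. \<exists>t. \<forall>s\<ge>t. Q (prefix \<omega> s)}" by auto
  ultimately have "(\<lambda>t. prob (?B t)) \<longlonglongrightarrow> prob {\<omega>. \<exists>t. \<forall>s\<ge>t. Q (prefix \<omega> s)}" by simp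
  then have "\<forall>\<^sub>F t in sequentially. prob {\<omega>. \<exists>t. \<forall>s\<ge>t. Q (prefix \<omega> s)} - \<epsilon> < prob (?B t)"
    using assms by (intro order_tendstoD(1)) auto
  then obtain n0 where n0: "\<And>t. t \<ge> n0 \<Longrightarrow> prob {\<omega>. \<exists>t. \<forall>s\<ge>t. Q (prefix \<omega> s)} - \<epsilon> < prob (?B t)"
    by (auto simp: eventually_sequentially)
  show ?thesis
  proof (intro exI[of _ n0] allI impI)
    fix n assume "n \<ge> n0"
    then have "prob {\<omega>. \<exists>t. \<forall>s\<ge>t. Q (prefix \<omega> s)} - \<epsilon> \<le> prob (?B n)" using n0[of n] by simp
    also have "\<dots> \<le> prob {\<omega>. Q (prefix \<omega> n)}"
      by (rule finite_measure_mono[OF _ prefix_sets]) auto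
    also have "\<dots> = measure (future n []) {h. Q h}" by (rule prob_prefix)
    finally show "prob {\<omega>. \<exists>t. \<forall>s\<ge>t. Q (prefix \<omega> s)} - \<epsilon> \<le> measure (future n []) {h. Q h}" .
  qed
qed

context game
begin

section \<open>The upper bound\<close>

text \<open>
  If no cycle has positive drift, the compensator is bounded above. A martingale with bounded
  increments does not diverge to infinity, so the score cannot either.
\<close>

lemma F0_infeasible_no_conviction:
  assumes "lambda_feasible F0 F1 = {}"
  shows "AE \<omega> in law F0 \<sigma>. \<omega> \<notin> conviction_event v \<pi>0"
proof -
  interpret p: play k init F0 \<sigma> "agent_opt v \<pi>0" .
  have "0 \<notin> lambda_feasible F0 F1" using assms by blast
  then have D: "e True False + e False True \<le> 0" by (simp add: lambda_feasible_def)
  define C where "C = \<bar>e True False\<bar> * real k"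
  have C: "drift h \<le> C" for h
  proof -
    \<comment> \<open>The price \<open>e True False\<close> makes the transition
      \<open>1 \<rightarrow> 0\<close> tight; \<open>D\<close> then covers
      \<open>0 \<rightarrow> 1\<close>.\<close>
    have "1 * e a b \<le> 0 + e True False * (of_bool a - of_bool b)" for a b
      using D llr_mean_neg[of True] llr_mean_neg[of False] by (cases a; cases b) auto
    then show ?thesis using linear_bound[of 0 1 0 "e True False" h] by (simp add: C_def)
  qed
  have null: "AE \<omega> in law F0 \<sigma>. \<not> (\<forall>K::nat. \<exists>r. \<forall>s\<ge>r. real K + 1 < score (prefix \<omega> s) \<and>
      (\<forall>i. t \<le> i \<and> i \<le> length (prefix \<omega> s) \<longrightarrow> score (take i (prefix \<omega> s)) > 0))" for t
  proof -
    define stay where "stay g \<longleftrightarrow> (\<forall>i. t \<le> i \<and> i \<le> length g \<longrightarrow> score (take i g) > 0)" for g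
    \<comment> \<open>The martingale, killed at the first nonpositive score from time
      \<open>t\<close> on. While it lives, \<open>mart + C\<close> is at least the score and hence
      positive; \<open>bound\<close> absorbs the jump of the killing period, so that killing only
      lowers the value.\<close>
    define \<phi> where "\<phi> g = (if stay g then mart g + C + bound else 0)" for g
    have \<phi>_ge: "real K + 1 \<le> \<phi> g" if "stay g" "real K + 1 < score g" for g K
      using that C[of g] bound_pos by (simp add: \<phi>_def mart_def)
    have \<phi>_nonneg: "0 \<le> \<phi> g" if "t \<le> length g" for g
    proof (cases "stay g")
      case True
      then have "score g > 0" using that by (auto simp: stay_def dest: spec[of _ "length g"])
      then show ?thesis using True C[of g] bound_pos by (simp add: \<phi>_def mart_def)
    qed (simp add: \<phi>_def)
    have super: "measure_pmf.expectation (p.step g) (\<lambda>x. \<phi> (g @ [x])) \<le> 1 * \<phi> g" if g: "t \<le> length g" for g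
    proof (cases "stay g")
      case True
      then have pos: "score g > 0" using g by (auto simp: stay_def dest: spec[of _ "length g"])
      have "measure_pmf.expectation (p.step g) (\<lambda>x. \<phi> (g @ [x]))
          \<le> measure_pmf.expectation (p.step g) (\<lambda>x. mart (g @ [x]) + (C + bound))"
      proof (rule integral_mono_pmf_finite)
        fix x
        have "mart (g @ [x]) + C + bound \<ge> 0"
          using pos C[of "g @ [x]"] llr_bound[of "action x" "outcome x"] unfolding mart_def score_snoc
          by (simp add: abs_le_iff)
        then show "\<phi> (g @ [x]) \<le> mart (g @ [x]) + (C + bound)" by (simp add: \<phi>_def)
      qed simp
      also have "\<dots> = measure_pmf.expectation (p.step g) (\<lambda>x. mart (g @ [x])) + (C + bound)"
        by (subst Bochner_Integration.integral_add) (auto intro: integrable_measure_pmf_finite)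
      also have "\<dots> \<le> mart g + (C + bound)" using mart_expectation by simp
      finally show ?thesis using True by (simp add: \<phi>_def)
    next
      case False
      then obtain i where "t \<le> i" "i \<le> length g" "\<not> score (take i g) > 0" by (auto simp: stay_def)
      then have "\<not> stay (g @ [x])" for x
        by (auto simp: stay_def intro!: exI[of _ i])
      then show ?thesis using False by (simp add: \<phi>_def)
    qed
    define c where "c = measure_pmf.expectation (p.future t []) \<phi>"
    have c: "measure_pmf.expectation (p.future (t + j) []) \<phi> \<le> c" for j
    proof -
      have "measure_pmf.expectation (p.future (t + j) []) \<phi>
          = measure_pmf.expectation (p.future t []) (\<lambda>h. measure_pmf.expectation (p.future j h) \<phi>)"
        unfolding p.future_add by (rule expectation_bind_pmf_finite) auto
      also have "\<dots> \<le> c" unfolding c_def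
      proof (rule integral_mono_pmf_finite)
        fix h assume "h \<in> set_pmf (p.future t [])"
        then have "t \<le> length h" using p.set_future by fastforce
        then show "measure_pmf.expectation (p.future j h) \<phi> \<le> \<phi> h"
          using p.future_expectation_le[where I="\<lambda>g. t \<le> length g" and c=1 and \<phi>=\<phi>] super by simp
      qed simp
      finally show ?thesis .
    qed
    have tail: "measure (p.future n []) {h. real K + 1 < score h \<and> stay h} \<le> c / (real K + 1)" if n: "n \<ge> t" for n K
    proof -
      \<comment> \<open>Markov's inequality for \<open>\<phi>\<close>; letting \<open>K\<close> grow
        rules out divergence to infinity.\<close>
      have "(real K + 1) * measure (p.future n []) {h. real K + 1 < score h \<and> stay h}
          = measure_pmf.expectation (p.future n []) (\<lambda>h. (real K + 1) * indicator {h. real K + 1 < score h \<and> stay h} h)"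
        by simp
      also have "\<dots> \<le> measure_pmf.expectation (p.future n []) \<phi>"
      proof (rule integral_mono_pmf_finite)
        fix h assume "h \<in> set_pmf (p.future n [])"
        then have "t \<le> length h" using p.set_future n by fastforce
        then show "(real K + 1) * indicator {h. real K + 1 < score h \<and> stay h} h \<le> \<phi> h"
          using \<phi>_ge[of h K] \<phi>_nonneg[of h] by (simp add: indicator_def)
      qed simp
      also have "\<dots> \<le> c" using c[of "n - t"] n by simp
      finally show ?thesis by (simp add: field_simps)
    qed
    let ?U = "\<lambda>K. {\<omega>. \<exists>r. \<forall>s\<ge>r. real K + 1 < score (prefix \<omega> s) \<and> stay (prefix \<omega> s)}"
    have U: "?U K \<in> sets (law F0 \<sigma>)" for K
      by (rule p.eventually_sets)
    have U_le: "p.prob (?U K) \<le> c / (real K + 1)" for K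
    proof (rule field_le_epsilon)
      fix \<epsilon> :: real assume "\<epsilon> > 0"
      then obtain n0 where "\<And>n. n \<ge> n0 \<Longrightarrow> p.prob (?U K) - \<epsilon> \<le> measure (p.future n []) {h. real K + 1 < score h \<and> stay h}"
        using p.prob_eventually_le[of \<epsilon> "\<lambda>h. real K + 1 < score h \<and> stay h"] by blast
      from this[of "max n0 t"] tail[of "max n0 t" K] show "p.prob (?U K) \<le> c / (real K + 1) + \<epsilon>" by simp
    qed
    have I: "(\<Inter>K. ?U K) \<in> sets (law F0 \<sigma>)" using U by (intro sets.countable_INT') auto
    have "p.prob (\<Inter>K. ?U K) \<le> c / (real K + 1)" for K
    proof -
      have "p.prob (\<Inter>K. ?U K) \<le> p.prob (?U K)" using U by (intro p.finite_measure_mono) auto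
      then show ?thesis using U_le[of K] by simp
    qed
    moreover have "(\<lambda>K. c / (real K + 1)) \<longlonglongrightarrow> 0" by real_asymp
    ultimately have "p.prob (\<Inter>K. ?U K) \<le> 0"
      by (intro LIMSEQ_le_const[where X="\<lambda>K. c / (real K + 1)"]) auto
    then have "p.prob (\<Inter>K. ?U K) = 0" by (simp add: measure_le_0_iff)
    then have "AE \<omega> in law F0 \<sigma>. \<omega> \<notin> (\<Inter>K. ?U K)" using p.prob_eq_0[OF I] by simp
    then show ?thesis by (simp add: stay_def)
  qed
  then have "AE \<omega> in law F0 \<sigma>. \<forall>t. \<not> (\<forall>K::nat. \<exists>r. \<forall>s\<ge>r. real K + 1 < score (prefix \<omega> s) \<and>
      (\<forall>i. t \<le> i \<and> i \<le> length (prefix \<omega> s) \<longrightarrow> score (take i (prefix \<omega> s)) > 0))"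
    unfolding AE_all_countable by blast
  then show ?thesis
    using F0_conviction_diverges[of \<sigma>]
  proof eventually_elim
    case (elim \<omega>)
    show ?case
    proof
      assume conv: "\<omega> \<in> conviction_event v \<pi>0"
      then obtain t where t: "\<And>s. s \<ge> t \<Longrightarrow> score (prefix \<omega> s) > 0" by (auto simp: conviction_event_eq)
      have stay: "\<forall>i. t \<le> i \<and> i \<le> length (prefix \<omega> s) \<longrightarrow> score (take i (prefix \<omega> s)) > 0" for s
        using t by (simp add: min_def)
      have "\<forall>K::nat. \<exists>r. \<forall>s\<ge>r. real K + 1 < score (prefix \<omega> s)"
        using elim(2) conv by blast
      then show False using elim(1) stay by blast
    qed
  qed
qed

lemma lambda_feasible_image_bdd: "bdd_above ((\<lambda>x. (x + 1) / (x + 2)) ` lambda_feasible F0 F1)"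
  by (rule bdd_aboveI[of _ 1]) (auto simp: lambda_feasible_def)

lemma lambda_star_ge: "x \<in> lambda_feasible F0 F1 \<Longrightarrow> (x + 1) / (x + 2) \<le> lambda_star F0 F1"
  unfolding lambda_star_def using lambda_feasible_image_bdd by (auto intro: cSUP_upper)

lemma lambda_star_bounds: "0 \<le> lambda_star F0 F1" "lambda_star F0 F1 \<le> 1"
proof -
  show "lambda_star F0 F1 \<le> 1"
    by (auto simp: lambda_star_def lambda_feasible_def intro!: cSUP_least)
  show "0 \<le> lambda_star F0 F1"
  proof (cases "lambda_feasible F0 F1 = {}")
    case False
    then obtain x where x: "x \<in> lambda_feasible F0 F1" by blast
    then have "0 \<le> (x + 1) / (x + 2)" by (simp add: lambda_feasible_def)
    then show ?thesis using lambda_star_ge[OF x] by linarith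
  qed (simp add: lambda_star_def)
qed

text \<open>
  Linear programming duality for the frequencies of the four transitions: \<open>\<kappa>\<close> prices the drift and
  \<open>\<mu>\<close> the balance between the transitions \<open>0 \<rightarrow> 1\<close> and \<open>1 \<rightarrow> 0\<close>.
\<close>

lemma dual_certificate:
  assumes "lambda_feasible F0 F1 \<noteq> {}"
  shows "\<exists>\<kappa>\<ge>0. \<exists>\<mu>. \<forall>a b. 1 * of_bool b + \<kappa> * e a b \<le> lambda_star F0 F1 + \<mu> * (of_bool a - of_bool b)"
proof -
  define K where "K = - e True True"
  define D where "D = e True False + e False True"
  have K: "K > 0" using llr_mean_neg[of True] by (simp add: K_def)
  have feas: "x \<in> lambda_feasible F0 F1 \<longleftrightarrow> 0 \<le> x \<and> x < D / K" for x
    using K by (auto simp: lambda_feasible_def K_def D_def field_simps)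
  have DK: "D / K > 0" using assms feas by force
  let ?\<Lambda> = "lambda_star F0 F1"
  \<comment> \<open>The price that makes \<open>1 \<rightarrow> 1\<close> tight. The later choice of
    \<open>\<mu>\<close> makes \<open>1 \<rightarrow> 0\<close> tight, and
    \<open>0 \<rightarrow> 1\<close> becomes exactly
    \<open>\<kappa> * D \<le> 2 * ?\<Lambda> - 1\<close>.\<close>
  define \<kappa> where "\<kappa> = (1 - ?\<Lambda>) / K"
  have \<kappa>: "\<kappa> \<ge> 0" using lambda_star_bounds K by (simp add: \<kappa>_def)
  have "(1 - ?\<Lambda>) * (D / K) \<le> 2 * ?\<Lambda> - 1"
  proof (cases "?\<Lambda> = 1")
    case False
    then have L: "1 - ?\<Lambda> > 0" using lambda_star_bounds by linarith
    have "D / K \<le> (2 * ?\<Lambda> - 1) / (1 - ?\<Lambda>)"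
    \<comment> \<open>Only values below \<open>D / K\<close> are feasible, so the bound at
      \<open>D / K\<close> comes from all smaller ones.\<close>
    proof (rule dense_le_bounded[OF DK])
      fix x assume "0 < x" "x < D / K"
      then have "(x + 1) / (x + 2) \<le> ?\<Lambda>" using lambda_star_ge[of x] feas[of x] by simp
      then show "x \<le> (2 * ?\<Lambda> - 1) / (1 - ?\<Lambda>)" using L \<open>0 < x\<close> by (simp add: field_simps)
    qed
    then show ?thesis using L by (simp add: field_simps)
  qed simp
  then have D: "\<kappa> * D \<le> 2 * ?\<Lambda> - 1" by (simp add: \<kappa>_def)
  have "1 * of_bool b + \<kappa> * e a b \<le> ?\<Lambda> + (\<kappa> * e True False - ?\<Lambda>) * (of_bool a - of_bool b)" for a b
  proof -
    have "\<kappa> * e True True = ?\<Lambda> - 1" using K by (simp add: \<kappa>_def K_def field_simps)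
    moreover have "\<kappa> * e False False \<le> 0" using \<kappa> llr_mean_neg[of False] by (simp add: mult_nonneg_nonpos)
    moreover have "\<kappa> * e True False + \<kappa> * e False True \<le> 2 * ?\<Lambda> - 1" using D by (simp add: D_def ring_distribs)
    ultimately show ?thesis using lambda_star_bounds by (cases a; cases b) auto
  qed
  then show ?thesis using \<kappa> by blast
qed

lemma count_take_le:
  assumes "\<And>i. T \<le> i \<Longrightarrow> i < n \<Longrightarrow> \<not> action (\<omega> i)"
  shows "count (prefix \<omega> n) \<le> real T"
proof -
  have "count (prefix \<omega> n) = (\<Sum>i<n. of_bool (action (\<omega> i)))" by (simp add: count_def)
  also have "\<dots> \<le> (\<Sum>i\<in>{..<T}. 1)"
  proof -
    have "(\<Sum>i<n. of_bool (action (\<omega> i)) :: real) = (\<Sum>i\<in>{..<n} \<inter> {..<T}. of_bool (action (\<omega> i)))"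
      using assms by (intro sum.mono_neutral_right) (auto simp: not_less[symmetric])
    also have "\<dots> \<le> (\<Sum>i\<in>{..<n} \<inter> {..<T}. 1)" by (intro sum_mono) auto
    also have "\<dots> \<le> (\<Sum>i\<in>{..<T}. 1)" by (intro sum_mono2) auto
    finally show ?thesis .
  qed
  finally show ?thesis by simp
qed

text \<open>On the conviction event the certificate applies once the score is positive and the
  martingale is not linearly large. The exceptions are a remainder that vanishes almost surely and a
  martingale tail that is exponentially small.\<close>

lemma F0_upper:
  assumes \<epsilon>: "\<epsilon> > 0"
  shows "\<forall>\<^sub>F n in sequentially. measure_pmf.expectation (future F0 \<sigma> n []) (\<lambda>h. count h / real n)
    \<le> lambda_star F0 F1 * measure (law F0 \<sigma>) (conviction_event v \<pi>0) + \<epsilon>"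
proof -
  interpret p: play k init F0 \<sigma> "agent_opt v \<pi>0" .
  let ?E = "conviction_event v \<pi>0"
  have E [measurable]: "?E \<in> sets (law F0 \<sigma>)" by (rule conviction_event_sets)
  have [measurable]: "(\<lambda>\<omega>. f (prefix \<omega> n)) \<in> borel_measurable (law F0 \<sigma>)" for f :: "'y history \<Rightarrow> real" and n
    by (rule measurable_compose[OF p.measurable_prefix_law]) simp
  \<comment> \<open>The remainder: on the conviction event it marks the dates before conviction is
    final, off the event it is the whole frequency, which tends to 0 because action 1 is eventually
    refused.\<close>
  define r where "r n \<omega> = (if \<omega> \<in> ?E then of_bool (score (prefix \<omega> n) \<le> 0) else count (prefix \<omega> n) / real n)" for n \<omega>
  have r_meas [measurable]: "r n \<in> borel_measurable (law F0 \<sigma>)" for n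
    unfolding r_def by measurable
  have freq: "0 \<le> count (prefix \<omega> n) / real n" "count (prefix \<omega> n) / real n \<le> 1" for \<omega> :: "nat \<Rightarrow> 'y period" and n
    using count_nonneg[of "prefix \<omega> n"] count_le[of "prefix \<omega> n"] by (auto simp: divide_le_eq_1)
  have r01: "0 \<le> r n \<omega>" "r n \<omega> \<le> 1" for n \<omega>
    using freq[of \<omega> n] by (auto simp: r_def)
  have "AE \<omega> in law F0 \<sigma>. \<forall>n. \<omega> n \<in> set_pmf (p.step (prefix \<omega> n))"
    using p.AE_step by (simp add: AE_all_countable)
  then have "AE \<omega> in law F0 \<sigma>. (\<lambda>n. r n \<omega>) \<longlonglongrightarrow> 0"
    using F0_not_convinced[of \<sigma>]
  proof eventually_elim
    case (elim \<omega>)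
    show ?case
    proof (cases "\<omega> \<in> ?E")
      case True
      then obtain t where t: "\<And>s. s \<ge> t \<Longrightarrow> score (prefix \<omega> s) > 0" by (auto simp: conviction_event_eq)
      have "\<forall>\<^sub>F n in sequentially. r n \<omega> = 0"
        unfolding eventually_sequentially
        by (rule exI[of _ t]) (use t True in \<open>auto simp: r_def not_le\<close>)
      then show ?thesis by (rule tendsto_eventually)
    next
      case False
      then obtain t where t: "\<And>s. s \<ge> t \<Longrightarrow> score (prefix \<omega> s) < 0" using elim(2) by blast
      have "\<not> action (\<omega> s)" if "s \<ge> t" for s
        using elim(1) no_accept[of "\<omega> s" F0 \<sigma> "prefix \<omega> s"] t[OF that] by auto
      then have "r n \<omega> \<le> real t / real n" for n
        using count_take_le[of t n \<omega>] False by (auto simp: r_def divide_right_mono)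
      moreover have "(\<lambda>n. real t / real n) \<longlonglongrightarrow> 0" by real_asymp
      ultimately show ?thesis
        using r01 by (intro tendsto_sandwich[of "\<lambda>_. 0" "\<lambda>n. r n \<omega>" _ "\<lambda>n. real t / real n"]) auto
    qed
  qed
  then have "(\<lambda>n. \<integral>\<omega>. r n \<omega> \<partial>law F0 \<sigma>) \<longlonglongrightarrow> (\<integral>\<omega>. 0 \<partial>law F0 \<sigma>)"
    using r01 by (intro integral_dominated_convergence[where w="\<lambda>_. 1"]) auto
  then have r_lim: "(\<lambda>n. \<integral>\<omega>. r n \<omega> \<partial>law F0 \<sigma>) \<longlonglongrightarrow> 0" by simp
  have r_int: "integrable (law F0 \<sigma>) (r n)" for n
    by (rule p.integrable_const_bound[where B=1]) (use r01 in auto)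
  have f_int: "integrable (law F0 \<sigma>) (\<lambda>\<omega>. count (prefix \<omega> n) / real n)" for n
    by (rule p.integrable_const_bound[where B=1]) (use freq in \<open>auto simp: count_nonneg\<close>)
  have f_exp: "measure_pmf.expectation (p.future n []) (\<lambda>h. count h / real n) = (\<integral>\<omega>. count (prefix \<omega> n) / real n \<partial>law F0 \<sigma>)" for n
    by (rule p.integral_prefix[symmetric])
  show ?thesis
  proof (cases "lambda_feasible F0 F1 = {}")
    case True
    have "measure_pmf.expectation (p.future n []) (\<lambda>h. count h / real n) \<le> (\<integral>\<omega>. r n \<omega> \<partial>law F0 \<sigma>)" for n
      unfolding f_exp
    proof (rule integral_mono_AE[OF f_int r_int])
      show "AE \<omega> in law F0 \<sigma>. count (prefix \<omega> n) / real n \<le> r n \<omega>"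
        using F0_infeasible_no_conviction[OF True, of \<sigma>] by eventually_elim (simp add: r_def)
    qed
    moreover have "\<forall>\<^sub>F n in sequentially. (\<integral>\<omega>. r n \<omega> \<partial>law F0 \<sigma>) < \<epsilon>"
      using order_tendstoD(2)[OF r_lim \<epsilon>] .
    ultimately show ?thesis
      using lambda_star_bounds(1) by (elim eventually_mono) (smt (verit) measure_nonneg mult_nonneg_nonneg)
  next
    case False
    obtain \<kappa> \<mu> where \<kappa>: "\<kappa> \<ge> 0" and cert: "\<And>a b. 1 * of_bool b + \<kappa> * e a b \<le> lambda_star F0 F1 + \<mu> * (of_bool a - of_bool b)"
      using dual_certificate[OF False] by blast
    let ?\<Lambda> = "lambda_star F0 F1"
    \<comment> \<open>Ensures \<open>\<kappa> * \<eta> < \<epsilon> / 2\<close>; the summand 1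
      allows \<open>\<kappa> = 0\<close>.\<close>
    define \<eta> where "\<eta> = \<epsilon> / (2 * (\<kappa> + 1))"
    have \<eta>: "\<eta> > 0" using \<epsilon> \<kappa> by (simp add: \<eta>_def)
    define C where "C = \<bar>\<mu>\<bar> * real k + \<kappa> * \<bar>score []\<bar>"
    have C: "C \<ge> 0" using \<kappa> by (simp add: C_def)
    let ?M = "\<lambda>n. {\<omega>. score [] + \<eta> * real n \<le> mart (prefix \<omega> n)}"
    have M [measurable]: "?M n \<in> sets (law F0 \<sigma>)" for n by (rule p.prefix_sets)
    have main: "count (prefix \<omega> n) / real n \<le> indicator ?E \<omega> * (?\<Lambda> + \<kappa> * \<eta> + C / real n) + r n \<omega> + indicator (?M n) \<omega>"
      if n: "n > 0" for n \<omega>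
    proof -
      have nonneg: "0 \<le> ?\<Lambda> + \<kappa> * \<eta> + C / real n"
        using lambda_star_bounds \<kappa> \<eta> C by simp
      consider "\<omega> \<notin> ?E" | "\<omega> \<in> ?M n" | "score (prefix \<omega> n) \<le> 0" "\<omega> \<in> ?E"
        | "\<omega> \<in> ?E" "score (prefix \<omega> n) > 0" "\<omega> \<notin> ?M n" by force
      then show ?thesis
      proof cases
        case 4
        have "count (prefix \<omega> n) \<le> ?\<Lambda> * real n + \<bar>\<mu>\<bar> * real k + \<kappa> * (mart (prefix \<omega> n) - score (prefix \<omega> n))"
          using linear_bound[of 1 \<kappa> ?\<Lambda> \<mu> "prefix \<omega> n", OF cert] by (simp add: mart_def)
        also have "\<kappa> * (mart (prefix \<omega> n) - score (prefix \<omega> n)) \<le> \<kappa> * (\<bar>score []\<bar> + \<eta> * real n)"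
          using 4 \<kappa> by (intro mult_left_mono) auto
        finally have "count (prefix \<omega> n) \<le> ?\<Lambda> * real n + \<kappa> * \<eta> * real n + C"
          by (simp add: C_def algebra_simps)
        also have "\<dots> = (?\<Lambda> + \<kappa> * \<eta> + C / real n) * real n"
          using n by (simp add: ring_distribs)
        finally have "count (prefix \<omega> n) \<le> (?\<Lambda> + \<kappa> * \<eta> + C / real n) * real n" .
        then have "count (prefix \<omega> n) / real n \<le> ?\<Lambda> + \<kappa> * \<eta> + C / real n"
          using n by (simp add: divide_le_eq)
        then show ?thesis using 4 r01[of n \<omega>] by simp
      qed (use freq[of \<omega> n] r01[of n \<omega>] nonneg in \<open>auto simp: r_def indicator_def\<close>)
    qed
    have le: "measure_pmf.expectation (p.future n []) (\<lambda>h. count h / real n)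
        \<le> p.prob ?E * (?\<Lambda> + \<kappa> * \<eta> + C / real n) + (\<integral>\<omega>. r n \<omega> \<partial>law F0 \<sigma>) + exp (- (\<eta>\<^sup>2 / (2 * bound\<^sup>2))) ^ n" if n: "n > 0" for n
    proof -
      have i1: "integrable (law F0 \<sigma>) (\<lambda>\<omega>. indicator ?E \<omega> * (?\<Lambda> + \<kappa> * \<eta> + C / real n))"
        by (intro integrable_mult_left integrable_real_indicator) (auto simp: p.emeasure_finite less_top[symmetric])
      have i2: "integrable (law F0 \<sigma>) (indicat_real (?M n))"
        by (intro integrable_real_indicator) (auto simp: p.emeasure_finite less_top[symmetric])
      have "measure_pmf.expectation (p.future n []) (\<lambda>h. count h / real n)
          \<le> (\<integral>\<omega>. indicator ?E \<omega> * (?\<Lambda> + \<kappa> * \<eta> + C / real n) + r n \<omega> + indicator (?M n) \<omega> \<partial>law F0 \<sigma>)"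
        unfolding f_exp
        by (rule integral_mono[OF f_int]) (use main[OF n] in \<open>auto intro!: Bochner_Integration.integrable_add i1 i2 r_int\<close>)
      also have "\<dots> = (\<integral>\<omega>. indicator ?E \<omega> * (?\<Lambda> + \<kappa> * \<eta> + C / real n) \<partial>law F0 \<sigma>)
          + (\<integral>\<omega>. r n \<omega> \<partial>law F0 \<sigma>) + (\<integral>\<omega>. indicator (?M n) \<omega> \<partial>law F0 \<sigma>)"
        using i1 i2 r_int by (simp add: Bochner_Integration.integral_add Bochner_Integration.integrable_add)
      also have "\<dots> = p.prob ?E * (?\<Lambda> + \<kappa> * \<eta> + C / real n) + (\<integral>\<omega>. r n \<omega> \<partial>law F0 \<sigma>) + p.prob (?M n)"
        by simp
      also have "p.prob (?M n) = measure (p.future n []) {h. score [] + \<eta> * real n \<le> mart h}"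
        by (rule p.prob_prefix)
      also have "\<dots> \<le> exp (- (\<eta>\<^sup>2 / (2 * bound\<^sup>2))) ^ n" by (rule mart_tail[OF \<eta>])
      finally show ?thesis by simp
    qed
    have "(\<lambda>n. C / real n) \<longlonglongrightarrow> 0" by real_asymp
    moreover have "(\<lambda>n. exp (- (\<eta>\<^sup>2 / (2 * bound\<^sup>2))) ^ n) \<longlonglongrightarrow> 0"
      using \<eta> bound_pos by (intro LIMSEQ_power_zero) (simp add: abs_exp_cancel)
    ultimately have "(\<lambda>n. p.prob ?E * (?\<Lambda> + \<kappa> * \<eta> + C / real n) + (\<integral>\<omega>. r n \<omega> \<partial>law F0 \<sigma>) + exp (- (\<eta>\<^sup>2 / (2 * bound\<^sup>2))) ^ n)
        \<longlonglongrightarrow> p.prob ?E * (?\<Lambda> + \<kappa> * \<eta> + 0) + 0 + 0"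
      using r_lim by (intro tendsto_add tendsto_mult tendsto_const)
    moreover have "p.prob ?E * (?\<Lambda> + \<kappa> * \<eta> + 0) + 0 + 0 < ?\<Lambda> * p.prob ?E + \<epsilon>"
    proof -
      have "p.prob ?E * (\<kappa> * \<eta>) \<le> 1 * (\<kappa> * \<eta>)" using \<kappa> \<eta> by (intro mult_right_mono) auto
      also have "\<kappa> * \<eta> < (\<kappa> + 1) * \<eta>" using \<eta> by (simp add: algebra_simps)
      also have "(\<kappa> + 1) * \<eta> = \<epsilon> / 2" using \<kappa> by (simp add: \<eta>_def field_simps)
      finally show ?thesis using \<epsilon> by (simp add: algebra_simps)
    qed
    ultimately have "\<forall>\<^sub>F n in sequentially. p.prob ?E * (?\<Lambda> + \<kappa> * \<eta> + C / real n) + (\<integral>\<omega>. r n \<omega> \<partial>law F0 \<sigma>)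
        + exp (- (\<eta>\<^sup>2 / (2 * bound\<^sup>2))) ^ n < ?\<Lambda> * p.prob ?E + \<epsilon>"
      by (rule order_tendstoD(2))
    then show ?thesis
      using eventually_gt_at_top[of 0]
    proof eventually_elim
      case (elim n)
      show ?case by (rule order_trans[OF le[OF elim(2)] less_imp_le[OF elim(1)]])
    qed
  qed
qed

end

section \<open>The lower bound\<close>

text \<open>The deviation from the linear trend is itself periodic, so it takes finitely many
  values.\<close>

lemma periodic_sum_bound:
  fixes c :: "nat \<Rightarrow> real"
  assumes per: "\<And>i. c (i + T) = c i" and T: "T > 0" and sum: "(\<Sum>i<T. c i) = \<mu> * real T"
  shows "\<exists>C\<ge>0. \<forall>n. \<bar>(\<Sum>i<n. c i) - \<mu> * real n\<bar> \<le> C"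
proof -
  define d where "d n = (\<Sum>i<n. c i) - \<mu> * real n" for n
  have "d (n + T) = d n" for n
  proof -
    have "(\<Sum>i<n + T. c i) = (\<Sum>i<T. c i) + (\<Sum>i<n. c (i + T))"
      by (induction n) (simp_all add: per)
    then show ?thesis by (simp add: d_def per sum ring_distribs)
  qed
  then have "d (m + j * T) = d m" for m j
    by (induction j) (simp_all, metis add.assoc add.commute)
  then have "d n = d (n mod T)" for n
    by (metis mod_div_mult_eq)
  moreover have "\<bar>d (n mod T)\<bar> \<le> (\<Sum>i<T. \<bar>d i\<bar>)" for n
    using T by (intro member_le_sum[of "n mod T" "{..<T}" "\<lambda>i. \<bar>d i\<bar>"]) auto
  ultimately have "\<bar>d n\<bar> \<le> (\<Sum>i<T. \<bar>d i\<bar>)" for n by metis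
  then show ?thesis unfolding d_def[symmetric] by (intro exI[of _ "\<Sum>i<T. \<bar>d i\<bar>"]) (auto intro: sum_nonneg)
qed

lemma sum_blocks:
  fixes g :: "nat \<Rightarrow> real"
  assumes "k > 0"
  shows "(\<Sum>i<n * k. g (i div k)) = real k * (\<Sum>j<n. g j)"
proof -
  have "(\<Sum>i<n * k. g (i div k)) = (\<Sum>j<n. \<Sum>i\<in>{j * k..<j * k + k}. g (i div k))"
    by (rule sum.nat_group[symmetric])
  also have "\<dots> = (\<Sum>j<n. \<Sum>i\<in>{j * k..<j * k + k}. g j)"
  proof (intro sum.cong refl)
    fix i j assume "i \<in> {j * k..<j * k + k}"
    then have "i div k = j" using assms by (intro div_nat_eqI) (auto simp: mult.commute)
    then show "g (i div k) = g j" by simp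
  qed
  also have "\<dots> = real k * (\<Sum>j<n. g j)" by (simp add: sum_distrib_left)
  finally show ?thesis .
qed

text \<open>
  The cyclic pattern \<open>(0 1)\<^sup>w 1\<^sup>u\<close>. Every entry is held for \<open>k\<close> periods, so that each period sees the
  previous entry as its lagged action.
\<close>

definition pattern :: "nat \<Rightarrow> nat \<Rightarrow> nat \<Rightarrow> bool" where
  "pattern u w j \<longleftrightarrow> (j mod (u + 2 * w) < 2 * w \<longrightarrow> odd (j mod (u + 2 * w)))"

lemma pattern_periodic: "pattern u w (j + (u + 2 * w)) = pattern u w j"
  by (simp add: pattern_def)

lemma sum_alternating:
  fixes p q :: real
  shows "(\<Sum>j<2 * w. if odd j then p else q) = real w * (p + q)"
  by (induction w) (auto simp: algebra_simps)

text \<open>The index \<open>j + (u + 2 * w) - 1\<close> is the cyclic predecessor of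
  \<open>j\<close>; adding a period avoids truncated subtraction at 0. The wrap-around always goes
  from 1 to 0, which balances the two kinds of switches.\<close>

lemma sum_pattern:
  fixes f :: "bool \<Rightarrow> bool \<Rightarrow> real"
  assumes w: "w > 0"
  shows "(\<Sum>j<u + 2 * w. f (pattern u w (j + (u + 2 * w) - 1)) (pattern u w j))
    = real u * f True True + real w * (f True False + f False True)"
proof -
  let ?Q = "u + 2 * w"
  have eq: "f (pattern u w (j + ?Q - 1)) (pattern u w j)
      = (if j < 2 * w then (if odd j then f False True else f True False) else f True True)" if j: "j < ?Q" for j
  proof -
    have cur: "pattern u w j \<longleftrightarrow> (j < 2 * w \<longrightarrow> odd j)" using j by (simp add: pattern_def)
    have prev: "pattern u w (j + ?Q - 1) \<longleftrightarrow> \<not> (j < 2 * w \<and> odd j)"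
    proof (cases "j = 0")
      case True
      then have "pattern u w (j + ?Q - 1) \<longleftrightarrow> (?Q - 1 < 2 * w \<longrightarrow> odd (?Q - 1))"
        using w by (simp add: pattern_def)
      moreover have "?Q - 1 < 2 * w \<Longrightarrow> odd (?Q - 1)" using w by (cases "u = 0") auto
      ultimately show ?thesis using True by simp
    next
      case False
      then have "j + ?Q - 1 = (j - 1) + ?Q" by simp
      then have "pattern u w (j + ?Q - 1) = pattern u w (j - 1)" using pattern_periodic by metis
      also have "\<dots> \<longleftrightarrow> (j - 1 < 2 * w \<longrightarrow> odd (j - 1))" using j by (simp add: pattern_def)
      also have "\<dots> \<longleftrightarrow> \<not> (j < 2 * w \<and> odd j)"
        using False by (cases "j = 2 * w") auto
      finally show ?thesis .
    qed
    show ?thesis using cur prev by auto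
  qed
  have "(\<Sum>j<?Q. f (pattern u w (j + ?Q - 1)) (pattern u w j))
      = (\<Sum>j<?Q. if j < 2 * w then (if odd j then f False True else f True False) else f True True)"
    by (intro sum.cong refl eq) auto
  also have "\<dots> = (\<Sum>j\<in>{..<2 * w} \<union> {2 * w..<?Q}. if j < 2 * w then (if odd j then f False True else f True False) else f True True)"
    by (intro sum.cong) auto
  also have "\<dots>
      = (\<Sum>j<2 * w. if odd j then f False True else f True False) + (\<Sum>j\<in>{2 * w..<?Q}. f True True)"
    by (subst sum.union_disjoint) auto
  also have "\<dots> = real u * f True True + real w * (f True False + f False True)"
    by (simp add: sum_alternating)
  finally show ?thesis .
qed

lemma play_future_cong:
  assumes "\<And>h. length h < N \<Longrightarrow> \<sigma> h = \<sigma>' h" "length h + n \<le> N"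
  shows "play.future k init F \<sigma> \<sigma>a n h = play.future k init F \<sigma>' \<sigma>a n h"
  using assms(2)
proof (induction n arbitrary: h)
  case (Suc n)
  then have "period_pmf k init F \<sigma> \<sigma>a h = period_pmf k init F \<sigma>' \<sigma>a h"
    using assms(1)[of h] by (simp add: period_pmf_def)
  then show ?case using Suc by (simp add: play.future.simps)
qed (simp add: play.future.simps)

section \<open>Frequency of action 1 in state \<open>F1\<close>\<close>

context game
begin

text \<open>On plays that pass the test \<open>Q\<close>, action 1 is eventually permanent and its
  frequency tends to 1; dominated convergence passes this to the mean.\<close>

lemma F1_lower:
  assumes \<sigma>: "\<And>h. N \<le> length h \<Longrightarrow> Q (take N h) \<Longrightarrow> \<sigma> h = 1" and \<epsilon>: "\<epsilon> > 0"
  shows "\<forall>\<^sub>F n in sequentially. measure (future F1 \<sigma> N []) {h. Q h} - \<epsilon>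
    \<le> measure_pmf.expectation (future F1 \<sigma> n []) (\<lambda>h. count h / real n)"
proof -
  interpret p: play k init F1 \<sigma> "agent_opt v \<pi>0" .
  let ?T = "{\<omega>. Q (prefix \<omega> N)}"
  have T [measurable]: "?T \<in> sets (law F1 \<sigma>)" by (rule p.prefix_sets)
  have [measurable]: "(\<lambda>\<omega>. f (prefix \<omega> n)) \<in> borel_measurable (law F1 \<sigma>)" for f :: "'y history \<Rightarrow> real" and n
    by (rule measurable_compose[OF p.measurable_prefix_law]) simp
  have freq: "0 \<le> count (prefix \<omega> n) / real n" "count (prefix \<omega> n) / real n \<le> 1" for \<omega> :: "nat \<Rightarrow> 'y period" and n
    using count_nonneg[of "prefix \<omega> n"] count_le[of "prefix \<omega> n"] by (auto simp: divide_le_eq_1)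
  let ?f = "\<lambda>n \<omega>. indicator ?T \<omega> * (count (prefix \<omega> n) / real n)"
  have f_abs: "\<bar>?f n \<omega>\<bar> \<le> 1" for n \<omega>
    using freq[of \<omega> n] by (auto simp: indicator_def)
  have ae: "AE \<omega> in law F1 \<sigma>. Q (prefix \<omega> N) \<longrightarrow> (\<exists>t. \<forall>s\<ge>t. action (\<omega> s))"
    by (rule F1_eventually_action1) (rule \<sigma>)
  have "AE \<omega> in law F1 \<sigma>. (\<lambda>n. ?f n \<omega>) \<longlonglongrightarrow> indicator ?T \<omega>"
    using ae
  proof eventually_elim
    case (elim \<omega>)
    show ?case
    proof (cases "\<omega> \<in> ?T")
      case True
      then obtain t where t: "\<And>s. s \<ge> t \<Longrightarrow> action (\<omega> s)" using elim by blast
      have low: "1 - real t / real n \<le> count (prefix \<omega> n) / real n" if "n > 0" for n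
      proof -
        have "real n - real t \<le> (\<Sum>i<n. of_bool (t \<le> i) :: real)"
          by (induction n) auto
        also have "\<dots> \<le> (\<Sum>i<n. of_bool (action (\<omega> i)))"
          using t by (intro sum_mono) auto
        also have "\<dots> = count (prefix \<omega> n)" by (simp add: count_def)
        finally have "(real n - real t) / real n \<le> count (prefix \<omega> n) / real n"
          by (intro divide_right_mono) auto
        then show ?thesis using that by (simp add: diff_divide_distrib)
      qed
      have "(\<lambda>n. count (prefix \<omega> n) / real n) \<longlonglongrightarrow> 1"
      proof (rule tendsto_sandwich)
        show "\<forall>\<^sub>F n in sequentially. 1 - real t / real n \<le> count (prefix \<omega> n) / real n"
          using eventually_gt_at_top[of 0] by eventually_elim (rule low)
        show "(\<lambda>n. 1 - real t / real n) \<longlonglongrightarrow> 1" by real_asymp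
      qed (use freq in auto)
      then show ?thesis using True by simp
    qed simp
  qed
  then have "(\<lambda>n. \<integral>\<omega>. ?f n \<omega> \<partial>law F1 \<sigma>) \<longlonglongrightarrow> (\<integral>\<omega>. indicator ?T \<omega> \<partial>law F1 \<sigma>)"
    using f_abs by (intro integral_dominated_convergence[where w="\<lambda>_. 1"]) auto
  moreover have "(\<integral>\<omega>. indicator ?T \<omega> \<partial>law F1 \<sigma>) = measure (p.future N []) {h. Q h}"
    by (simp add: p.prob_prefix[of Q])
  ultimately have "\<forall>\<^sub>F n in sequentially. measure (p.future N []) {h. Q h} - \<epsilon> < (\<integral>\<omega>. ?f n \<omega> \<partial>law F1 \<sigma>)"
    using \<epsilon> by (intro order_tendstoD(1)) auto
  then show ?thesis
  proof eventually_elim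
    case (elim n)
    have "(\<integral>\<omega>. ?f n \<omega> \<partial>law F1 \<sigma>) \<le> (\<integral>\<omega>. count (prefix \<omega> n) / real n \<partial>law F1 \<sigma>)"
    proof (rule integral_mono)
      show "integrable (law F1 \<sigma>) (?f n)"
        by (rule p.integrable_const_bound[where B=1]) (use f_abs in auto)
      show "integrable (law F1 \<sigma>) (\<lambda>\<omega>. count (prefix \<omega> n) / real n)"
        by (rule p.integrable_const_bound[where B=1]) (use freq in \<open>auto simp: count_nonneg\<close>)
      show "?f n \<omega> \<le> count (prefix \<omega> n) / real n" for \<omega>
        using freq[of \<omega> n] by (simp add: indicator_def)
    qed
    also have "\<dots> = measure_pmf.expectation (p.future n []) (\<lambda>h. count h / real n)"
      by (rule p.integral_prefix)
    finally show ?case using elim by simp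
  qed
qed

section \<open>Frequency, drift and persistence along the cyclic pattern\<close>

definition plays_pattern :: "nat \<Rightarrow> nat \<Rightarrow> nat \<Rightarrow> 'y history \<Rightarrow> bool" where
  "plays_pattern u w N g \<longleftrightarrow> (\<forall>i. N \<le> i \<and> i < length g \<longrightarrow> action (g ! i) = pattern u w ((i - N) div k))"

lemma sum_from:
  fixes f :: "nat \<Rightarrow> real"
  assumes "N \<le> n"
  shows "(\<Sum>i<n. f i) - (\<Sum>i<N. f i) = (\<Sum>j<n - N. f (N + j))"
proof -
  have "(\<Sum>i<N + m. f i) = (\<Sum>i<N. f i) + (\<Sum>j<m. f (N + j))" for m by (induction m) auto
  from this[of "n - N"] show ?thesis using assms by simp
qed

lemma pattern_count:
  assumes w: "w > 0"
  shows "\<exists>C\<ge>0. \<forall>N g. N \<le> length g \<longrightarrow> plays_pattern u w N g \<longrightarrow>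
    count g \<ge> (real u + real w) / (real u + 2 * real w) * (real (length g) - real N) - C"
proof -
  let ?Q = "u + 2 * w" and ?\<mu> = "(real u + real w) / (real u + 2 * real w)"
  let ?c = "\<lambda>i. of_bool (pattern u w (i div k)) :: real"
  have k: "k > 0" using lag by simp
  have "\<exists>C\<ge>0. \<forall>n. \<bar>(\<Sum>i<n. ?c i) - ?\<mu> * real n\<bar> \<le> C"
  proof (rule periodic_sum_bound[where T="?Q * k"])
    fix i
    have "(i + ?Q * k) div k = i div k + ?Q" using k by simp
    then show "?c (i + ?Q * k) = ?c i" by (simp only: pattern_periodic)
  next
    show "?Q * k > 0" using k w by simp
    have "(\<Sum>i<?Q * k. ?c i) = real k * (\<Sum>j<?Q. of_bool (pattern u w j))"
      using sum_blocks[OF k, of "\<lambda>j. of_bool (pattern u w j)"] by simp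
    also have "(\<Sum>j<?Q. of_bool (pattern u w j) :: real) = real u + real w"
      using sum_pattern[OF w, of "\<lambda>a b. of_bool b"] by simp
    also have "real k * (real u + real w) = ?\<mu> * real (?Q * k)"
      using w by (simp add: field_simps)
    finally show "(\<Sum>i<?Q * k. ?c i) = ?\<mu> * real (?Q * k)" .
  qed
  then obtain C where C: "C \<ge> 0" "\<And>n. \<bar>(\<Sum>i<n. ?c i) - ?\<mu> * real n\<bar> \<le> C" by blast
  have "count g \<ge> ?\<mu> * (real (length g) - real N) - C" if g: "N \<le> length g" "plays_pattern u w N g" for N g
  proof -
    have "(\<Sum>i<length g - N. ?c i) = (\<Sum>j<length g - N. of_bool (action (g ! (N + j))))"
      using g by (intro sum.cong refl) (auto simp: plays_pattern_def)
    also have "\<dots> = count g - (\<Sum>i<N. of_bool (action (g ! i)))"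
      using sum_from[OF g(1), of "\<lambda>i. of_bool (action (g ! i))"] by (simp add: count_def)
    also have "\<dots> \<le> count g" by (simp add: sum_nonneg)
    finally have "(\<Sum>i<length g - N. ?c i) \<le> count g" .
    then show ?thesis using C(2)[of "length g - N"] g(1) by (simp add: of_nat_diff abs_le_iff)
  qed
  then show ?thesis using C(1) by blast
qed

text \<open>For \<open>w > 0\<close> its positivity is the constraint defining \<lambda>, taken at
  the ratio of \<open>u\<close> to \<open>w\<close>.\<close>

definition pattern_drift_rate :: "nat \<Rightarrow> nat \<Rightarrow> real" where
  "pattern_drift_rate u w = (real u * e True True + real w * (e True False + e False True)) / (real u + 2 * real w)"

text \<open>The constant is uniform in \<open>N\<close>, as the start of the pattern is chosen only
  after a score threshold that depends on it. Only in the first \<open>k\<close> periods does the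
  lagged action predate the pattern, at a cost of at most \<open>2 * bound\<close> each.\<close>

lemma pattern_drift:
  assumes w: "w > 0"
  shows "\<exists>C\<ge>0. \<forall>N g. N \<le> length g \<longrightarrow> plays_pattern u w N g \<longrightarrow>
    drift g - drift (take N g) \<ge> pattern_drift_rate u w * (real (length g) - real N) - C"
proof -
  let ?Q = "u + 2 * w" and ?\<mu> = "pattern_drift_rate u w"
  let ?s = "\<lambda>j. e (pattern u w (j + ?Q - 1)) (pattern u w j)"
  have k: "k > 0" using lag by simp
  have "\<exists>C\<ge>0. \<forall>n. \<bar>(\<Sum>i<n. ?s (i div k)) - ?\<mu> * real n\<bar> \<le> C"
  proof (rule periodic_sum_bound[where T="?Q * k"])
    fix i
    have "(i + ?Q * k) div k = i div k + ?Q" using k by simp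
    moreover have "i div k + ?Q + ?Q - 1 = (i div k + ?Q - 1) + ?Q" using w by simp
    ultimately show "?s ((i + ?Q * k) div k) = ?s (i div k)"
      by (simp only: pattern_periodic)
  next
    show "?Q * k > 0" using k w by simp
    have "(\<Sum>i<?Q * k. ?s (i div k)) = real k * (\<Sum>j<?Q. ?s j)"
      using sum_blocks[OF k, of ?s] by simp
    also have "(\<Sum>j<?Q. ?s j) = real u * e True True + real w * (e True False + e False True)"
      by (rule sum_pattern[OF w])
    also have "real k * \<dots> = ?\<mu> * real (?Q * k)"
      using w by (simp add: pattern_drift_rate_def field_simps)
    finally show "(\<Sum>i<?Q * k. ?s (i div k)) = ?\<mu> * real (?Q * k)" .
  qed
  then obtain C where C: "C \<ge> 0" "\<And>n. \<bar>(\<Sum>i<n. ?s (i div k)) - ?\<mu> * real n\<bar> \<le> C" by blast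
  have "drift g - drift (take N g) \<ge> ?\<mu> * (real (length g) - real N) - (C + 2 * bound * real k)"
    if g: "N \<le> length g" "plays_pattern u w N g" for N g
  proof -
    let ?t = "\<lambda>i. e (lagged (take i g)) (action (g ! i))"
    have ab: "\<bar>e a b\<bar> \<le> bound" for a b using bound[of b undefined a] by linarith
    have step: "?s (j div k) - 2 * bound * of_bool (j < k) \<le> ?t (N + j)" if j: "j < length g - N" for j
    proof -
      have act: "action (g ! (N + j)) = pattern u w (j div k)"
        using g j by (auto simp: plays_pattern_def)
      show ?thesis
      proof (cases "j < k")
        case True
        then show ?thesis
          using ab[of "pattern u w (j div k + ?Q - 1)" "pattern u w (j div k)"]
            ab[of "lagged (take (N + j) g)" "action (g ! (N + j))"] by (simp add: abs_le_iff)
      next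
        case False
        have "lagged (take (N + j) g) = action (g ! (N + j - k))"
        proof -
          have len: "length (take (N + j) g) = N + j" using j by simp
          then have "take (N + j) g ! (N + j - k) = g ! (N + j - k)" using k False by simp
          then show ?thesis using play.lag_eq[OF lag, of "take (N + j) g" init] False unfolding len by simp
        qed
        also have "\<dots> = pattern u w ((N + j - k - N) div k)"
        proof -
          have "N \<le> N + j - k" "N + j - k < length g" using False j k by auto
          then show ?thesis using g(2) unfolding plays_pattern_def by blast
        qed
        \<comment> \<open>Every entry lasts \<open>k\<close> periods, so looking back
          \<open>k\<close> periods means looking back one entry.\<close>
        also have "(N + j - k - N) div k = j div k - 1"
          using False k by (simp add: le_div_geq[of k j])
        also have "pattern u w (j div k - 1) = pattern u w (j div k - 1 + ?Q)"
          by (rule pattern_periodic[symmetric])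
        also have "j div k - 1 + ?Q = j div k + ?Q - 1"
          using False k div_greater_zero_iff[of j k] by simp
        finally show ?thesis using act False by simp
      qed
    qed
    have "(\<Sum>j<n. of_bool (j < k) :: real) \<le> real k" for n
    proof -
      have "(\<Sum>j<n. of_bool (j < k) :: real) = real (card ({..<n} \<inter> {..<k}))"
        by (simp add: lessThan_def)
      also have "\<dots> \<le> real (card {..<k})" by (intro of_nat_mono card_mono) auto
      finally show ?thesis by simp
    qed
    then have "2 * bound * (\<Sum>j<length g - N. of_bool (j < k)) \<le> 2 * bound * real k"
      using bound_pos by (intro mult_left_mono) auto
    then have "(\<Sum>j<length g - N. ?s (j div k)) - 2 * bound * real k
        \<le> (\<Sum>j<length g - N. ?s (j div k) - 2 * bound * of_bool (j < k))"
      by (simp only: sum_subtractf sum_distrib_left[symmetric])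
    also have "\<dots> \<le> (\<Sum>j<length g - N. ?t (N + j))"
      by (intro sum_mono step) auto
    also have "\<dots> = drift g - drift (take N g)"
      using sum_from[OF g(1), of ?t] g(1) by (simp add: drift_def min_def)
    finally show ?thesis
      using C(2)[of "length g - N"] g(1) by (simp add: of_nat_diff abs_le_iff)
  qed
  then show ?thesis
    using C(1) bound_pos by (intro exI[of _ "C + 2 * bound * real k"]) auto
qed

text \<open>
  With \<open>\<theta> = 2 d / bound\<^sup>2\<close> the positive drift \<open>d\<close> of the pattern pays exactly for the
  exponential compensator of the martingale, so a high initial score stays positive.
\<close>

lemma pattern_keeps_conviction:
  assumes w: "w > 0" and d: "pattern_drift_rate u w > 0" and \<epsilon>: "\<epsilon> > 0"
  shows "\<exists>K\<ge>0. \<forall>N h \<sigma> j. length h = N \<longrightarrow> score h > K \<longrightarrow>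
    (\<forall>g. N \<le> length g \<longrightarrow> take N g = h \<longrightarrow> \<sigma> g = of_bool (pattern u w ((length g - N) div k))) \<longrightarrow>
    measure (future F0 \<sigma> j h) {g. plays_pattern u w N g} \<ge> 1 - \<epsilon>"
proof -
  let ?d = "pattern_drift_rate u w"
  obtain C where C: "C \<ge> 0" and drift: "\<And>N g. N \<le> length g \<Longrightarrow> plays_pattern u w N g \<Longrightarrow>
      drift g - drift (take N g) \<ge> ?d * (real (length g) - real N) - C"
    using pattern_drift[OF w, of u] by blast
  define \<theta> where "\<theta> = 2 * ?d / bound\<^sup>2"
  have \<theta>: "\<theta> > 0" using d bound_pos by (simp add: \<theta>_def)
  have \<theta>d: "\<theta>\<^sup>2 * bound\<^sup>2 / 2 = \<theta> * ?d" using bound_pos by (simp add: \<theta>_def power2_eq_square field_simps)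
  \<comment> \<open>Beyond the loss \<open>C\<close> in the drift, this margin makes
    \<open>exp (- \<theta> * (K - C))\<close> at most \<open>\<epsilon>\<close>.\<close>
  define K where "K = C + max 0 (- ln \<epsilon> / \<theta>)"
  have K: "K \<ge> 0" using C by (simp add: K_def)
  have "- ln \<epsilon> / \<theta> \<le> K - C" by (simp add: K_def)
  then have "- ln \<epsilon> \<le> \<theta> * (K - C)" using \<theta> by (simp add: field_simps)
  then have "exp (- \<theta> * (K - C)) \<le> exp (ln \<epsilon>)" by (subst exp_le_cancel_iff) linarith
  then have K\<epsilon>: "exp (- \<theta> * (K - C)) \<le> \<epsilon>" using \<epsilon> by simp
  have "measure (future F0 \<sigma> j h) {g. plays_pattern u w N g} \<ge> 1 - \<epsilon>"
    if h: "length h = N" "score h > K"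
      and \<sigma>: "\<And>g. N \<le> length g \<Longrightarrow> take N g = h \<Longrightarrow> \<sigma> g = of_bool (pattern u w ((length g - N) div k))"
    for N h \<sigma> j
  proof -
    interpret p: play k init F0 \<sigma> "agent_opt v \<pi>0" .
    define I where "I g \<longleftrightarrow> N \<le> length g \<and> take N g = h \<and> plays_pattern u w N g \<and> score g > 0" for g
    \<comment> \<open>The accumulated drift discounts the exponential of the martingale's fall,
      making a supermartingale. It starts at \<open>exp (- \<theta> * (K - C))\<close>, and at a
      nonpositive score the drift bound forces it to at least 1.\<close>
    define \<phi> where "\<phi> g = exp (- \<theta> * (mart g - mart h) - \<theta> * ?d * (real (length g) - real N) - \<theta> * (K - C))" for g
    have plays: "plays_pattern u w N (g @ [x])" if "I g" "x \<in> set_pmf (p.step g)" for g x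
    proof -
      have "\<sigma> g = of_bool (pattern u w ((length g - N) div k))" using \<sigma> that(1) by (simp add: I_def)
      then have "action x = pattern u w ((length g - N) div k)"
        using accept[OF that(2)] no_accept[OF that(2)] that(1) unfolding I_def by (cases "pattern u w ((length g - N) div k)") auto
      then show ?thesis using that(1) by (auto simp: I_def plays_pattern_def nth_append less_Suc_eq)
    qed
    have "measure (p.future j h) {g. \<not> I g} \<le> \<phi> h"
    proof (rule p.exit_bound)
      fix g assume "I g"
      have "measure_pmf.expectation (p.step g) (\<lambda>x. \<phi> (g @ [x]))
          = measure_pmf.expectation (p.step g) (\<lambda>x. exp (\<theta> * mart h - \<theta> * ?d * (real (length g) + 1 - real N) - \<theta> * (K - C)) * exp (- \<theta> * mart (g @ [x])))"
        by (simp add: \<phi>_def exp_add[symmetric] algebra_simps)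
      also have "\<dots> = exp (\<theta> * mart h - \<theta> * ?d * (real (length g) + 1 - real N) - \<theta> * (K - C)) * measure_pmf.expectation (p.step g) (\<lambda>x. exp (- \<theta> * mart (g @ [x])))"
        by simp
      also have "\<dots> \<le> exp (\<theta> * mart h - \<theta> * ?d * (real (length g) + 1 - real N) - \<theta> * (K - C)) * (exp (\<theta> * ?d) * exp (- \<theta> * mart g))"
        using mart_exp_expectation[of \<sigma> g "- \<theta>"] by (intro mult_left_mono) (auto simp: \<theta>d)
      also have "\<dots> = \<phi> g"
        by (simp add: \<phi>_def exp_add[symmetric] algebra_simps)
      finally show "measure_pmf.expectation (p.step g) (\<lambda>x. \<phi> (g @ [x])) \<le> \<phi> g" .
    next
      fix g x assume g: "I g" "x \<in> set_pmf (p.step g)" "\<not> I (g @ [x])"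
      let ?g = "g @ [x]"
      have pl: "plays_pattern u w N ?g" "N \<le> length ?g" "take N ?g = h" using plays[OF g(1,2)] g(1) by (auto simp: I_def)
      then have "score ?g \<le> 0" using g(3) unfolding I_def by auto
      then have "mart ?g - mart h \<le> - K - (?d * (real (length ?g) - real N) - C)"
        using drift[OF pl(2,1)] h(2) unfolding mart_def pl(3) by linarith
      then have "\<theta> * (mart ?g - mart h) \<le> \<theta> * (- K - (?d * (real (length ?g) - real N) - C))"
        using \<theta> by (intro mult_left_mono) auto
      then have "0 \<le> - \<theta> * (mart ?g - mart h) - \<theta> * ?d * (real (length ?g) - real N) - \<theta> * (K - C)"
        by (simp add: algebra_simps)
      then show "1 \<le> \<phi> ?g" unfolding \<phi>_def by simp
    qed (use h K in \<open>auto simp: \<phi>_def I_def plays_pattern_def\<close>)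
    also have "\<phi> h \<le> \<epsilon>" using K\<epsilon> h(1) by (simp add: \<phi>_def)
    finally have "1 - \<epsilon> \<le> measure (p.future j h) {g. I g}"
      using measure_pmf_Not[of "p.future j h" I] by simp
    also have "\<dots> \<le> measure (p.future j h) {g. plays_pattern u w N g}"
      by (rule measure_pmf.finite_measure_mono) (auto simp: I_def)
    finally show ?thesis .
  qed
  then show ?thesis using K by blast
qed

section \<open>The value\<close>

lemma avg_payoff_eq:
  "avg_payoff v k init \<pi>0 \<sigma> n
    = pmf \<pi>0 F1 * measure_pmf.expectation (future F1 \<sigma> n []) (\<lambda>h. count h / real n)
      + pmf \<pi>0 F0 * measure_pmf.expectation (future F0 \<sigma> n []) (\<lambda>h. count h / real n)"
proof -
  let ?P = "PiM UNIV play_algebra :: (nat \<Rightarrow> 'y period) measure"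
  have ne: "F0 \<noteq> F1" using distinct by auto
  note [measurable] = measurable_prefix
  have cnt: "(\<Sum>s<n. of_bool (action (\<omega> s)) :: real) = count (prefix \<omega> n)" for \<omega> :: "nat \<Rightarrow> 'y period"
    by (simp add: count_def)
  have meas: "(\<lambda>\<omega>. count (prefix \<omega> n)) \<in> borel_measurable ?P"
    by (rule measurable_compose[OF measurable_prefix]) simp
  have bnd: "\<bar>count (prefix \<omega> n)\<bar> \<le> real n" for \<omega> :: "nat \<Rightarrow> 'y period"
    using count_nonneg[of "prefix \<omega> n"] count_le[of "prefix \<omega> n"] by simp
  have prob: "prob_space (law F \<sigma>)" for F by (rule prob_space_play_measure)
  have kern: "(\<lambda>F. law F \<sigma>) \<in> measurable (measure_pmf \<pi>0) (subprob_algebra ?P)"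
  proof -
    have "(\<lambda>F. law F \<sigma>) \<in> UNIV \<rightarrow> space (subprob_algebra ?P)"
      using prob by (auto simp: space_subprob_algebra sets_play_measure intro: prob_space_imp_subprob_space)
    then show ?thesis by simp
  qed
  have "(\<integral>\<omega>. (\<Sum>s<n. of_bool (action (\<omega> s))) \<partial>ex_ante_measure k init \<pi>0 \<sigma> (agent_opt v \<pi>0))
      = (\<integral>F. (\<integral>\<omega>. count (prefix \<omega> n) \<partial>law F \<sigma>) \<partial>measure_pmf \<pi>0)"
    unfolding ex_ante_measure_def cnt
  proof (rule integral_bind[where K="?P" and B="real n" and B'=1])
    show "AE F in measure_pmf \<pi>0. emeasure (law F \<sigma>) (space (law F \<sigma>)) \<le> ennreal 1"
      using prob_space.emeasure_space_1[OF prob] by simp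
  qed (use meas bnd kern in \<open>auto intro: measure_pmf.finite_measure_axioms\<close>)
  also have "\<dots> = (\<integral>F. measure_pmf.expectation (future F \<sigma> n []) count \<partial>measure_pmf \<pi>0)"
    by (simp add: play.integral_prefix)
  also have "\<dots> = pmf \<pi>0 F1 * measure_pmf.expectation (future F1 \<sigma> n []) count
      + pmf \<pi>0 F0 * measure_pmf.expectation (future F0 \<sigma> n []) count"
    using ne by (subst integral_measure_pmf[of "{F0, F1}"]) (auto simp: prior_support)
  finally show ?thesis by (simp add: avg_payoff_def add_divide_distrib)
qed

lemma freq_expectation_bounds:
  "0 \<le> measure_pmf.expectation (future F \<sigma> n []) (\<lambda>h. count h / real n)"
  "measure_pmf.expectation (future F \<sigma> n []) (\<lambda>h. count h / real n) \<le> 1"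
proof -
  interpret p: play k init F \<sigma> "agent_opt v \<pi>0" .
  show "0 \<le> measure_pmf.expectation (p.future n []) (\<lambda>h. count h / real n)"
    by (intro Bochner_Integration.integral_nonneg) (simp add: count_nonneg)
  have "measure_pmf.expectation (p.future n []) (\<lambda>h. count h / real n) \<le> measure_pmf.expectation (p.future n []) (\<lambda>_. 1)"
  proof (rule integral_mono_pmf_finite)
    fix h assume "h \<in> set_pmf (p.future n [])"
    then have "length h = n" using p.set_future(1) by fastforce
    then show "count h / real n \<le> 1" using count_le[of h] by (auto simp: divide_le_eq_1)
  qed simp
  then show "measure_pmf.expectation (p.future n []) (\<lambda>h. count h / real n) \<le> 1" by simp
qed

lemma q_star_bdd: "bdd_above ((\<lambda>\<sigma>. measure (law F0 \<sigma>) (conviction_event v \<pi>0)) ` strategies)"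
  by (rule bdd_aboveI[of _ 1]) (auto intro: prob_space.prob_le_1[OF prob_space_play_measure])

lemma conviction_le_q_star:
  "\<sigma> \<in> strategies \<Longrightarrow> measure (law F0 \<sigma>) (conviction_event v \<pi>0) \<le> q_star v k init \<pi>0 F0"
  unfolding q_star_def by (rule cSUP_upper[OF _ q_star_bdd])

lemma strategies_nonempty: "(\<lambda>_. 1) \<in> strategies"
  by (simp add: strategies_def)

lemma q_star_bounds: "0 \<le> q_star v k init \<pi>0 F0" "q_star v k init \<pi>0 F0 \<le> 1"
proof -
  show "0 \<le> q_star v k init \<pi>0 F0"
    using order_trans[OF measure_nonneg conviction_le_q_star[OF strategies_nonempty]] .
  show "q_star v k init \<pi>0 F0 \<le> 1"
    unfolding q_star_def using strategies_nonempty
    by (intro cSUP_least) (auto intro: prob_space.prob_le_1[OF prob_space_play_measure])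
qed

section \<open>Upper bound and near-optimal strategies for the target value\<close>

abbreviation target :: real where
  "target \<equiv> pmf \<pi>0 F1 + pmf \<pi>0 F0 * q_star v k init \<pi>0 F0 * lambda_star F0 F1"

lemma avg_payoff_upper:
  assumes \<sigma>: "\<sigma> \<in> strategies" and \<epsilon>: "\<epsilon> > 0"
  shows "\<forall>\<^sub>F n in sequentially. avg_payoff v k init \<pi>0 \<sigma> n \<le> target + \<epsilon>"
  using F0_upper[OF \<epsilon>, of \<sigma>]
proof eventually_elim
  case (elim n)
  let ?E = "\<lambda>F. measure_pmf.expectation (future F \<sigma> n []) (\<lambda>h. count h / real n)"
  have "?E F0 \<le> lambda_star F0 F1 * q_star v k init \<pi>0 F0 + \<epsilon>"
    using elim mult_left_mono[OF conviction_le_q_star[OF \<sigma>] lambda_star_bounds(1)] by simp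
  then have "pmf \<pi>0 F0 * ?E F0 \<le> pmf \<pi>0 F0 * (lambda_star F0 F1 * q_star v k init \<pi>0 F0 + \<epsilon>)"
    by (intro mult_left_mono) auto
  moreover have "pmf \<pi>0 F1 * ?E F1 \<le> pmf \<pi>0 F1 * 1"
    using freq_expectation_bounds(2)[of F1 \<sigma> n] by (intro mult_left_mono) auto
  moreover have "pmf \<pi>0 F0 * \<epsilon> \<le> 1 * \<epsilon>"
    using \<epsilon> by (intro mult_right_mono) (auto simp: pmf_le_1)
  ultimately show ?case unfolding avg_payoff_eq by (simp add: algebra_simps)
qed

text \<open>Feasibility means lying in the interval from 0 up to, but excluding,
  \<open>D / K\<close>. A nearly optimal point can therefore be raised to a feasible rational, a
  ratio of cycle lengths, and \<open>(x + 1) / (x + 2)\<close> increases with it.\<close>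

lemma rational_cycle:
  assumes "lambda_feasible F0 F1 \<noteq> {}" "\<delta> > 0"
  shows "\<exists>u w. w > 0 \<and> pattern_drift_rate u w > 0 \<and>
    (real u + real w) / (real u + 2 * real w) \<ge> lambda_star F0 F1 - \<delta>"
proof -
  define K where "K = - e True True"
  define D where "D = e True False + e False True"
  have K: "K > 0" using llr_mean_neg[of True] by (simp add: K_def)
  have "lambda_star F0 F1 - \<delta> < (SUP x\<in>lambda_feasible F0 F1. (x + 1) / (x + 2))"
    using assms by (simp add: lambda_star_def)
  then obtain x where x: "x \<in> lambda_feasible F0 F1" "lambda_star F0 F1 - \<delta> < (x + 1) / (x + 2)"
    using less_cSUP_iff[OF assms(1) lambda_feasible_image_bdd] by blast
  then have x0: "0 \<le> x" "x < D / K" using K by (auto simp: lambda_feasible_def K_def D_def field_simps)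
  then obtain q where q: "q \<in> \<rat>" "x < q" "q < D / K" using Rats_dense_in_real by blast
  obtain u w :: nat where uw: "w \<noteq> 0" "\<bar>q\<bar> = real u / real w"
    using Rats_abs_nat_div_natE[OF q(1)] by metis
  then have qe: "q = real u / real w" using q x0 by simp
  have w: "real w > 0" using uw by simp
  have "real u * K < real w * D" using q(3) K w unfolding qe by (simp add: field_simps)
  then have num: "0 < real u * e True True + real w * (e True False + e False True)"
    by (simp add: K_def D_def algebra_simps)
  have "(x + 1) / (x + 2) \<le> (q + 1) / (q + 2)" using q x0 by (simp add: field_simps)
  also have "\<dots> = (real u + real w) / (real u + 2 * real w)"
  proof -
    have "q + 1 = (real u + real w) / real w" "q + 2 = (real u + 2 * real w) / real w"
      using w by (simp_all add: qe add_divide_distrib)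
    then show ?thesis using w by simp
  qed
  finally show ?thesis
    using x(2) num w by (intro exI[of _ u] exI[of _ w]) (auto simp: pattern_drift_rate_def intro: divide_pos_pos)
qed

lemma true_llr_swap: "play.true_llr k init F1 F0 h = - play.true_llr k init F0 F1 h"
  by (simp add: play.true_llr_def llr_swap sum_negf)

text \<open>Here \<lambda> is 0 and only state \<open>F1\<close> contributes to the target, so
  proposing action 1 forever suffices.\<close>

lemma lower_strategy_infeasible:
  assumes "lambda_feasible F0 F1 = {}" and \<epsilon>: "\<epsilon> > 0"
  shows "\<exists>\<sigma>\<in>strategies. \<forall>\<^sub>F n in sequentially. target - \<epsilon> \<le> avg_payoff v k init \<pi>0 \<sigma> n"
proof (rule bexI[OF _ strategies_nonempty])
  have "\<forall>\<^sub>F n in sequentially. measure (future F1 (\<lambda>_. 1) 0 []) {h. True} - \<epsilon>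
      \<le> measure_pmf.expectation (future F1 (\<lambda>_. 1) n []) (\<lambda>h. count h / real n)"
    by (rule F1_lower) (use \<epsilon> in auto)
  then show "\<forall>\<^sub>F n in sequentially. target - \<epsilon> \<le> avg_payoff v k init \<pi>0 (\<lambda>_. 1) n"
  proof eventually_elim
    case (elim n)
    let ?E = "\<lambda>F. measure_pmf.expectation (future F (\<lambda>_. 1) n []) (\<lambda>h. count h / real n)"
    have "pmf \<pi>0 F1 * (1 - \<epsilon>) \<le> pmf \<pi>0 F1 * ?E F1"
      using elim by (intro mult_left_mono) auto
    moreover have "0 \<le> pmf \<pi>0 F0 * ?E F0"
      using freq_expectation_bounds(1) by (intro mult_nonneg_nonneg) auto
    moreover have "pmf \<pi>0 F1 * \<epsilon> \<le> 1 * \<epsilon>"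
      using \<epsilon> by (intro mult_right_mono) (auto simp: pmf_le_1)
    ultimately show ?case using assms(1) unfolding avg_payoff_eq
      by (simp add: lambda_star_def algebra_simps)
  qed
qed

text \<open>
  For \<open>N\<close> periods the principal follows a strategy that is nearly optimal for conviction. By then the
  correctly specified likelihood ratio reveals the state with high probability; in state \<open>F1\<close>
  action 1 is proposed forever, in state \<open>F0\<close> the cyclic pattern is played.
\<close>

lemma lower_strategy_feasible:
  assumes feas: "lambda_feasible F0 F1 \<noteq> {}" and \<epsilon>: "\<epsilon> > 0"
  shows "\<exists>\<sigma>\<in>strategies. \<forall>\<^sub>F n in sequentially. target - \<epsilon> \<le> avg_payoff v k init \<pi>0 \<sigma> n"
proof -
  \<comment> \<open>The error budget: \<open>2 * \<delta>\<close> in state \<open>F1\<close> and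
    \<open>6 * \<delta>\<close> in state \<open>F0\<close>.\<close>
  define \<delta> where "\<delta> = \<epsilon> / 8"
  have \<delta>: "\<delta> > 0" using \<epsilon> by (simp add: \<delta>_def)
  let ?q = "q_star v k init \<pi>0 F0" and ?\<Lambda> = "lambda_star F0 F1"
  let ?R = "play.true_llr k init F0 F1"
  have "?q - \<delta> < (SUP \<sigma>\<in>strategies. measure (law F0 \<sigma>) (conviction_event v \<pi>0))"
    using \<delta> by (simp add: q_star_def)
  then obtain \<sigma> where \<sigma>: "\<sigma> \<in> strategies" "?q - \<delta> < measure (law F0 \<sigma>) (conviction_event v \<pi>0)"
    using less_cSUP_iff[OF _ q_star_bdd] strategies_nonempty by blast
  obtain u w where w: "w > 0" "pattern_drift_rate u w > 0"
    and f_ge: "(real u + real w) / (real u + 2 * real w) \<ge> ?\<Lambda> - \<delta>"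
    using rational_cycle[OF feas \<delta>] by blast
  define f where "f = (real u + real w) / (real u + 2 * real w)"
  have f: "0 \<le> f" "f \<le> 1" "f \<ge> ?\<Lambda> - \<delta>" using w f_ge by (auto simp: f_def divide_le_eq_1)
  obtain C where C: "C \<ge> 0" "\<And>N g. N \<le> length g \<Longrightarrow> plays_pattern u w N g \<Longrightarrow>
      count g \<ge> f * (real (length g) - real N) - C"
    using pattern_count[OF w(1), of u] unfolding f_def by blast
  obtain K where K: "\<And>N h \<sigma> j. length h = N \<Longrightarrow> score h > K \<Longrightarrow>
      (\<And>g. N \<le> length g \<Longrightarrow> take N g = h \<Longrightarrow> \<sigma> g = of_bool (pattern u w ((length g - N) div k))) \<Longrightarrow>
      measure (future F0 \<sigma> j h) {g. plays_pattern u w N g} \<ge> 1 - \<delta>"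
    using pattern_keeps_conviction[OF w \<delta>] by meson
  interpret p0: play k init F0 \<sigma> "agent_opt v \<pi>0" .
  interpret p1: play k init F1 \<sigma> "agent_opt v \<pi>0" .
  obtain \<rho>0 where \<rho>0: "\<rho>0 \<ge> 0" "\<rho>0 < 1"
    and decay0: "\<And>n c. measure (p0.future n []) {h. p0.true_llr F0 F1 h \<ge> c} \<le> exp (- c / 2) * \<rho>0 ^ n"
    using p0.true_llr_exponential_decay[of F1] full_support distinct by metis
  obtain \<rho>1 where \<rho>1: "\<rho>1 \<ge> 0" "\<rho>1 < 1"
    and decay1: "\<And>n c. measure (p1.future n []) {h. p1.true_llr F1 F0 h \<ge> c} \<le> exp (- c / 2) * \<rho>1 ^ n"
    using p1.true_llr_exponential_decay[of F0] full_support distinct by metis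
  have "(\<lambda>n. \<rho>0 ^ n) \<longlonglongrightarrow> 0" "(\<lambda>n. \<rho>1 ^ n) \<longlonglongrightarrow> 0"
    using \<rho>0 \<rho>1 by (auto intro: LIMSEQ_power_zero)
  then have "\<forall>\<^sub>F n in sequentially. \<rho>0 ^ n < \<delta> \<and> \<rho>1 ^ n < \<delta>"
    using \<delta> by (intro eventually_conj order_tendstoD(2)) auto
  then obtain n1 where n1: "\<And>n. n \<ge> n1 \<Longrightarrow> \<rho>0 ^ n < \<delta> \<and> \<rho>1 ^ n < \<delta>"
    by (auto simp: eventually_sequentially)
  obtain n2 where n2: "\<And>n. n \<ge> n2 \<Longrightarrow> p0.prob {\<omega>. \<exists>t. \<forall>s\<ge>t. K < score (prefix \<omega> s)} - \<delta> \<le> measure (p0.future n []) {h. K < score h}"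
    using p0.prob_eventually_le[OF \<delta>, of "\<lambda>h. K < score h"] by blast
  define N where "N = max n1 n2"
  have "p0.prob (conviction_event v \<pi>0) \<le> p0.prob {\<omega>. \<exists>t. \<forall>s\<ge>t. K < score (prefix \<omega> s)}"
    using F0_conviction_diverges[of \<sigma>]
    by (intro p0.finite_measure_mono_AE p0.eventually_sets) auto
  then have high: "measure (p0.future N []) {h. K < score h} \<ge> ?q - 2 * \<delta>"
    using n2[of N] \<sigma>(2) by (simp add: N_def)
  have test0: "measure (p0.future N []) {h. 0 \<le> ?R h} \<le> \<delta>"
    using decay0[of N 0] n1[of N] by (simp add: N_def)
  have test1: "measure (p1.future N []) {h. 0 < ?R h} \<ge> 1 - \<delta>"
  proof -
    have "measure (p1.future N []) {h. \<not> 0 < ?R h} \<le> \<delta>"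
      using decay1[of N 0] n1[of N] by (simp add: N_def true_llr_swap not_less)
    then show ?thesis using measure_pmf_Not[of "p1.future N []" "\<lambda>h. 0 < ?R h"] by simp
  qed
  \<comment> \<open>The test reads only the first \<open>N\<close> periods, so its verdict is never
    revised.\<close>
  define \<tau> where "\<tau> h = (if length h < N then \<sigma> h else if 0 < ?R (take N h) then 1
    else of_bool (pattern u w ((length h - N) div k)))" for h
  have \<tau>: "\<tau> \<in> strategies" using \<sigma>(1) by (auto simp: strategies_def \<tau>_def Pi_iff)
  have fut: "future F \<tau> N [] = future F \<sigma> N []" for F
    by (rule play_future_cong[where N=N]) (auto simp: \<tau>_def)
  interpret t0: play k init F0 \<tau> "agent_opt v \<pi>0" .
  let ?B = "{h. K < score h \<and> \<not> 0 < ?R h}"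
  define b where "b = measure (t0.future N []) ?B"
  \<comment> \<open>The three losses come from the near-optimality of \<open>\<sigma>\<close>, from
    stopping at the finite time \<open>N\<close>, and from a wrong verdict of the test.\<close>
  have b: "b \<ge> ?q - 3 * \<delta>" "0 \<le> b" "b \<le> 1"
  proof -
    have "measure (p0.future N []) {h. K < score h} \<le> measure (p0.future N []) (?B \<union> {h. 0 \<le> ?R h})"
      by (rule measure_pmf.finite_measure_mono) auto
    also have "\<dots> \<le> measure (p0.future N []) ?B + measure (p0.future N []) {h. 0 \<le> ?R h}"
      by (rule measure_Un_le) auto
    finally show "b \<ge> ?q - 3 * \<delta>" using high test0 by (simp add: b_def fut)
  qed (auto simp: b_def)
  \<comment> \<open>The condition keeps the factor \<open>1 - \<delta>\<close> nonnegative. For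
    larger \<open>\<delta>\<close> the claim about state \<open>F0\<close> is trivial, as its left
    side is negative.\<close>
  have pat: "measure (t0.future (N + j) []) {g. plays_pattern u w N g} \<ge> b * (1 - \<delta>)" if "\<delta> \<le> 1" for j
  proof (rule t0.future_add_bound)
    fix h assume h: "h \<in> ?B" "h \<in> set_pmf (t0.future N [])"
    then have len: "length h = N" using t0.set_future(1) by fastforce
    show "1 - \<delta> \<le> measure (t0.future j h) {g. plays_pattern u w N g}"
      by (rule K[OF len]) (use h in \<open>auto simp: \<tau>_def\<close>)
  qed (use that in \<open>auto simp: b_def\<close>)
  have E0: "\<forall>\<^sub>F n in sequentially. ?q * ?\<Lambda> - 6 * \<delta> \<le> measure_pmf.expectation (t0.future n []) (\<lambda>h. count h / real n)"
  proof (cases "\<delta> \<le> 1")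
    case True
    have "(\<lambda>n. b * (1 - \<delta>) * ((f * (real n - real N) - C) / real n)) \<longlonglongrightarrow> b * (1 - \<delta>) * f"
      by (intro tendsto_mult tendsto_const) real_asymp
    then have "\<forall>\<^sub>F n in sequentially. b * (1 - \<delta>) * f - \<delta> < b * (1 - \<delta>) * ((f * (real n - real N) - C) / real n)"
      using \<delta> by (intro order_tendstoD(1)) auto
    then show ?thesis
      using eventually_gt_at_top[of N]
    proof eventually_elim
      case (elim n)
      let ?a = "(f * (real n - real N) - C) / real n"
      have E_nonneg: "0 \<le> measure_pmf.expectation (t0.future n []) (\<lambda>h. count h / real n)"
        by (rule freq_expectation_bounds)
      have "b * (1 - \<delta>) * ?a \<le> measure_pmf.expectation (t0.future n []) (\<lambda>h. count h / real n)"
      proof (cases "?a \<ge> 0")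
        case a: True
        have "b * (1 - \<delta>) * ?a \<le> measure (t0.future n []) {g. plays_pattern u w N g} * ?a"
          using pat[OF True, of "n - N"] elim a by (intro mult_right_mono) auto
        also have "\<dots> = measure_pmf.expectation (t0.future n []) (\<lambda>h. indicator {g. plays_pattern u w N g} h * ?a)"
          by simp
        also have "\<dots> \<le> measure_pmf.expectation (t0.future n []) (\<lambda>h. count h / real n)"
        proof (rule integral_mono_pmf_finite)
          fix h assume "h \<in> set_pmf (t0.future n [])"
          then have "length h = n" using t0.set_future(1) by fastforce
          then show "indicator {g. plays_pattern u w N g} h * ?a \<le> count h / real n"
            using C(2)[of N h] elim count_nonneg[of h] by (auto simp: indicator_def divide_right_mono)
        qed simp
        finally show ?thesis .
      next
        case False
        then have "b * (1 - \<delta>) * ?a \<le> 0" using b True by (intro mult_nonneg_nonpos) auto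
        then show ?thesis using E_nonneg by linarith
      qed
      then have 1: "b * (1 - \<delta>) * f - \<delta> \<le> measure_pmf.expectation (t0.future n []) (\<lambda>h. count h / real n)"
        using elim by linarith
      have "b * f * \<delta> \<le> 1 * \<delta>" using b f \<delta> by (intro mult_right_mono) (auto intro: mult_le_one)
      moreover have "(?q - 3 * \<delta>) * f \<le> b * f" using b f by (intro mult_right_mono) auto
      moreover have "\<delta> * f \<le> \<delta> * 1" using f \<delta> by (intro mult_left_mono) auto
      moreover have "?q * (?\<Lambda> - \<delta>) \<le> ?q * f" using f q_star_bounds by (intro mult_left_mono) auto
      moreover have "?q * \<delta> \<le> 1 * \<delta>" using q_star_bounds \<delta> by (intro mult_right_mono) auto
      ultimately have "?q * ?\<Lambda> - 6 * \<delta> \<le> b * (1 - \<delta>) * f - \<delta>" by (simp add: algebra_simps)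
      then show ?case using 1 by linarith
    qed
  next
    case False
    have "?q * ?\<Lambda> \<le> 1" using q_star_bounds lambda_star_bounds by (intro mult_le_one) auto
    then have "?q * ?\<Lambda> - 6 * \<delta> \<le> 0" using False by linarith
    then show ?thesis using freq_expectation_bounds(1)[of F0 \<tau>] by (intro always_eventually allI) (meson order_trans)
  qed
  have "\<forall>\<^sub>F n in sequentially. measure (future F1 \<tau> N []) {h. 0 < ?R h} - \<delta>
      \<le> measure_pmf.expectation (future F1 \<tau> n []) (\<lambda>h. count h / real n)"
    by (rule F1_lower[OF _ \<delta>]) (simp add: \<tau>_def)
  then have "\<forall>\<^sub>F n in sequentially. target - \<epsilon> \<le> avg_payoff v k init \<pi>0 \<tau> n"
    using E0
  proof eventually_elim
    case (elim n)
    let ?E = "\<lambda>F. measure_pmf.expectation (future F \<tau> n []) (\<lambda>h. count h / real n)"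
    have "1 - 2 * \<delta> \<le> ?E F1" using elim(1) test1 by (simp add: fut)
    then have "pmf \<pi>0 F1 * (1 - 2 * \<delta>) \<le> pmf \<pi>0 F1 * ?E F1" by (intro mult_left_mono) auto
    moreover have "pmf \<pi>0 F0 * (?q * ?\<Lambda> - 6 * \<delta>) \<le> pmf \<pi>0 F0 * ?E F0"
      using elim(2) by (intro mult_left_mono) auto
    moreover have "pmf \<pi>0 F1 * \<delta> \<le> 1 * \<delta>" "pmf \<pi>0 F0 * \<delta> \<le> 1 * \<delta>"
      using \<delta> by (auto intro!: mult_right_mono simp: pmf_le_1 simp del: mult_1)
    ultimately show ?case unfolding avg_payoff_eq by (simp add: \<delta>_def algebra_simps)
  qed
  then show ?thesis using \<tau> by blast
qed

lemma lower_strategy: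
  assumes "\<epsilon> > 0"
  shows "\<exists>\<sigma>\<in>strategies. \<forall>\<^sub>F n in sequentially. target - \<epsilon> \<le> avg_payoff v k init \<pi>0 \<sigma> n"
  using lower_strategy_feasible[OF _ assms] lower_strategy_infeasible[OF _ assms] by blast

lemma values_eq_target: "upper_value v k init \<pi>0 = ereal target" "lower_value v k init \<pi>0 = ereal target"
proof -
  have up: "upper_value v k init \<pi>0 \<le> ereal target"
    unfolding upper_value_def
  proof (rule SUP_least)
    fix \<sigma> :: "'y strategy" assume \<sigma>: "\<sigma> \<in> strategies"
    show "limsup (\<lambda>t. ereal (avg_payoff v k init \<pi>0 \<sigma> t)) \<le> ereal target"
    proof (rule ereal_le_epsilon2)
      fix \<epsilon> :: real assume "0 < \<epsilon>"
      from avg_payoff_upper[OF \<sigma> this]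
      have "limsup (\<lambda>t. ereal (avg_payoff v k init \<pi>0 \<sigma> t)) \<le> ereal (target + \<epsilon>)"
        by (intro Limsup_bounded) (auto elim: eventually_mono)
      then show "limsup (\<lambda>t. ereal (avg_payoff v k init \<pi>0 \<sigma> t)) \<le> ereal target + ereal \<epsilon>"
        by simp
    qed
  qed
  have low: "ereal target \<le> lower_value v k init \<pi>0"
  proof (rule ereal_le_epsilon2)
    fix \<epsilon> :: real assume "0 < \<epsilon>"
    from lower_strategy[OF this] obtain \<sigma> where \<sigma>: "\<sigma> \<in> strategies"
      and ev: "\<forall>\<^sub>F n in sequentially. target - \<epsilon> \<le> avg_payoff v k init \<pi>0 \<sigma> n" by blast
    have "ereal (target - \<epsilon>) \<le> liminf (\<lambda>t. ereal (avg_payoff v k init \<pi>0 \<sigma> t))"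
      using ev by (intro Liminf_bounded) (auto elim: eventually_mono)
    also have "\<dots> \<le> lower_value v k init \<pi>0"
      unfolding lower_value_def by (rule SUP_upper[OF \<sigma>])
    finally have "ereal (target - \<epsilon>) + ereal \<epsilon> \<le> lower_value v k init \<pi>0 + ereal \<epsilon>"
      by (rule add_right_mono)
    then show "ereal target \<le> lower_value v k init \<pi>0 + ereal \<epsilon>" by simp
  qed
  have "lower_value v k init \<pi>0 \<le> upper_value v k init \<pi>0"
    unfolding lower_value_def upper_value_def
    by (intro SUP_mono' Liminf_le_Limsup) auto
  then show "upper_value v k init \<pi>0 = ereal target" "lower_value v k init \<pi>0 = ereal target"
    using up low by (auto intro: antisym order_trans)
qed

end

theorem theorem2:
  fixes v :: "'y::finite \<Rightarrow> real"
    and k :: nat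
    and init :: "int \<Rightarrow> bool"
    and F0 F1 :: "'y state"
    and \<pi>0 :: "'y state pmf"
  assumes lag: "k \<ge> 1"
    and full_support: "\<And>a. set_pmf (F0 a) = UNIV" "\<And>a. set_pmf (F1 a) = UNIV"
    and distinct: "\<And>a. F0 a \<noteq> F1 a"
    and best_reply1: "(\<Sum>y\<in>UNIV. v y * pmf (F1 True) y) > (\<Sum>y\<in>UNIV. v y * pmf (F1 False) y)"
    and best_reply0: "(\<Sum>y\<in>UNIV. v y * pmf (F0 False) y) > (\<Sum>y\<in>UNIV. v y * pmf (F0 True) y)"
    and prior_support: "set_pmf \<pi>0 = {F0, F1}"
    and never_indifferent: "\<And>h. h \<in> histories \<Longrightarrow> \<not> indifferent v \<pi>0 h"
  shows "upper_value v k init \<pi>0 = lower_value v k init \<pi>0 \<and>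
         lower_value v k init \<pi>0 =
           ereal (pmf \<pi>0 F1 + pmf \<pi>0 F0 * q_star v k init \<pi>0 F0 * lambda_star F0 F1)"
proof -
  interpret game v k init F0 F1 \<pi>0
    by unfold_locales (use assms in \<open>auto simp: payoff_def\<close>)
  show ?thesis by (simp add: values_eq_target)
qed

end
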